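(* Let $n\ge2$ and let $B=B_1(0)$ be the open unit ball in $\mathbb{R}^n$. Assume $h\in C(\mathbb{R})$ is one-to-one, $p\ge\frac{n}{n-1}$ and $\phi\in W^{1,p}_{loc}(0,1)$. Let $u(x)=\phi(|x|)x$ be a weak solution of $$\operatorname{div}\big(h(\det Du)\operatorname{cof} Du\big)=0\quad\text{in }B$$ such that $h(\det Du)\operatorname{cof}Du\in L^{\frac{p}{p-1}}_{loc}(B;\mathbb{M}^{n\times n})$. Then either $\phi\equiv0$, or $$\phi(r)=\Big(\lambda+\frac{c}{r^n}\Big)^{1/n}\ne0\qquad\forall\,0<r<1,$$ where $\lambda$ and $c$ are constants. (When $n$ is even, it is required that $\lambda+\frac{c}{r^n}>0$ in $(0,1)$, and there are two nonzero branches, positive and negative, of the $n$-th root.)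
   Context: $\mathbb{M}^{n\times n}$ is the space of real $n\times n$ matrices with inner product $A:B=\sum_{i,j}A^i_jB^i_j$; $\operatorname{cof}A$ is the cofactor matrix, so that $A^T\operatorname{cof}A=(\operatorname{cof}A)A^T=(\det A)I$. $Du$ is the Jacobian matrix, $(Du)^i_j=\partial u^i/\partial x_j$. Functions in $W^{1,p}_{loc}(0,1)$ are identified with their continuous representatives. A function $u\in W^{1,1}_{loc}(B;\mathbb{R}^n)$ is a weak solution of $\operatorname{div}(h(\det Du)\operatorname{cof}Du)=0$ in $B$ if $h(\det Du)\operatorname{cof}Du\in L^1_{loc}(B;\mathbb{M}^{n\times n})$ and $\int_B h(\det Du)\operatorname{cof}Du:D\zeta\,dx=0$ for all $\zeta\in C^1_c(B;\mathbb{R}^n)$. *)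

theory Defs
  imports "HOL-Analysis.Analysis"
begin

section \<open>Cofactor matrix\<close>

text \<open>The index type carries no order, so the signed minor \<open>(-1)\<^sup>i\<^sup>+\<^sup>j M\<^sub>i\<^sub>j\<close> is written as the
  determinant of the matrix whose \<open>i\<close>-th row and \<open>j\<close>-th column are replaced by unit vectors.\<close>

definition cof :: "real^'n^'n \<Rightarrow> real^'n^'n" where
  "cof A = (\<chi> i j. det (\<chi> k l. if k = i \<and> l = j then 1
                                else if k = i \<or> l = j then 0 else A $ k $ l))"

lemma cof_transpose: "cof (transpose A) = transpose (cof A)"
proof -
  have "det (\<chi> k l. if k = i \<and> l = j then 1 else if k = i \<or> l = j then 0 else A $ l $ k)
      = det (\<chi> k l. if k = j \<and> l = i then 1 else if k = j \<or> l = i then 0 else A $ k $ l)" for i j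
  proof -
    have "(\<chi> k l. if k = i \<and> l = j then 1 else if k = i \<or> l = j then 0 else A $ l $ k)
        = transpose (\<chi> k l. if k = j \<and> l = i then 1 else if k = j \<or> l = i then 0 else A $ k $ l)"
      by (auto simp: vec_eq_iff transpose_def)
    then show ?thesis by (simp only: det_transpose)
  qed
  then show ?thesis
    by (simp add: vec_eq_iff cof_def transpose_def cong: if_cong)
qed

lemma cof_nth_row:
  "cof A $ i $ j = det (\<chi> k. if k = i then axis j 1 else A $ k)"
proof -
  let ?L = "(\<chi> k l. if k = i \<and> l = j then 1 else if k = i \<or> l = j then 0 else A $ k $ l)"
  let ?R = "(\<chi> k. if k = i then axis j 1 else A $ k)"
  have "(\<Prod>k\<in>UNIV. ?L $ k $ p k) = (\<Prod>k\<in>UNIV. ?R $ k $ p k)" if "p permutes UNIV" for p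
  proof (cases "p i = j")
    case True
    have "p k = j \<longleftrightarrow> k = i" for k
      using permutes_inj[OF that] True by (auto dest: injD)
    then show ?thesis by (intro prod.cong) (auto simp: axis_def)
  next
    case False
    then have "?L $ i $ p i = 0" "?R $ i $ p i = 0" by (auto simp: axis_def)
    then have "(\<Prod>k\<in>UNIV. ?L $ k $ p k) = 0" "(\<Prod>k\<in>UNIV. ?R $ k $ p k) = 0"
      by (metis (no_types, lifting) UNIV_I finite prod_zero)+
    then show ?thesis by (simp only:)
  qed
  then have "det ?L = det ?R"
    unfolding det_def by (intro sum.cong) auto
  then show ?thesis by (simp add: cof_def)
qed

lemma cof_mult_transpose: "cof A ** transpose A = det A *\<^sub>R mat 1"
proof -
  have "(\<Sum>k\<in>UNIV. cof A $ i $ k * A $ j $ k) = (if i = j then det A else 0)" for i j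
  proof -
    have "(\<Sum>k\<in>UNIV. cof A $ i $ k * A $ j $ k)
        = (\<Sum>k\<in>UNIV. det (\<chi> l. if l = i then (A $ j $ k) *s axis k 1 else A $ l))"
      by (simp add: cof_nth_row det_row_mul mult.commute)
    also have "\<dots> = det (\<chi> l. if l = i then (\<Sum>k\<in>UNIV. (A $ j $ k) *s axis k 1) else A $ l)"
      by (rule det_linear_row_sum[symmetric]) simp
    also have "\<dots> = det (\<chi> l. if l = i then A $ j else A $ l)"
      by (simp add: basis_expansion cong: if_cong)
    also have "\<dots> = (if i = j then det A else 0)"
    proof (cases "i = j")
      case True
      then have "(\<chi> l. if l = i then A $ j else A $ l) = A" by (auto simp: vec_eq_iff)
      with True show ?thesis by simp
    next
      case False
      then have "det (\<chi> l. if l = i then A $ j else A $ l) = 0"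
        by (intro det_identical_rows[OF False]) (auto simp: row_def vec_eq_iff)
      with False show ?thesis by simp
    qed
    finally show ?thesis .
  qed
  then show ?thesis
    by (simp add: vec_eq_iff matrix_matrix_mult_def transpose_def mat_def)
qed

lemma transpose_mult_cof: "transpose A ** cof A = det A *\<^sub>R mat 1"
proof -
  have "transpose (transpose A ** cof A) = cof (transpose A) ** transpose (transpose A)"
    by (simp add: matrix_transpose_mul cof_transpose)
  also have "\<dots> = det A *\<^sub>R mat 1" by (simp add: cof_mult_transpose del: transpose_transpose)
  finally have "transpose A ** cof A = transpose (det A *\<^sub>R mat 1)" by (metis transpose_transpose)
  then show ?thesis by (simp add: vec_eq_iff transpose_def mat_def)
qed


section \<open>Local Sobolev spaces and weak derivatives\<close>

text \<open>For real \<open>p \<ge> 1\<close>.\<close>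

definition Lp_loc :: "real \<Rightarrow> 'a::euclidean_space set \<Rightarrow> ('a \<Rightarrow> 'b::euclidean_space) \<Rightarrow> bool" where
  "Lp_loc p S f \<longleftrightarrow> f \<in> borel_measurable (lebesgue_on S) \<and>
     (\<forall>K. compact K \<and> K \<subseteq> S \<longrightarrow> set_integrable lebesgue K (\<lambda>x. norm (f x) powr p))"

text \<open>\<open>C\<^sup>1\<^sub>c(S)\<close>; a test function on \<open>S\<close> is represented by its extension by zero to the whole space.\<close>

definition C1c :: "'a::euclidean_space set \<Rightarrow> ('a \<Rightarrow> 'b::euclidean_space) set" where
  "C1c S = {\<zeta>. (\<forall>x. \<zeta> differentiable (at x)) \<and>
                (\<forall>v. continuous_on UNIV (\<lambda>x. frechet_derivative \<zeta> (at x) v)) \<and>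
                compact (closure {x. \<zeta> x \<noteq> 0}) \<and> closure {x. \<zeta> x \<noteq> 0} \<subseteq> S}"

text \<open>\<open>g\<close> is the weak derivative of \<open>f\<close> in \<open>S\<close> in direction \<open>v\<close>. Testing with \<open>C\<^sup>1\<^sub>c\<close> is equivalent
  to testing with \<open>C\<^sup>\<infinity>\<^sub>c\<close>, by mollification.\<close>

definition weak_partial ::
    "'a::euclidean_space set \<Rightarrow> ('a \<Rightarrow> 'b::euclidean_space) \<Rightarrow> 'a \<Rightarrow> ('a \<Rightarrow> 'b) \<Rightarrow> bool" where
  "weak_partial S f v g \<longleftrightarrow> Lp_loc 1 S f \<and> Lp_loc 1 S g \<and>
     (\<forall>\<eta> \<in> C1c S. (LINT x:S|lebesgue. frechet_derivative \<eta> (at x) v *\<^sub>R f x)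
                 = - (LINT x:S|lebesgue. (\<eta> x :: real) *\<^sub>R g x))"

definition W1p_loc :: "real \<Rightarrow> 'a::euclidean_space set \<Rightarrow> ('a \<Rightarrow> 'b::euclidean_space) \<Rightarrow> bool" where
  "W1p_loc p S f \<longleftrightarrow> Lp_loc p S f \<and> (\<forall>b\<in>Basis. \<exists>g. Lp_loc p S g \<and> weak_partial S f b g)"

text \<open>The weak Jacobian matrix \<open>(Du)\<^sup>i\<^sub>j = \<partial>u\<^sup>i/\<partial>x\<^sub>j\<close>. It is determined only almost everywhere, so the
  choice below fixes a representative; it is meaningful for \<open>u \<in> W\<^sup>1\<^sup>,\<^sup>1\<^sub>l\<^sub>o\<^sub>c(S)\<close>.\<close>

definition weak_jacobian :: "(real^'n) set \<Rightarrow> (real^'n \<Rightarrow> real^'m) \<Rightarrow> real^'n \<Rightarrow> real^'n^'m" where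
  "weak_jacobian S u =
     (SOME G. \<forall>i j. weak_partial S (\<lambda>x. u x $ i) (axis j 1) (\<lambda>x. G x $ i $ j))"


section \<open>Weak solutions of \<open>div (h (det Du) cof Du) = 0\<close>\<close>

definition flux :: "(real \<Rightarrow> real) \<Rightarrow> (real^'n) set \<Rightarrow> (real^'n \<Rightarrow> real^'n) \<Rightarrow> real^'n \<Rightarrow> real^'n^'n" where
  "flux h S u x = h (det (weak_jacobian S u x)) *\<^sub>R cof (weak_jacobian S u x)"

text \<open>The inner product of \<^typ>\<open>real^'n^'n\<close> is \<open>A : B = \<Sum>\<^sub>i\<^sub>,\<^sub>j A\<^sup>i\<^sub>j B\<^sup>i\<^sub>j\<close>.\<close>

definition weak_solution :: "(real \<Rightarrow> real) \<Rightarrow> (real^'n) set \<Rightarrow> (real^'n \<Rightarrow> real^'n) \<Rightarrow> bool" where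
  "weak_solution h S u \<longleftrightarrow> W1p_loc 1 S u \<and> Lp_loc 1 S (flux h S u) \<and>
     (\<forall>\<zeta> \<in> C1c S. (LINT x:S|lebesgue. flux h S u x \<bullet> jacobian \<zeta> (at x)) = 0)"

end

theory Submission
  imports Defs
begin

text \<open>Write \<open>r = |x|\<close>. For \<open>u(x) = \<phi>(|x|) x\<close> the Jacobian is
\<open>\<phi> I + (\<phi>'/r) x \<otimes> x\<close>, so \<open>det Du = \<phi>^(n-1) (\<phi> + r \<phi>')\<close>, which up to the factor
\<open>n r^(n-1)\<close> is the derivative of \<open>(r \<phi>)^n\<close>. The claim is that \<open>det Du\<close> is a constant \<open>\<lambda>\<close> unless
\<open>\<phi>\<close> vanishes: then \<open>(r \<phi>)^n = c + \<lambda> r^n\<close>, which is the asserted formula.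

Testing the equation with the radial fields \<open>\<zeta>(x) = \<eta>(|x|) x\<close> and integrating over spheres turns
it into a single ordinary equation. With \<open>H = h (det Du)\<close> and \<open>w = r^n \<phi>^(n-1)\<close> it says that \<open>H w\<close>
has the weak derivative \<open>H w'\<close> on \<open>(0,1)\<close> (\<open>radial_equation\<close>). Hence \<open>H w\<close> agrees almost everywhere
with an absolutely continuous function \<open>P\<close> with \<open>P' = H w'\<close> (\<open>du_Bois_Reymond\<close>). Where \<open>\<phi>\<close> does
not vanish one may divide by \<open>w\<close>, and the quotient rule gives
\<open>(P / w)' = H w' / w - H w w' / w^2 = 0\<close>. So \<open>H\<close> is constant there, and since \<open>h\<close> is injective, so
is \<open>det Du\<close> (\<open>radial_equation_first_integral\<close>).

It remains to see that \<open>\<phi>\<close> vanishes nowhere or everywhere. If not, some interval on which \<open>\<phi>\<close> is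
nonzero has an end point \<open>z\<close> inside \<open>(0,1)\<close> with \<open>\<phi>(z) = 0\<close>, and there \<open>(r \<phi>)^n = \<lambda> (r^n - z^n)\<close>
with \<open>\<lambda> \<noteq> 0\<close>, so \<open>|\<phi>|\<close> is at least a positive multiple of \<open>|r - z|^(1/n)\<close>. But \<open>\<phi>' \<in> L^p\<close> near \<open>z\<close>
with \<open>1 - 1/p \<ge> 1/n\<close> forces \<open>\<phi>(r) = o(|r - z|^(1/n))\<close> (\<open>no_root_like_zero\<close>). This is where
\<open>p \<ge> n/(n-1)\<close> enters, and the bound is sharp: \<open>|r - z|^(1/n)\<close> has its derivative in \<open>L^p\<close> exactly
for \<open>p < n/(n-1)\<close>.

The analytic groundwork has three parts. The weak Jacobian is an arbitrary weak derivative, so it has to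
be identified almost everywhere with the formula above (\<open>weak_jacobian_radial\<close>); this rests on the
fundamental lemma of the calculus of variations and on \<open>weak_derivative_radial\<close>. Integrals of radial
functions are reduced to one variable by computing the image of Lebesgue measure under the norm
(\<open>distr_norm_lborel\<close>). Finally, absolutely continuous functions of one variable need a product and
a chain rule (\<open>primitive_on_chain_rule\<close>), which is obtained by approximating the derivative in
\<open>L^1\<close> by continuous functions.\<close>

section \<open>Continuously differentiable functions and test functions\<close>

definition C1 :: "('a::euclidean_space \<Rightarrow> 'b::euclidean_space) \<Rightarrow> bool" where
  "C1 f \<longleftrightarrow> (\<forall>x. f differentiable (at x)) \<and>
            (\<forall>v. continuous_on UNIV (\<lambda>x. frechet_derivative f (at x) v))"

lemma C1I:
  assumes "\<And>x. (f has_derivative f' x) (at x)" "\<And>v. continuous_on UNIV (\<lambda>x. f' x v)"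
  shows "C1 f"
proof -
  have "frechet_derivative f (at x) = f' x" for x
    using frechet_derivative_at[OF assms(1)] by simp
  with assms show ?thesis by (auto simp: C1_def differentiable_def)
qed

lemma C1_has_derivative: "C1 f \<Longrightarrow> (f has_derivative frechet_derivative f (at x)) (at x)"
  by (simp add: C1_def frechet_derivative_works)

lemma C1_continuous_derivative:
  "C1 f \<Longrightarrow> continuous_on UNIV (\<lambda>x. frechet_derivative f (at x) v)"
  by (simp add: C1_def)

lemma C1_continuous: "C1 f \<Longrightarrow> continuous_on A f"
  by (meson C1_has_derivative continuous_at_imp_continuous_on has_derivative_continuous)

lemma C1_const: "C1 (\<lambda>x. c)"
  by (rule C1I[of _ "\<lambda>_ _. 0"]) auto

lemma C1_linear: "bounded_linear f \<Longrightarrow> C1 f"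
  by (rule C1I[of _ "\<lambda>_. f"]) (auto intro: bounded_linear_imp_has_derivative)

lemma C1_diff: assumes "C1 f" "C1 g" shows "C1 (\<lambda>x. f x - g x)"
  by (rule C1I, rule has_derivative_diff[OF C1_has_derivative[OF assms(1)] C1_has_derivative[OF assms(2)]])
     (intro continuous_on_diff assms[THEN C1_continuous_derivative])

lemma C1_scaleR: fixes f :: "'a::euclidean_space \<Rightarrow> real" assumes "C1 f" "C1 g" shows "C1 (\<lambda>x. f x *\<^sub>R g x)"
  by (rule C1I, rule has_derivative_scaleR[OF C1_has_derivative[OF assms(1)] C1_has_derivative[OF assms(2)]])
     (intro continuous_on_add continuous_on_scaleR assms[THEN C1_continuous]
       assms[THEN C1_continuous_derivative])

lemma C1_mult: fixes f g :: "'a::euclidean_space \<Rightarrow> real" assumes "C1 f" "C1 g" shows "C1 (\<lambda>x. f x * g x)"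
  using C1_scaleR[OF assms] by simp

lemma C1_compose_real:
  fixes f :: "'a::euclidean_space \<Rightarrow> real" and g g' :: "real \<Rightarrow> real"
  assumes "C1 f" "\<And>t. (g has_real_derivative g' t) (at t)" "continuous_on UNIV g'"
  shows "C1 (\<lambda>x. g (f x))"
proof (rule C1I)
  show "((\<lambda>x. g (f x)) has_derivative (\<lambda>v. g' (f x) * frechet_derivative f (at x) v)) (at x)" for x
    using has_derivative_compose[OF C1_has_derivative[OF assms(1)], of g "(*) (g' (f x))" x]
      assms(2)[of "f x"] by (simp add: has_field_derivative_def)
  show "continuous_on UNIV (\<lambda>x. g' (f x) * frechet_derivative f (at x) v)" for v
    by (intro continuous_intros C1_continuous_derivative assms(1)
        continuous_on_compose2[OF assms(3)] C1_continuous) auto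
qed

text \<open>Squaring the positive part keeps it \<open>C\<^sup>1\<close> at its zeros. This is the source of all bump functions
below: one derivative is enough for them, so no smooth transition function is needed.\<close>

lemma C1_pos_part_square:
  fixes f :: "'a::euclidean_space \<Rightarrow> real"
  assumes "C1 f" shows "C1 (\<lambda>x. (max 0 (f x))\<^sup>2)"
proof (rule C1_compose_real[OF assms])
  fix t :: real
  have pos: "((\<lambda>t. (max 0 t)\<^sup>2) has_real_derivative 2 * t) (at t)" if "t > 0"
  proof (rule DERIV_cong_ev[THEN iffD2, OF refl _ refl])
    show "\<forall>\<^sub>F x in nhds t. (max 0 x)\<^sup>2 = x\<^sup>2"
      using eventually_gt_at_top order_tendstoD(1)[OF tendsto_ident_at] that
      by (auto intro!: eventually_mono[OF eventually_nhds_in_open[of "{0<..}"]] simp: max_def)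
  qed (auto intro!: derivative_eq_intros)
  have neg: "((\<lambda>t. (max 0 t)\<^sup>2) has_real_derivative 0) (at t)" if "t < 0"
  proof (rule DERIV_cong_ev[THEN iffD2, OF refl _ refl])
    show "\<forall>\<^sub>F x in nhds t. (max 0 x)\<^sup>2 = 0"
      using that by (auto intro!: eventually_mono[OF eventually_nhds_in_open[of "{..<0}"]] simp: max_def)
  qed (auto intro!: derivative_eq_intros)
  have zero: "((\<lambda>t::real. (max 0 t)\<^sup>2) has_real_derivative 0) (at 0)"
  proof -
    have "(\<lambda>h::real. (max 0 h)\<^sup>2 / h) \<midarrow>0\<rightarrow> 0"
    proof (rule Lim_null_comparison[of _ "\<lambda>h. \<bar>h\<bar>"])
      have "norm ((max 0 h)\<^sup>2 / h) \<le> \<bar>h\<bar>" for h :: real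
        by (cases "h > 0") (auto simp: max_def power2_eq_square)
      then show "\<forall>\<^sub>F h in at 0. norm ((max 0 h)\<^sup>2 / h) \<le> \<bar>h::real\<bar>" by simp
    qed (auto intro!: tendsto_eq_intros)
    then show ?thesis by (simp add: DERIV_def)
  qed
  show "((\<lambda>t. (max 0 t)\<^sup>2) has_real_derivative 2 * max 0 t) (at t)"
    using pos neg zero by (cases "t > 0"; cases "t < 0") (auto simp: max_def)
qed (intro continuous_intros)

lemma C1cI:
  assumes "C1 \<zeta>" "compact K" "K \<subseteq> S" "\<And>x. x \<notin> K \<Longrightarrow> \<zeta> x = 0"
  shows "\<zeta> \<in> C1c S"
proof -
  have sub: "closure {x. \<zeta> x \<noteq> 0} \<subseteq> K"
    using assms by (intro closure_minimal compact_imp_closed) auto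
  then have "compact (closure {x. \<zeta> x \<noteq> 0})"
    using compact_Int_closed[OF assms(2) closed_closure, of "{x. \<zeta> x \<noteq> 0}"] sub by (simp add: Int_absorb1)
  with sub assms(1,3) show ?thesis unfolding C1c_def C1_def by blast
qed

text \<open>The support is a closure, on whose complement the derivative vanishes as well. Test functions enter
all later arguments in this form: a compact set off which both the function and its derivative are zero.\<close>

lemma C1cE:
  assumes "\<zeta> \<in> C1c S"
  obtains K where "C1 \<zeta>" "compact K" "K \<subseteq> S" "\<And>x. x \<notin> K \<Longrightarrow> \<zeta> x = 0"
    "\<And>x. x \<notin> K \<Longrightarrow> frechet_derivative \<zeta> (at x) = (\<lambda>v. 0)"
proof -
  let ?K = "closure {x. \<zeta> x \<noteq> 0}"
  have 1: "C1 \<zeta>" "compact ?K" "?K \<subseteq> S" using assms by (simp_all add: C1c_def C1_def)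
  have z: "\<zeta> x = 0" if "x \<notin> ?K" for x using that closure_subset[of "{x. \<zeta> x \<noteq> 0}"] by blast
  have 2: "frechet_derivative \<zeta> (at x) = (\<lambda>v. 0)" if "x \<notin> ?K" for x
  proof -
    have "(\<zeta> has_derivative (\<lambda>v. 0)) (at x)"
    proof (rule has_derivative_transform_within_open[of "\<lambda>x. 0"])
      show "open (- ?K)" by (intro open_Compl closed_closure)
      show "x \<in> - ?K" using that by simp
      show "0 = \<zeta> y" if "y \<in> - ?K" for y using z[of y] that by simp
    qed (rule has_derivative_const)
    then show ?thesis by (rule frechet_derivative_at[symmetric])
  qed
  show thesis by (rule that[OF 1 z 2])
qed

lemma C1c_mono: "S \<subseteq> T \<Longrightarrow> C1c S \<subseteq> C1c T"
  unfolding C1c_def by blast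

lemma open_cozero:
  fixes W :: "'a::euclidean_space \<Rightarrow> real"
  assumes "C1 W" shows "open {x. W x \<noteq> 0}"
  using continuous_open_preimage[of UNIV W "- {0}"] C1_continuous[OF assms, of UNIV]
  by (auto simp: vimage_def)

text \<open>The sets \<open>{W \<noteq> 0}\<close> with \<open>W\<close> of class \<open>C\<^sup>1\<close> are stable under intersection (multiply the functions) and
contain the half-spaces, so they generate the Borel sets. By Dynkin's lemma the integral of \<open>F\<close> over
every Borel set vanishes.\<close>

lemma AE_eq_0_if_cozero_integrals_eq_0:
  fixes F :: "'a::euclidean_space \<Rightarrow> real"
  assumes int: "integrable lborel F"
    and zero: "\<And>W :: 'a \<Rightarrow> real. C1 W \<Longrightarrow> (LINT x:{x. W x \<noteq> 0}|lborel. F x) = 0"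
  shows "AE x in lborel. F x = 0"
proof -
  define G where "G = {{x. W x \<noteq> 0} |W :: 'a \<Rightarrow> real. C1 W}"
  have GI: "{x. W x \<noteq> 0} \<in> G" if "C1 W" for W :: "'a \<Rightarrow> real" using that by (auto simp: G_def)
  have stable: "Int_stable G"
  proof (rule Int_stableI)
    fix A B assume "A \<in> G" "B \<in> G"
    then obtain V W :: "'a \<Rightarrow> real" where VW: "C1 V" "C1 W" and AB: "A = {x. V x \<noteq> 0}" "B = {x. W x \<noteq> 0}" by (auto simp: G_def)
    have "A \<inter> B = {x. V x * W x \<noteq> 0}" using AB by auto
    then show "A \<inter> B \<in> G" using GI[OF C1_mult[OF VW]] by simp
  qed
  have "{x. x \<bullet> i < a} \<in> G" for i :: 'a and a
  proof -
    have eq: "{x. x \<bullet> i < a} = {x. (max 0 (a - x \<bullet> i))\<^sup>2 \<noteq> 0}" by (auto simp: max_def)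
    show ?thesis unfolding eq
      by (intro GI C1_pos_part_square C1_diff C1_const C1_linear bounded_linear_inner_left)
  qed
  then have "(\<lambda>(a, i). {x. x \<bullet> i < a}) ` (UNIV \<times> Basis) \<subseteq> G" by auto
  then have sub: "sets (borel :: 'a measure) \<subseteq> sigma_sets UNIV G"
    unfolding borel_eq_halfspace_less by (simp add: sets_measure_of sigma_sets_mono')
  have "G \<subseteq> sets borel"
  proof
    fix A assume "A \<in> G"
    then obtain W :: "'a \<Rightarrow> real" where W: "C1 W" "A = {x. W x \<noteq> 0}" by (auto simp: G_def)
    then have "open A" using open_cozero by simp
    then show "A \<in> sets borel" by simp
  qed
  then have eq: "sigma_sets UNIV G = sets borel"
    using sub sets.sigma_sets_subset[of G borel] by auto
  have UNIV0: "(LINT x|lborel. F x) = 0"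
    using zero[OF C1_const[of 1]] by (simp add: set_lebesgue_integral_def)
  have iA: "set_integrable lborel A F" if "A \<in> sets borel" for A
    unfolding set_integrable_def using that int by (intro integrable_mult_indicator) auto
  have "(LINT x:A|lborel. F x) = 0" if "A \<in> sets borel" for A
  proof -
    have "G \<subseteq> Pow UNIV" "A \<in> sigma_sets UNIV G" using that eq by simp_all
    from stable this show ?thesis
    proof (induction rule: sigma_sets_induct_disjoint)
      case (basic A) then show ?case using zero by (auto simp: G_def)
    next
      case empty then show ?case by (simp add: set_lebesgue_integral_def)
    next
      case (compl A)
      then have "A \<in> sets borel" using eq by simp
      then have "(LINT x:UNIV|lborel. F x) = (LINT x:A|lborel. F x) + (LINT x:UNIV - A|lborel. F x)"
        by (subst set_integral_Un[symmetric]) (auto intro!: iA simp: Un_absorb1)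
      then show ?case using compl UNIV0 by (simp add: set_lebesgue_integral_def)
    next
      case (union A)
      then have A: "\<And>i. A i \<in> sets borel" using eq by auto
      have "(LINT x:(\<Union>i. A i)|lborel. F x) = (\<Sum>i. (LINT x:A i|lborel. F x))"
        by (rule lebesgue_integral_countable_add)
           (use A union in \<open>auto simp: disjoint_family_on_def intro!: iA sets.countable_UN\<close>)
      then show ?case using union by simp
    qed
  qed
  then have "AE x in lborel. F x = (\<lambda>x. 0) x"
    by (intro density_unique_real int) (auto simp: set_lebesgue_integral_def)
  then show ?thesis by simp
qed

section \<open>The fundamental lemma of the calculus of variations\<close>

lemma C1_inner_self_diff: "C1 (\<lambda>x :: 'a::euclidean_space. (x - c) \<bullet> (x - c))"
  by (rule C1I[of _ "\<lambda>x v. (x - c) \<bullet> v + v \<bullet> (x - c)"])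
     (auto intro!: derivative_eq_intros continuous_intros simp: inner_commute)

text \<open>The functions \<open>t \<mapsto> k t\<^sup>2 / (1 + k t\<^sup>2)\<close> are of class \<open>C\<^sup>1\<close>, take values in \<open>[0,1)\<close> and increase to the
indicator of \<open>t \<noteq> 0\<close> as \<open>k\<close> grows. They turn a \<open>C\<^sup>1\<close> function into \<open>C\<^sup>1\<close> approximations of the
indicator of the set where it does not vanish.\<close>

lemma saturation_derivative:
  assumes "k \<ge> (0::real)"
  shows "((\<lambda>t. k * t\<^sup>2 / (1 + k * t\<^sup>2)) has_real_derivative (2 * k * t / (1 + k * t\<^sup>2)\<^sup>2)) (at t)"
proof -
  have "1 + k * t\<^sup>2 > 0" using assms by (simp add: add_pos_nonneg)
  then show ?thesis
    by (auto intro!: derivative_eq_intros simp: field_simps power2_eq_square)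
qed

text \<open>On a ball with closure in \<open>S\<close>, the indicator of \<open>{W \<noteq> 0}\<close> is a bounded pointwise limit of test
functions, so by dominated convergence \<open>AE_eq_0_if_cozero_integrals_eq_0\<close> applies. Countably many such
balls cover \<open>S\<close>.\<close>

theorem fundamental_lemma_calculus_of_variations:
  fixes f :: "'a::euclidean_space \<Rightarrow> real"
  assumes "open S"
    and loc: "\<And>K. compact K \<Longrightarrow> K \<subseteq> S \<Longrightarrow> f absolutely_integrable_on K"
    and zero: "\<And>\<eta>. \<eta> \<in> C1c S \<Longrightarrow> (LINT x:S|lebesgue. \<eta> x * f x) = 0"
  shows "AE x in lebesgue. x \<in> S \<longrightarrow> f x = 0"
proof -
  have ball: "AE x in lebesgue. x \<in> ball c \<rho> \<longrightarrow> f x = 0" if cb: "cball c \<rho> \<subseteq> S" and "\<rho> > 0" for c \<rho>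
  proof -
    define F where "F x = indicator (ball c \<rho>) x * f x" for x
    have "f absolutely_integrable_on ball c \<rho>"
      by (rule set_integrable_subset[OF loc[OF compact_cball cb]]) auto
    then have F: "integrable lebesgue F" by (simp add: F_def[abs_def] set_integrable_def)
    then obtain F' where F': "F' \<in> borel_measurable lborel" "AE x in lborel. F x = F' x"
      using completion_ex_borel_measurable_real[of F lborel] by auto
    have ae: "AE x in lebesgue. F x = F' x" using F'(2) by (rule AE_completion)
    have F'm: "F' \<in> borel_measurable lebesgue" using F'(1) by (rule measurable_completion)
    have "integrable lebesgue F'"
      using F integrable_cong_AE[OF borel_measurable_integrable[OF F] F'm ae] by simp
    then have F'i: "integrable lborel F'" using integrable_completion F'(1) by blast
    have "AE x in lborel. F' x = 0"
    proof (rule AE_eq_0_if_cozero_integrals_eq_0[OF F'i])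
      fix W :: "'a \<Rightarrow> real" assume W: "C1 W"
      \<comment> \<open>The first factor confines the support to the closed ball.\<close>
      define V where "V x = (max 0 (\<rho>\<^sup>2 - (x - c) \<bullet> (x - c)))\<^sup>2 * W x" for x
      have V: "C1 V" unfolding V_def[abs_def]
        by (intro C1_mult W C1_pos_part_square C1_diff C1_const C1_inner_self_diff)
      have V0: "V x \<noteq> 0 \<longleftrightarrow> x \<in> ball c \<rho> \<and> W x \<noteq> 0" for x
      proof -
        have "(x - c) \<bullet> (x - c) < \<rho>\<^sup>2 \<longleftrightarrow> x \<in> ball c \<rho>"
          using \<open>\<rho> > 0\<close> by (simp add: dist_norm norm_minus_commute norm_lt_square flip: power2_norm_eq_inner)
        then show ?thesis by (auto simp: V_def max_def)
      qed
      define \<eta> where "\<eta> k x = real k * (V x)\<^sup>2 / (1 + real k * (V x)\<^sup>2)" for k :: nat and x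
      have \<eta>: "\<eta> k \<in> C1c S" for k
      proof (rule C1cI[OF _ compact_cball cb])
        have "1 + real k * t\<^sup>2 \<noteq> 0" for t :: real
          by (metis add_nonneg_eq_0_iff mult_nonneg_nonneg of_nat_0_le_iff zero_le_one zero_le_power2 zero_neq_one)
        then show "C1 (\<eta> k)" unfolding \<eta>_def[abs_def]
          by (intro C1_compose_real[OF V saturation_derivative] continuous_intros) auto
        show "\<eta> k x = 0" if "x \<notin> cball c \<rho>" for x
          using V0[of x] that by (auto simp: \<eta>_def)
      qed
      let ?U = "{x. W x \<noteq> 0}"
      have lim: "(\<lambda>k. \<eta> k x) \<longlonglongrightarrow> (if V x = 0 then 0 else 1)" for x
      proof (cases "V x = 0")
        case False
        have "(\<lambda>k. 1 - 1 / (1 + real k * (V x)\<^sup>2)) \<longlonglongrightarrow> 1 - 0"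
          by (intro tendsto_intros tendsto_divide_0[OF tendsto_const] filterlim_at_top_imp_at_infinity
              filterlim_tendsto_add_at_top[OF tendsto_const]
              filterlim_at_top_mult_tendsto_pos[OF tendsto_const] filterlim_real_sequentially)
             (use False in auto)
        moreover have "1 - 1 / (1 + real k * (V x)\<^sup>2) = \<eta> k x" for k
        proof -
          have "1 + real k * (V x)\<^sup>2 > 0" by (simp add: add_pos_nonneg)
          then show ?thesis by (simp add: \<eta>_def field_simps)
        qed
        ultimately show ?thesis using False by simp
      qed (simp add: \<eta>_def)
      have bd: "\<bar>\<eta> k x\<bar> \<le> 1" for k x
      proof -
        have "1 + real k * (V x)\<^sup>2 > 0" by (simp add: add_pos_nonneg)
        then show ?thesis by (simp add: \<eta>_def field_simps)
      qed
      have \<eta>F: "indicator S x *\<^sub>R (\<eta> k x * f x) = \<eta> k x * F x" for k x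
      proof (cases "V x = 0")
        case False
        then have "x \<in> ball c \<rho>" "x \<in> S" using V0[of x] cb by auto
        then show ?thesis by (simp add: F_def)
      qed (simp add: \<eta>_def)
      have "(\<lambda>k. \<integral>x. \<eta> k x * F x \<partial>lebesgue) \<longlonglongrightarrow> (\<integral>x. indicator ?U x * F x \<partial>lebesgue)"
      proof (rule integral_dominated_convergence[where w = "\<lambda>x. norm (F x)"])
        have "open ?U" by (rule open_cozero[OF W])
        then show "(\<lambda>x. indicator ?U x * F x) \<in> borel_measurable lebesgue"
          using borel_measurable_integrable[OF F] by (intro borel_measurable_times borel_measurable_indicator) auto
        have "\<eta> k \<in> borel_measurable lebesgue" for k
        proof (rule measurable_completion)
          show "\<eta> k \<in> borel_measurable lborel"
            using C1_continuous[of "\<eta> k" UNIV] \<eta>[of k]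
            by (auto elim!: C1cE intro: borel_measurable_continuous_onI)
        qed
        then show "(\<lambda>x. \<eta> k x * F x) \<in> borel_measurable lebesgue" for k
          using borel_measurable_integrable[OF F] by (intro borel_measurable_times)
        show "AE x in lebesgue. (\<lambda>k. \<eta> k x * F x) \<longlonglongrightarrow> indicator ?U x * F x"
        proof (rule AE_I2)
          fix x
          have "(\<lambda>k. \<eta> k x * F x) \<longlonglongrightarrow> (if V x = 0 then 0 else 1) * F x"
            by (intro tendsto_intros lim)
          moreover have "(if V x = 0 then 0 else 1) * F x = indicator ?U x * F x"
            using V0[of x] by (auto simp: F_def indicator_def)
          ultimately show "(\<lambda>k. \<eta> k x * F x) \<longlonglongrightarrow> indicator ?U x * F x" by simp
        qed
        show "AE x in lebesgue. norm (\<eta> k x * F x) \<le> norm (F x)" for k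
          by (auto simp: abs_mult intro!: mult_left_le_one_le bd)
      qed (use F in auto)
      moreover have "(\<integral>x. \<eta> k x * F x \<partial>lebesgue) = 0" for k
        using zero[OF \<eta>, of k] by (simp only: set_lebesgue_integral_def \<eta>F)
      ultimately have "(\<integral>x. indicator ?U x * F x \<partial>lebesgue) = 0"
        by (simp add: LIMSEQ_const_iff)
      moreover have Uo: "open ?U" by (rule open_cozero[OF W])
      have "(\<integral>x. indicator ?U x * F x \<partial>lebesgue) = (\<integral>x. indicator ?U x * F' x \<partial>lebesgue)"
      proof (rule integral_cong_AE)
        show "AE x in lebesgue. indicator ?U x * F x = indicator ?U x * F' x"
          using ae by eventually_elim simp
      qed (use Uo F F'm in \<open>auto intro!: borel_measurable_times borel_measurable_indicator\<close>)
      moreover have "\<dots> = (\<integral>x. indicator ?U x * F' x \<partial>lborel)"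
        by (rule integral_completion) (use Uo F'(1) in auto)
      ultimately show "(LINT x:?U|lborel. F' x) = 0"
        by (simp add: set_lebesgue_integral_def)
    qed
    then have "AE x in lebesgue. F' x = 0" by (rule AE_completion)
    with ae show ?thesis by eventually_elim (auto simp: F_def)
  qed
  define \<B> where "\<B> = {ball c \<rho> |c \<rho>. cball c \<rho> \<subseteq> S \<and> \<rho> > 0}"
  have "\<Union>\<B> = S"
  proof
    show "S \<subseteq> \<Union>\<B>"
    proof
      fix x assume "x \<in> S"
      then obtain e where "e > 0" "cball x e \<subseteq> S" using \<open>open S\<close> open_contains_cball by metis
      then have "ball x e \<in> \<B>" "x \<in> ball x e" by (auto simp: \<B>_def)
      then show "x \<in> \<Union>\<B>" by blast
    qed
    show "\<Union>\<B> \<subseteq> S"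
      using ball_subset_cball by (auto simp: \<B>_def)
  qed
  moreover obtain \<C> where "\<C> \<subseteq> \<B>" "countable \<C>" "\<Union>\<C> = \<Union>\<B>"
    using Lindelof[of \<B>] by (auto simp: \<B>_def)
  moreover have "AE x in lebesgue. \<forall>C\<in>\<C>. x \<in> C \<longrightarrow> f x = 0"
    using \<open>countable \<C>\<close> \<open>\<C> \<subseteq> \<B>\<close> ball by (subst AE_ball_countable) (auto simp: \<B>_def)
  ultimately show ?thesis by (auto elim!: eventually_mono)
qed

text \<open>For \<open>p \<ge> 1\<close> the bound \<open>t \<le> 1 + t^p\<close> gives \<open>L^p \<subseteq> L^1\<close> on compact sets.\<close>

lemma Lp_loc_absolutely_integrable:
  fixes f :: "'a::euclidean_space \<Rightarrow> 'b::euclidean_space"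
  assumes "Lp_loc p S f" "p \<ge> 1" "compact K" "K \<subseteq> S" "S \<in> sets lebesgue"
  shows "f absolutely_integrable_on K"
proof -
  have K: "K \<in> sets lebesgue" "K \<in> lmeasurable" using assms(3) by (auto simp: lmeasurable_compact fmeasurableD)
  have "f \<in> borel_measurable (lebesgue_on S)" and
    i: "(\<lambda>x. norm (f x) powr p) absolutely_integrable_on K"
    using assms by (auto simp: Lp_loc_def)
  then have m: "f \<in> borel_measurable (lebesgue_on K)"
    using assms by (meson measurable_restrict_mono)
  have "(\<lambda>x. 1 + norm (f x) powr p) absolutely_integrable_on K"
    by (intro set_integral_add i) (use K in \<open>simp add: absolutely_integrable_on_const\<close>)
  then show ?thesis
  proof (intro measurable_bounded_by_integrable_imp_absolutely_integrable[OF m K(1)])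
    show "norm (f x) \<le> 1 + norm (f x) powr p" for x
    proof (cases "norm (f x) \<le> 1")
      case False
      then have "norm (f x) powr 1 \<le> norm (f x) powr p" using assms(2) by (intro powr_mono) auto
      then show ?thesis using False by auto
    qed (simp add: add_increasing2)
  qed (rule set_lebesgue_integral_eq_integral(1))
qed

section \<open>Integrals of directional derivatives\<close>

lemma integral_lborel_translate:
  fixes F :: "'a::euclidean_space \<Rightarrow> real"
  assumes "F \<in> borel_measurable borel"
  shows "(\<integral>x. F (x + v) \<partial>lborel) = (\<integral>x. F x \<partial>lborel)"
proof -
  have "(\<integral>x. F x \<partial>distr lborel borel ((+) v)) = (\<integral>x. F (v + x) \<partial>lborel)"
    by (rule integral_distr) (use assms in auto)
  then show ?thesis by (simp add: lborel_distr_plus add.commute)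
qed

text \<open>The divergence theorem for compactly supported functions, without any geometry: the integral of
\<open>x \<mapsto> F (x + t v)\<close> does not depend on \<open>t\<close>, so the difference quotients of \<open>F\<close> in direction \<open>v\<close> integrate
to zero, and they converge boundedly to the derivative.\<close>

theorem integral_directional_derivative_eq_0:
  fixes F :: "'a::euclidean_space \<Rightarrow> real"
  assumes "F \<in> C1c UNIV"
  shows "(\<integral>x. frechet_derivative F (at x) v \<partial>lborel) = 0"
proof -
  obtain K where F: "C1 F" and K: "compact K" and F0: "\<And>x. x \<notin> K \<Longrightarrow> F x = 0"
    and D0: "\<And>x. x \<notin> K \<Longrightarrow> frechet_derivative F (at x) = (\<lambda>v. 0)"
    using C1cE[OF assms] by metis
  define D where "D x = frechet_derivative F (at x) v" for x
  have Dc: "continuous_on UNIV D" unfolding D_def[abs_def] by (rule C1_continuous_derivative[OF F])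
  have Fm: "F \<in> borel_measurable borel" by (intro borel_measurable_continuous_onI C1_continuous F)
  have "(\<lambda>x. indicator K x *\<^sub>R F x) = F" using F0 by (auto simp: indicator_def fun_eq_iff)
  then have Fi: "integrable lborel F"
    using borel_integrable_compact[OF K C1_continuous[OF F]] by simp
  obtain R where R: "\<And>x. x \<in> K \<Longrightarrow> norm x \<le> R" using compact_imp_bounded[OF K] bounded_iff by metis
  have "bounded (D ` K)" using K compact_continuous_image[OF continuous_on_subset[OF Dc]] compact_imp_bounded by blast
  then obtain M where M: "\<And>x. x \<in> K \<Longrightarrow> \<bar>D x\<bar> \<le> M" "M \<ge> 0" 
    unfolding bounded_iff by (metis (no_types, lifting) abs_ge_zero image_eqI order_trans real_norm_def abs_le_iff linear)
  have M': "\<bar>D x\<bar> \<le> M" for x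
    using M D0[of x] by (cases "x \<in> K") (auto simp: D_def)
  \<comment> \<open>step sizes of the difference quotients, at most one so that all supports stay in one ball\<close>
  define e where "e k = 1 / (real k + 1)" for k :: nat
  have e: "0 < e k" "e k \<le> 1" for k by (auto simp: e_def)
  have e0: "e \<longlonglongrightarrow> 0" using LIMSEQ_inverse_real_of_nat by (simp add: e_def[abs_def] inverse_eq_divide add.commute)
  define Q where "Q k x = (F (x + e k *\<^sub>R v) - F x) / e k" for k x
  have Qd: "((\<lambda>t. F (x + t *\<^sub>R v)) has_real_derivative D (x + t *\<^sub>R v)) (at t)" for x t
  proof -
    have "((\<lambda>t. F (x + t *\<^sub>R v)) has_derivative (\<lambda>s. frechet_derivative F (at (x + t *\<^sub>R v)) (s *\<^sub>R v))) (at t)"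
      by (rule has_derivative_compose[OF _ C1_has_derivative[OF F]]) (auto intro!: derivative_eq_intros)
    then show ?thesis
      using linear_cmul[OF has_derivative_linear[OF C1_has_derivative[OF F]]]
      by (simp add: has_field_derivative_def D_def mult.commute[of _ "frechet_derivative _ _ _"] mult_commute_abs)
  qed
  have lim: "(\<lambda>k. Q k x) \<longlonglongrightarrow> D x" for x
  proof -
    have "((\<lambda>h. (F (x + h *\<^sub>R v) - F x) / h) \<longlongrightarrow> D x) (at 0)"
      using Qd[of x 0] by (simp add: DERIV_def)
    then show ?thesis unfolding Q_def
      by (rule filterlim_compose) (use e0 e in \<open>auto simp: filterlim_at less_le intro!: always_eventually\<close>)
  qed
  \<comment> \<open>The mean value theorem bounds the quotients by the supremum of the derivative.\<close>
  have Qb: "\<bar>Q k x\<bar> \<le> M * indicator (cball 0 (R + norm v)) x" for k x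
  proof (cases "x \<in> cball 0 (R + norm v)")
    case True
    have "\<exists>z. 0 < z \<and> z < e k \<and> F (x + e k *\<^sub>R v) - F (x + 0 *\<^sub>R v) = (e k - 0) * D (x + z *\<^sub>R v)"
      by (rule MVT2) (use e Qd in auto)
    then obtain z where "F (x + e k *\<^sub>R v) - F x = e k * D (x + z *\<^sub>R v)" by auto
    then have "Q k x = D (x + z *\<^sub>R v)" using e[of k] by (simp add: Q_def)
    then show ?thesis using True M' by simp
  next
    case False
    then have n: "norm x > R + norm v" by simp
    moreover have "norm x \<le> norm (x + e k *\<^sub>R v) + norm (e k *\<^sub>R v)"
      by (metis add_diff_cancel_right' norm_triangle_ineq4)
    moreover have "norm (e k *\<^sub>R v) \<le> norm v" using e[of k] by (simp add: mult_left_le_one_le)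
    ultimately have "x + e k *\<^sub>R v \<notin> K" "x \<notin> K" using R by (smt (verit) norm_ge_zero)+
    then show ?thesis using False F0 by (simp add: Q_def)
  qed
  have "(\<lambda>k. \<integral>x. Q k x \<partial>lborel) \<longlonglongrightarrow> (\<integral>x. D x \<partial>lborel)"
  proof (rule integral_dominated_convergence[where w = "\<lambda>x. M * indicator (cball 0 (R + norm v)) x"])
    show "D \<in> borel_measurable lborel" using borel_measurable_continuous_onI[OF Dc] by simp
    show "Q k \<in> borel_measurable lborel" for k
      unfolding Q_def[abs_def]
      by (intro borel_measurable_divide borel_measurable_diff)
         (use Fm in \<open>auto intro: measurable_compose[OF _ Fm]\<close>)
    show "integrable lborel (\<lambda>x. M * indicator (cball (0::'a) (R + norm v)) x)"
      by (intro integrable_mult_right integrable_real_indicator)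
         (use emeasure_lborel_cball_finite[of "0::'a" "R + norm v"] in \<open>auto simp: top.not_eq_extremum\<close>)
  qed (use lim Qb in auto)
  moreover have "(\<integral>x. Q k x \<partial>lborel) = 0" for k
  proof -
    have "integrable (distr lborel borel ((+) (e k *\<^sub>R v))) F" using Fi by (simp add: lborel_distr_plus)
    then have "integrable lborel (\<lambda>x. F (x + e k *\<^sub>R v))"
      by (subst (asm) integrable_distr_eq) (use Fm in \<open>auto simp: add.commute\<close>)
    then show ?thesis
      unfolding Q_def using Fi integral_lborel_translate[OF Fm] by simp
  qed
  ultimately show ?thesis by (simp add: LIMSEQ_const_iff D_def[abs_def])
qed

section \<open>Integration of radial functions\<close>

text \<open>The surface area of the sphere of radius \<open>r\<close> in dimension \<open>d\<close>, and \<open>0\<close> for negative \<open>r\<close>.\<close>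

definition radial_weight :: "nat \<Rightarrow> real \<Rightarrow> real" where
  "radial_weight d r = real d * unit_ball_vol (real d) * r ^ (d - 1) * indicator {0..} r"

lemma radial_weight_nonneg: "radial_weight d r \<ge> 0"
  by (auto simp: radial_weight_def indicator_def)

lemma radial_weight_measurable [measurable]: "radial_weight d \<in> borel_measurable borel"
  unfolding radial_weight_def[abs_def] by measurable

lemma nn_integral_radial_weight:
  assumes "a \<ge> 0" "d > 0"
  shows "(\<integral>\<^sup>+r. ennreal (radial_weight d r) * indicator {..a} r \<partial>lborel)
       = ennreal (unit_ball_vol (real d) * a ^ d)"
proof -
  have "(\<integral>\<^sup>+r. ennreal (radial_weight d r) * indicator {..a} r \<partial>lborel)
      = (\<integral>\<^sup>+r. ennreal (real d * unit_ball_vol (real d) * r ^ (d - 1)) * indicator {0..a} r \<partial>lborel)"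
    by (rule nn_integral_cong) (auto simp: radial_weight_def indicator_def)
  also have "\<dots> = ennreal (unit_ball_vol (real d) * a ^ d - unit_ball_vol (real d) * 0 ^ d)"
  proof (rule nn_integral_FTC_Icc)
    show "((\<lambda>r. unit_ball_vol (real d) * r ^ d) has_real_derivative
             real d * unit_ball_vol (real d) * x ^ (d - 1)) (at x)" for x
      by (auto intro!: derivative_eq_intros)
  qed (use assms in auto)
  finally show ?thesis using assms by simp
qed

text \<open>Both measures give the half-line up to \<open>a\<close> the volume of the ball of radius \<open>a\<close>. This replaces polar
coordinates, because only radial functions have to be integrated.\<close>

lemma distr_norm_lborel:
  "distr (lborel :: 'a::euclidean_space measure) borel norm
     = density lborel (\<lambda>r. ennreal (radial_weight DIM('a) r))" (is "?M = ?N")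
proof (rule measure_eqI_generator_eq[where E = "range (\<lambda>a::real. {..a})" and \<Omega> = UNIV
      and A = "\<lambda>i::nat. {..real i}"])
  show "Int_stable (range (\<lambda>a::real. {..a}))" by (auto simp: Int_stable_def)
  have M: "emeasure ?M {..a} = ennreal (unit_ball_vol (real DIM('a)) * a ^ DIM('a))" if "a \<ge> 0" for a
  proof -
    have "emeasure ?M {..a} = emeasure lborel (cball (0::'a) a)"
      by (subst emeasure_distr) (auto intro!: arg_cong[where f = "emeasure lborel"] simp: cball_def)
    then show ?thesis using emeasure_cball[OF that, of "0::'a"] by simp
  qed
  show "emeasure ?M X = emeasure ?N X" if XE: "X \<in> range (\<lambda>a::real. {..a})" for X
  proof -
    obtain a where X: "X = {..a}" using XE by auto
    show ?thesis
    proof (cases "a \<ge> 0")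
      case True
      then show ?thesis unfolding X M[OF True]
        by (subst emeasure_density) (auto simp: nn_integral_radial_weight)
    next
      case False
      have "\<not> norm x \<le> a" for x :: 'a using False order_trans[OF norm_ge_zero[of x], of a] by blast
      then have "norm -` {..a} = ({} :: 'a set)" by auto
      then have "emeasure ?M {..a} = 0" by (subst emeasure_distr) auto
      moreover have "emeasure ?N {..a} = 0"
      proof -
        have "radial_weight DIM('a) r = 0 \<or> r \<notin> {..a}" for r
          using False by (auto simp: radial_weight_def indicator_def)
        then have 0: "ennreal (radial_weight DIM('a) r) * indicator {..a} r = 0" for r
          by (metis ennreal_0 indicator_simps(2) mult_zero_left mult_zero_right)
        have "emeasure ?N {..a} = (\<integral>\<^sup>+r. ennreal (radial_weight DIM('a) r) * indicator {..a} r \<partial>lborel)"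
          by (rule emeasure_density) auto
        then show ?thesis unfolding 0 by simp
      qed
      ultimately show ?thesis by (simp add: X)
    qed
  qed
  show "emeasure ?M {..real i} \<noteq> \<infinity>" for i by (subst M) auto
  show "(\<Union>i. {..real i}) = UNIV" using real_arch_simple by auto
  show "sets ?M = sigma_sets UNIV (range (\<lambda>a. {..a}))"
    unfolding borel_eq_atMost by (simp add: sets_measure_of)
  then show "sets ?N = sigma_sets UNIV (range (\<lambda>a. {..a}))" by simp
qed auto

lemma integrable_radial_iff:
  fixes f :: "real \<Rightarrow> real"
  assumes [measurable]: "f \<in> borel_measurable borel"
  shows "integrable (lborel :: 'a::euclidean_space measure) (\<lambda>x. f (norm x))
     \<longleftrightarrow> integrable lborel (\<lambda>r. radial_weight DIM('a) r * f r)"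
proof -
  have "integrable (lborel :: 'a measure) (\<lambda>x. f (norm x)) \<longleftrightarrow> integrable (distr (lborel :: 'a measure) borel norm) f"
    by (subst integrable_distr_eq) auto
  then show ?thesis unfolding distr_norm_lborel
    by (subst (asm) integrable_density) (auto simp: radial_weight_nonneg)
qed

lemma integral_radial:
  fixes f :: "real \<Rightarrow> real"
  assumes [measurable]: "f \<in> borel_measurable borel"
  shows "(\<integral>x. f (norm x) \<partial>(lborel :: 'a::euclidean_space measure))
     = (\<integral>r. radial_weight DIM('a) r * f r \<partial>lborel)"
proof -
  have "(\<integral>x. f (norm x) \<partial>(lborel :: 'a measure)) = (\<integral>r. f r \<partial>distr (lborel :: 'a measure) borel norm)"
    by (subst integral_distr) auto
  then show ?thesis unfolding distr_norm_lborel
    by (subst (asm) integral_density) (auto simp: radial_weight_nonneg)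
qed

section \<open>Determinant and cofactor matrix of a multiple of the identity plus a dyad\<close>

text \<open>The matrix \<open>x \<otimes> x\<close>.\<close>

definition dyad :: "real^'n \<Rightarrow> real^'n^'n" where
  "dyad x = (\<chi> i j. x $ i * x $ j)"

lemma mat_1_inner_mat_1: "(mat 1 :: real^'n^'n) \<bullet> mat 1 = real CARD('n)"
  by (simp add: inner_vec_def mat_def if_distrib[of "\<lambda>t. t * _"] cong: if_cong)

lemma mat_1_inner_dyad: "mat 1 \<bullet> dyad x = x \<bullet> x"
  by (simp add: inner_vec_def mat_def dyad_def if_distrib[of "\<lambda>t. t * _"] cong: if_cong)

lemma dyad_inner_dyad: "dyad x \<bullet> dyad x = (x \<bullet> x)\<^sup>2"
  by (simp add: inner_vec_def dyad_def power2_eq_square sum_product mult_ac)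

lemmas scaleR_matrix_mult = scalar_matrix_assoc[symmetric] matrix_scalar_ac

lemma matrix_mult_add_right_distrib:
  fixes A B :: "real^'n^'m"
  shows "(A + B) ** C = A ** C + B ** C"
  by (simp add: vec_eq_iff matrix_matrix_mult_def algebra_simps sum.distrib)

lemma matrix_mult_diff_left_distrib:
  fixes A :: "real^'n^'m"
  shows "A ** (B - C) = A ** B - A ** C"
  by (simp add: vec_eq_iff matrix_matrix_mult_def algebra_simps sum_subtractf)

lemma dyad_mult_dyad: "dyad x ** dyad x = (x \<bullet> x) *\<^sub>R dyad x"
  by (simp add: vec_eq_iff matrix_matrix_mult_def dyad_def inner_vec_def sum_distrib_right sum_distrib_left mult_ac)

lemma dyad_matrix_vector: "dyad (Q *v x) = Q ** dyad x ** transpose Q"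
  by (simp add: vec_eq_iff matrix_matrix_mult_def matrix_vector_mult_def dyad_def transpose_def
      sum_product sum_distrib_right sum_distrib_left mult_ac)

lemma transpose_scalar_plus_dyad:
  "transpose (a *\<^sub>R mat 1 + b *\<^sub>R dyad x) = a *\<^sub>R mat 1 + b *\<^sub>R dyad x"
  by (simp add: vec_eq_iff transpose_def dyad_def mat_def mult_ac)

text \<open>A rotation that takes a coordinate direction to the direction of \<open>x\<close> diagonalises the matrix: the
eigenvalue in the direction of \<open>x\<close> is \<open>a + b |x|\<^sup>2\<close>, the other ones are \<open>a\<close>.\<close>

lemma det_scalar_plus_dyad:
  fixes x :: "real^'n"
  shows "det (a *\<^sub>R mat 1 + b *\<^sub>R dyad x) = a ^ (CARD('n) - 1) * (a + b * (x \<bullet> x))"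
proof -
  obtain k :: 'n where True by blast
  define e :: "real^'n" where "e = axis k (norm x)"
  obtain f where f: "orthogonal_transformation f" "f e = x"
    by (rule orthogonal_transformation_exists[of e x]) (simp add: e_def norm_eq_sqrt_inner[of "axis _ _"] inner_axis_axis)
  define Q where "Q = matrix f"
  have Q: "orthogonal_matrix Q" and Qe: "Q *v e = x"
    using f by (auto simp: Q_def orthogonal_transformation_matrix matrix_works orthogonal_transformation_linear)
  have QQ: "Q ** transpose Q = mat 1" using Q by (simp add: orthogonal_matrix_def)
  define D :: "real^'n^'n" where "D = a *\<^sub>R mat 1 + b *\<^sub>R dyad e"
  have D: "D $ i $ j = (if i = j then (if i = k then a + b * (x \<bullet> x) else a) else 0)" for i j
    by (simp add: D_def mat_def dyad_def e_def axis_def power2_norm_eq_inner[symmetric] power2_eq_square)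
  have "a *\<^sub>R mat 1 + b *\<^sub>R dyad x = Q ** D ** transpose Q"
  proof -
    have "Q ** D ** transpose Q = a *\<^sub>R (Q ** transpose Q) + b *\<^sub>R (Q ** dyad e ** transpose Q)"
      by (simp add: D_def matrix_add_ldistrib matrix_mult_add_right_distrib scaleR_matrix_mult)
    then show ?thesis by (simp add: QQ Qe dyad_matrix_vector[symmetric])
  qed
  then have "det (a *\<^sub>R mat 1 + b *\<^sub>R dyad x) = det (Q ** transpose Q) * det D"
    by (simp add: det_mul)
  also have "\<dots> = (\<Prod>i\<in>UNIV. D $ i $ i)"
    using det_diagonal[of D] D by (simp add: QQ)
  also have "\<dots> = (a + b * (x \<bullet> x)) * (\<Prod>i\<in>UNIV - {k}. D $ i $ i)"
    by (subst prod.remove[of _ k]) (auto simp: D)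
  also have "(\<Prod>i\<in>UNIV - {k}. D $ i $ i) = (\<Prod>i\<in>UNIV - {k}. a)"
    by (rule prod.cong) (auto simp: D)
  finally show ?thesis by (simp add: mult_ac)
qed

lemma tendsto_det:
  fixes M :: "'a \<Rightarrow> real^'n^'n"
  assumes "\<And>i j. ((\<lambda>t. M t $ i $ j) \<longlongrightarrow> L $ i $ j) F"
  shows "((\<lambda>t. det (M t)) \<longlongrightarrow> det L) F"
  unfolding det_def by (intro tendsto_intros assms)

lemma tendsto_cof:
  fixes M :: "'a \<Rightarrow> real^'n^'n"
  assumes "\<And>i j. ((\<lambda>t. M t $ i $ j) \<longlongrightarrow> L $ i $ j) F"
  shows "((\<lambda>t. cof (M t) $ i $ j) \<longlongrightarrow> cof L $ i $ j) F"
proof -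
  have "((\<lambda>t. det (\<chi> k l. if k = i \<and> l = j then 1 else if k = i \<or> l = j then 0 else M t $ k $ l))
    \<longlongrightarrow> det (\<chi> k l. if k = i \<and> l = j then 1 else if k = i \<or> l = j then 0 else L $ k $ l)) F"
    by (rule tendsto_det) (simp add: assms)
  then show ?thesis by (simp add: cof_def)
qed

text \<open>If the matrix \<open>A\<close> is regular, then \<open>cof A\<close> is determined by \<open>(cof A) A\<^sup>T = (det A) I\<close>. The singular case
follows by continuity, because adding a small multiple of the identity makes \<open>A\<close> regular. It cannot
be left out: at this stage the determinant of \<open>Du\<close> may vanish.\<close>

lemma cof_scalar_plus_dyad:
  fixes x :: "real^'n"
  assumes n: "CARD('n) \<ge> 2"
  shows "cof (a *\<^sub>R mat 1 + b *\<^sub>R dyad x)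
       = a ^ (CARD('n) - 2) *\<^sub>R ((a + b * (x \<bullet> x)) *\<^sub>R mat 1 - b *\<^sub>R dyad x)" (is "cof (?A a) = ?B a")
proof -
  have regular: "cof (?A a) = ?B a" if "a \<noteq> 0" "a + b * (x \<bullet> x) \<noteq> 0" for a
  proof -
    have "CARD('n) - 1 = Suc (CARD('n) - 2)" using n by simp
    then have det: "det (?A a) = a ^ (CARD('n) - 2) * (a * (a + b * (x \<bullet> x)))"
      unfolding det_scalar_plus_dyad by simp
    have AB: "?A a ** ?B a = det (?A a) *\<^sub>R mat 1"
    proof -
      have "?A a ** ((a + b * (x \<bullet> x)) *\<^sub>R mat 1 - b *\<^sub>R dyad x)
          = (a * (a + b * (x \<bullet> x))) *\<^sub>R mat 1"
        by (simp add: matrix_mult_diff_left_distrib matrix_mult_add_right_distrib matrix_add_ldistrib scaleR_matrix_mult dyad_mult_dyad)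
           (simp add: vec_eq_iff algebra_simps)
      then show ?thesis by (simp add: det scaleR_matrix_mult)
    qed
    have "det (?A a) *\<^sub>R ?B a = cof (?A a) ** transpose (?A a) ** ?B a"
      by (simp add: cof_mult_transpose scaleR_matrix_mult)
    also have "\<dots> = cof (?A a) ** (?A a ** ?B a)"
      by (simp only: transpose_scalar_plus_dyad matrix_mul_assoc)
    also have "\<dots> = det (?A a) *\<^sub>R cof (?A a)"
      unfolding AB by (simp add: scaleR_matrix_mult)
    finally have eq: "det (?A a) *\<^sub>R ?B a = det (?A a) *\<^sub>R cof (?A a)" .
    have "det (?A a) \<noteq> 0" using that by (simp add: det)
    then show ?thesis by (rule scaleR_left_imp_eq[OF _ eq[symmetric]])
  qed
  have *: "cof (?A a) $ i $ j = ?B a $ i $ j" for i j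
  proof (rule tendsto_unique)
    show "at (0::real) \<noteq> bot" by simp
    show "((\<lambda>\<epsilon>. cof (?A (a + \<epsilon>)) $ i $ j) \<longlongrightarrow> cof (?A a) $ i $ j) (at 0)"
      by (rule tendsto_cof) (auto intro!: tendsto_eq_intros)
    have "((\<lambda>\<epsilon>. ?B (a + \<epsilon>) $ i $ j) \<longlongrightarrow> ?B a $ i $ j) (at 0)"
      by (auto intro!: tendsto_eq_intros)
    moreover have "\<forall>\<^sub>F \<epsilon> in at 0. ?B (a + \<epsilon>) $ i $ j = cof (?A (a + \<epsilon>)) $ i $ j"
    proof -
      have "\<forall>\<^sub>F \<epsilon> in at 0. \<epsilon> \<noteq> - a" "\<forall>\<^sub>F \<epsilon> in at 0. \<epsilon> \<noteq> - (a + b * (x \<bullet> x))"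
        by (rule eventually_neq_at_within)+
      then show ?thesis
        by eventually_elim (subst regular, auto)
    qed
    ultimately show "((\<lambda>\<epsilon>. cof (?A (a + \<epsilon>)) $ i $ j) \<longlongrightarrow> ?B a $ i $ j) (at 0)"
      by (rule Lim_transform_eventually)
  qed
  show ?thesis unfolding vec_eq_iff by (intro allI *)
qed

lemma cof_scalar_plus_dyad_inner_mat_1:
  fixes x :: "real^'n"
  assumes n: "CARD('n) \<ge> 2"
  shows "cof (a *\<^sub>R mat 1 + b *\<^sub>R dyad x) \<bullet> mat 1
       = a ^ (CARD('n) - 2) * (a + real (CARD('n) - 1) * (a + b * (x \<bullet> x)))"
proof -
  have "real CARD('n) = 1 + real (CARD('n) - 1)" using n by simp
  then show ?thesis unfolding cof_scalar_plus_dyad[OF n]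
    by (simp add: inner_diff_left mat_1_inner_mat_1 inner_commute[of "dyad x"] mat_1_inner_dyad algebra_simps)
qed

lemma cof_scalar_plus_dyad_inner_dyad:
  fixes x :: "real^'n"
  assumes n: "CARD('n) \<ge> 2"
  shows "cof (a *\<^sub>R mat 1 + b *\<^sub>R dyad x) \<bullet> dyad x = a ^ (CARD('n) - 1) * (x \<bullet> x)"
proof -
  have "CARD('n) - 1 = Suc (CARD('n) - 2)" using n by simp
  then show ?thesis unfolding cof_scalar_plus_dyad[OF n]
    by (simp add: inner_diff_left mat_1_inner_dyad dyad_inner_dyad power2_eq_square algebra_simps)
qed

section \<open>Approximation in the mean by continuous functions\<close>

lemma clamp_bounds: "M \<ge> 0 \<Longrightarrow> \<bar>max (- M) (min M t)\<bar> \<le> M" for M t :: real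
  by (auto simp: max_def min_def)

text \<open>A measurable function is an almost everywhere limit of continuous functions, but these need not be
dominated. So \<open>f\<close> is first truncated at a level \<open>M\<close>; then the continuous functions may be truncated at
the same level, and bounded convergence applies.\<close>

lemma L1_approx_continuous:
  fixes f :: "real \<Rightarrow> real"
  assumes f: "f absolutely_integrable_on {a..b}" and "\<epsilon> > 0"
  obtains g where "continuous_on UNIV g" "integral {a..b} (\<lambda>x. \<bar>g x - f x\<bar>) < \<epsilon>"
proof -
  let ?M = "lebesgue_on {a..b}"
  have fi: "integrable ?M f" using f by (simp add: integrable_restrict_space set_integrable_def)
  have fm: "f \<in> borel_measurable ?M" using fi by simp
  interpret finite_measure ?M
    by (rule finite_measureI) (simp add: emeasure_restrict_space space_restrict_space emeasure_lborel_Icc_eq)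
  have "f measurable_on {a..b}" using fm by (simp add: measurable_on_iff_borel_measurable)
  then obtain N g where N: "negligible N" and gc: "\<And>n. continuous_on UNIV (g n)"
    and lim: "\<And>x. x \<notin> N \<Longrightarrow> (\<lambda>n. g n x) \<longlonglongrightarrow> (if x \<in> {a..b} then f x else 0)"
    unfolding measurable_on_def by blast
  define cl where "cl M t = max (- M) (min M t)" for M t :: real
  have clc: "continuous_on UNIV (cl M)" for M unfolding cl_def by (intro continuous_intros)
  have clm: "(\<lambda>x. cl M (q x)) \<in> borel_measurable ?M" if "q \<in> borel_measurable ?M" for M q
    using that unfolding cl_def by measurable
  have gm: "g n \<in> borel_measurable ?M" for n
    using gc[of n] by (intro continuous_imp_measurable_on_sets_lebesgue) (auto intro: continuous_on_subset)
  have "(\<lambda>M. \<integral>x. \<bar>cl (real M) (f x) - f x\<bar> \<partial>?M) \<longlonglongrightarrow> (\<integral>x. 0 \<partial>?M)"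
  proof (rule integral_dominated_convergence[where w = "\<lambda>x. \<bar>f x\<bar>"])
    show "AE x in ?M. (\<lambda>M. \<bar>cl (real M) (f x) - f x\<bar>) \<longlonglongrightarrow> 0"
    proof (rule AE_I2)
      fix x
      obtain n where n: "\<bar>f x\<bar> \<le> real n" using real_arch_simple by blast
      have "\<forall>\<^sub>F M in sequentially. \<bar>cl (real M) (f x) - f x\<bar> = 0"
        using n by (intro eventually_sequentiallyI[of n]) (auto simp: cl_def max_def min_def)
      then show "(\<lambda>M. \<bar>cl (real M) (f x) - f x\<bar>) \<longlonglongrightarrow> 0" by (rule tendsto_eventually)
    qed
    show "AE x in ?M. norm \<bar>cl (real M) (f x) - f x\<bar> \<le> \<bar>f x\<bar>" for M
      by (rule AE_I2) (auto simp: cl_def max_def min_def)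
    show "(\<lambda>x. \<bar>cl (real M) (f x) - f x\<bar>) \<in> borel_measurable ?M" for M
      using clm[OF fm] fm by measurable
  qed (use fi in auto)
  then have "\<forall>\<^sub>F M in sequentially. (\<integral>x. \<bar>cl (real M) (f x) - f x\<bar> \<partial>?M) < \<epsilon> / 2"
    by (rule order_tendstoD) (use \<open>\<epsilon> > 0\<close> in simp)
  then obtain M :: nat where M: "(\<integral>x. \<bar>cl (real M) (f x) - f x\<bar> \<partial>?M) < \<epsilon> / 2"
    by (meson eventually_sequentially order_refl)
  have "(\<lambda>n. \<integral>x. \<bar>cl (real M) (g n x) - cl (real M) (f x)\<bar> \<partial>?M) \<longlonglongrightarrow> (\<integral>x. 0 \<partial>?M)"
  proof (rule integral_dominated_convergence[where w = "\<lambda>x. 2 * real M"])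
    have "AE x in lebesgue. x \<notin> N" using N by (intro AE_not_in) (simp add: negligible_iff_null_sets)
    then have "AE x in ?M. x \<notin> N" by (auto simp: AE_restrict_space_iff elim: eventually_mono)
    then show "AE x in ?M. (\<lambda>n. \<bar>cl (real M) (g n x) - cl (real M) (f x)\<bar>) \<longlonglongrightarrow> 0"
      using AE_space
    proof eventually_elim
      case (elim x)
      then have "(\<lambda>n. g n x) \<longlonglongrightarrow> f x" using lim[of x] by (simp add: space_restrict_space)
      then have "(\<lambda>n. cl (real M) (g n x)) \<longlonglongrightarrow> cl (real M) (f x)"
        unfolding cl_def by (intro tendsto_intros)
      then have "(\<lambda>n. cl (real M) (g n x) - cl (real M) (f x)) \<longlonglongrightarrow> 0" by (simp add: LIM_zero)
      then show ?case by (rule tendsto_rabs_zero)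
    qed
    show "AE x in ?M. norm \<bar>cl (real M) (g n x) - cl (real M) (f x)\<bar> \<le> 2 * real M" for n
      by (rule AE_I2) (auto simp: cl_def max_def min_def)
    show "(\<lambda>x. \<bar>cl (real M) (g n x) - cl (real M) (f x)\<bar>) \<in> borel_measurable ?M" for n
      using clm[OF fm] clm[OF gm] by measurable
  qed auto
  then have "\<forall>\<^sub>F n in sequentially. (\<integral>x. \<bar>cl (real M) (g n x) - cl (real M) (f x)\<bar> \<partial>?M) < \<epsilon> / 2"
    by (rule order_tendstoD) (use \<open>\<epsilon> > 0\<close> in simp)
  then obtain n where n: "(\<integral>x. \<bar>cl (real M) (g n x) - cl (real M) (f x)\<bar> \<partial>?M) < \<epsilon> / 2"
    by (meson eventually_sequentially order_refl)
  have i1: "integrable ?M (\<lambda>x. cl (real M) (f x))" "integrable ?M (\<lambda>x. cl (real M) (g n x))"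
    by (rule integrable_const_bound[of _ "real M"]; use clm[OF fm] clm[OF gm] clamp_bounds[of "real M"] in \<open>simp add: cl_def\<close>)+
  let ?g = "\<lambda>x. cl (real M) (g n x)"
  have "(\<integral>x. \<bar>?g x - f x\<bar> \<partial>?M)
     \<le> (\<integral>x. \<bar>?g x - cl (real M) (f x)\<bar> + \<bar>cl (real M) (f x) - f x\<bar> \<partial>?M)"
    using i1 fi by (intro integral_mono) auto
  also have "\<dots> = (\<integral>x. \<bar>?g x - cl (real M) (f x)\<bar> \<partial>?M) + (\<integral>x. \<bar>cl (real M) (f x) - f x\<bar> \<partial>?M)"
    using i1 fi by (intro Bochner_Integration.integral_add) auto
  finally have "(\<integral>x. \<bar>?g x - f x\<bar> \<partial>?M) < \<epsilon>" using M n by linarith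
  moreover have "(\<integral>x. \<bar>?g x - f x\<bar> \<partial>?M) = integral {a..b} (\<lambda>x. \<bar>?g x - f x\<bar>)"
    using i1 fi by (intro lebesgue_integral_eq_integral) auto
  moreover have "continuous_on UNIV ?g"
    by (rule continuous_on_compose2[OF clc gc]) auto
  ultimately show thesis using that[of ?g] by simp
qed

lemma absolutely_integrable_continuous_mult:
  fixes q h :: "real \<Rightarrow> real"
  assumes "continuous_on {a..b} q" "h absolutely_integrable_on {a..b}"
  shows "(\<lambda>t. q t * h t) absolutely_integrable_on {a..b}"
proof (rule absolutely_integrable_bounded_measurable_product_real[OF _ _ _ assms(2)])
  show "q \<in> borel_measurable (lebesgue_on {a..b})"
    by (rule continuous_imp_measurable_on_sets_lebesgue[OF assms(1)]) simp
  show "bounded (q ` {a..b})"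
    by (rule compact_imp_bounded, rule compact_continuous_image[OF assms(1)]) simp
qed simp

section \<open>Calculus of absolutely continuous functions on an interval\<close>

text \<open>\<open>F\<close> is absolutely continuous on \<open>[a,b]\<close> and \<open>f\<close> is its derivative almost everywhere, expressed by the
fundamental theorem of calculus, so that no differentiation theorem for Lebesgue integrals is needed.\<close>

definition primitive_on :: "real \<Rightarrow> real \<Rightarrow> (real \<Rightarrow> real) \<Rightarrow> (real \<Rightarrow> real) \<Rightarrow> bool" where
  "primitive_on a b F f \<longleftrightarrow> f absolutely_integrable_on {a..b} \<and>
     (\<forall>x\<in>{a..b}. F x = F a + integral {a..x} f)"

lemma primitive_on_absolutely_integrable: "primitive_on a b F f \<Longrightarrow> f absolutely_integrable_on {a..b}"
  unfolding primitive_on_def by blast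

lemma primitive_on_integral: "primitive_on a b F f \<Longrightarrow> x \<in> {a..b} \<Longrightarrow> integral {a..x} f = F x - F a"
  unfolding primitive_on_def by fastforce

lemma primitive_on_continuous: 
  assumes "primitive_on a b F f" shows "continuous_on {a..b} F"
proof -
  have "f integrable_on {a..b}"
    using primitive_on_absolutely_integrable[OF assms] by (simp add: absolutely_integrable_on_def)
  then have "continuous_on {a..b} (\<lambda>x. F a + integral {a..x} f)"
    by (intro continuous_intros indefinite_integral_continuous_1)
  then show ?thesis
    by (rule continuous_on_eq) (simp add: primitive_on_integral[OF assms])
qed

lemma primitive_on_C1:
  assumes "\<And>x. x \<in> {a..b} \<Longrightarrow> (F has_real_derivative f x) (at x within {a..b})" "continuous_on {a..b} f"
  shows "primitive_on a b F f"
  unfolding primitive_on_def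
proof (intro conjI ballI)
  show "f absolutely_integrable_on {a..b}" by (rule absolutely_integrable_continuous_real[OF assms(2)])
  show "F x = F a + integral {a..x} f" if x: "x \<in> {a..b}" for x
  proof -
    have "(f has_integral F x - F a) {a..x}"
    proof (rule fundamental_theorem_of_calculus)
      show "a \<le> x" using x by simp
      show "(F has_vector_derivative f t) (at t within {a..x})" if "t \<in> {a..x}" for t
        unfolding has_real_derivative_iff_has_vector_derivative[symmetric]
        by (rule DERIV_subset[OF assms(1)]) (use that x in auto)
    qed
    then show ?thesis by (simp add: integral_unique)
  qed
qed

lemma primitive_on_cong:
  assumes "primitive_on a b F f" "\<And>x. x \<in> {a..b} \<Longrightarrow> F x = G x"
    "\<And>x. x \<in> {a..b} \<Longrightarrow> f x = g x"
  shows "primitive_on a b G g"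
proof -
  have "g absolutely_integrable_on {a..b}"
    using primitive_on_absolutely_integrable[OF assms(1)] 
    by (subst set_integrable_cong[of lebesgue lebesgue "{a..b}" "{a..b}" g f]) (simp_all add: assms(3))
  moreover have "G x = G a + integral {a..x} g" if x: "x \<in> {a..b}" for x
  proof -
    have "integral {a..x} g = integral {a..x} f"
      by (rule Henstock_Kurzweil_Integration.integral_cong) (use assms(3) x in simp)
    moreover have "F x = F a + integral {a..x} f" by (simp add: primitive_on_integral[OF assms(1) x])
    moreover have "F x = G x" "F a = G a" using assms(2)[of x] assms(2)[of a] x by simp_all
    ultimately show ?thesis by simp
  qed
  ultimately show ?thesis unfolding primitive_on_def by blast
qed

lemma primitive_on_add:
  assumes "primitive_on a b F f" "primitive_on a b G g"
  shows "primitive_on a b (\<lambda>x. F x + G x) (\<lambda>x. f x + g x)"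
  unfolding primitive_on_def
proof (intro conjI ballI)
  show "(\<lambda>x. f x + g x) absolutely_integrable_on {a..b}"
    by (intro set_integral_add assms[THEN primitive_on_absolutely_integrable])
  show "F x + G x = F a + G a + integral {a..x} (\<lambda>x. f x + g x)" if x: "x \<in> {a..b}" for x
  proof -
    have "f integrable_on {a..x}" "g integrable_on {a..x}"
      by (rule integrable_on_subinterval[OF set_lebesgue_integral_eq_integral(1)[OF primitive_on_absolutely_integrable]],
          rule assms, use x in simp)+
    then show ?thesis
      using primitive_on_integral[OF assms(1) x] primitive_on_integral[OF assms(2) x]
      by (simp add: integral_add)
  qed
qed

lemma primitive_on_cmult:
  assumes "primitive_on a b F f"
  shows "primitive_on a b (\<lambda>x. c * F x) (\<lambda>x. c * f x)"
  unfolding primitive_on_def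
proof (intro conjI ballI)
  show "(\<lambda>x. c * f x) absolutely_integrable_on {a..b}"
    using primitive_on_absolutely_integrable[OF assms] by simp
  show "c * F x = c * F a + integral {a..x} (\<lambda>x. c * f x)" if x: "x \<in> {a..b}" for x
    by (simp add: primitive_on_integral[OF assms x] right_diff_distrib)
qed

text \<open>Approximate \<open>f\<close> in \<open>L\<^sup>1\<close> by continuous functions \<open>g\<^sub>k\<close>. Their primitives \<open>G\<^sub>k\<close> converge uniformly to \<open>F\<close>,
and for them the claim is the classical chain rule. In the limit, \<open>\<Psi>'(G\<^sub>k) g\<^sub>k\<close> is split as
\<open>\<Psi>'(G\<^sub>k) (g\<^sub>k - f) + \<Psi>'(G\<^sub>k) f\<close>: the first term tends to zero in \<open>L\<^sup>1\<close> because \<open>\<Psi>'\<close> is bounded near the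
range of \<open>F\<close>, the second one converges by domination.\<close>

theorem primitive_on_chain_rule:
  fixes \<Psi> :: "real \<Rightarrow> real"
  assumes F: "primitive_on a b F f" and "open U" and FU: "F ` {a..b} \<subseteq> U"
    and \<Psi>: "\<And>t. t \<in> U \<Longrightarrow> (\<Psi> has_real_derivative \<Psi>' t) (at t)" and c: "continuous_on U \<Psi>'"
  shows "primitive_on a b (\<lambda>x. \<Psi> (F x)) (\<lambda>x. \<Psi>' (F x) * f x)"
proof (cases "a \<le> b")
  case False
  then show ?thesis by (simp add: primitive_on_def)
next
  case ab: True
  have f: "f absolutely_integrable_on {a..b}" by (rule primitive_on_absolutely_integrable[OF F])
  have Fc: "continuous_on {a..b} F" by (rule primitive_on_continuous[OF F])
  have "compact (F ` {a..b})" by (intro compact_continuous_image Fc) simp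
  \<comment> \<open>a compact neighbourhood of the range of \<open>F\<close> inside \<open>U\<close>, to which the approximations are confined\<close>
  then obtain \<delta> where \<delta>: "\<delta> > 0" "(\<Union>y\<in>F ` {a..b}. cball y \<delta>) \<subseteq> U"
    using compact_subset_open_imp_cball_epsilon_subset[of "F ` {a..b}" U] FU \<open>open U\<close> by auto
  define K where "K = (\<Union>y\<in>F ` {a..b}. cball y \<delta>)"
  have K: "compact K" unfolding K_def by (rule compact_minkowski_sum_cball) fact
  have KU: "K \<subseteq> U" using \<delta> by (simp add: K_def)
  have "bounded (\<Psi>' ` K)"
    by (intro compact_imp_bounded compact_continuous_image K continuous_on_subset[OF c KU])
  then obtain C where C: "\<And>t. t \<in> K \<Longrightarrow> \<bar>\<Psi>' t\<bar> \<le> C" by (auto simp: bounded_iff)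
  have "\<exists>g. continuous_on UNIV g \<and> integral {a..b} (\<lambda>x. \<bar>g x - f x\<bar>) < \<delta> / (real k + 1)" for k :: nat
    using L1_approx_continuous[OF f, of "\<delta> / (real k + 1)"] \<delta>(1) by (metis divide_pos_pos of_nat_0_le_iff add_nonneg_pos zero_less_one)
  then obtain g where gc: "\<And>k. continuous_on UNIV (g k)"
    and g: "\<And>k :: nat. integral {a..b} (\<lambda>x. \<bar>g k x - f x\<bar>) < \<delta> / (real k + 1)" by metis
  have gi: "g k absolutely_integrable_on {x..y}" for k x y
    by (intro absolutely_integrable_continuous_real continuous_on_subset[OF gc]) auto
  have fi: "f absolutely_integrable_on {a..x}" if "x \<le> b" for x
    by (rule set_integrable_subset[OF f]) (use that in auto)
  define G where "G k x = F a + integral {a..x} (g k)" for k x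
  have Gd: "(G k has_real_derivative g k x) (at x within {a..b})" if "x \<in> {a..b}" for k x
  proof -
    have "((\<lambda>x. integral {a..x} (g k)) has_vector_derivative g k x) (at x within {a..b})"
      by (rule integral_has_vector_derivative[OF continuous_on_subset[OF gc] that]) auto
    then show ?thesis unfolding G_def
      by (auto intro!: derivative_eq_intros simp: has_real_derivative_iff_has_vector_derivative)
  qed
  have gf: "integral {a..x} (\<lambda>t. \<bar>g k t - f t\<bar>) < \<delta> / (real k + 1)" if "x \<in> {a..b}" for k x
  proof -
    have "(\<lambda>t. \<bar>g k t - f t\<bar>) absolutely_integrable_on {a..b}"
      by (intro set_integrable_abs set_integral_diff(1) gi f)
    then have "(\<lambda>t. \<bar>g k t - f t\<bar>) integrable_on {a..b}" by (simp add: absolutely_integrable_on_def)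
    then have "integral {a..x} (\<lambda>t. \<bar>g k t - f t\<bar>) \<le> integral {a..b} (\<lambda>t. \<bar>g k t - f t\<bar>)"
      by (intro integral_subset_le integrable_on_subinterval[of _ "{a..b}" a x]) (use that in auto)
    then show ?thesis using g[of k] by simp
  qed
  have GF: "\<bar>G k x - F x\<bar> \<le> \<delta> / (real k + 1)" if "x \<in> {a..b}" for k x
  proof -
    have i: "g k integrable_on {a..x}" "f integrable_on {a..x}" "(\<lambda>t. \<bar>g k t - f t\<bar>) integrable_on {a..x}"
      using gi[of a x k] fi[of x] set_integrable_abs[OF set_integral_diff(1)[OF gi[of a x k] fi[of x]]] that
      by (auto simp: absolutely_integrable_on_def)
    have "G k x - F x = integral {a..x} (\<lambda>t. g k t - f t)"
      using primitive_on_integral[OF F that] i by (simp add: G_def integral_diff)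
    also have "\<bar>\<dots>\<bar> \<le> integral {a..x} (\<lambda>t. \<bar>g k t - f t\<bar>)"
      using i integral_norm_bound_integral[of "\<lambda>t. g k t - f t" "{a..x}" "\<lambda>t. \<bar>g k t - f t\<bar>"]
      by (auto intro: integrable_diff)
    finally show ?thesis using gf[OF that, of k] by simp
  qed
  have inv0: "(\<lambda>k. \<delta> / (real k + 1)) \<longlonglongrightarrow> 0"
    using tendsto_mult_right_zero[OF LIMSEQ_inverse_real_of_nat, of \<delta>]
    by (simp add: divide_inverse add.commute)
  have GK: "G k x \<in> K" if "x \<in> {a..b}" for k x
  proof -
    have "\<delta> / (real k + 1) \<le> \<delta>" using \<delta>(1) by (simp add: field_simps)
    then have "G k x \<in> cball (F x) \<delta>" using GF[OF that, of k] by (simp add: dist_real_def abs_minus_commute)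
    then show ?thesis using that by (auto simp: K_def)
  qed
  have FK: "F x \<in> K" if "x \<in> {a..b}" for x using that \<delta>(1) by (auto simp: K_def intro!: bexI[of _ x])
  have Glim: "(\<lambda>k. G k x) \<longlonglongrightarrow> F x" if "x \<in> {a..b}" for x
    using Lim_null_comparison[OF always_eventually inv0, of "\<lambda>k. G k x - F x"] GF[OF that] by (simp add: LIM_zero_iff)
  have \<Psi>F: "continuous_on {a..b} (\<lambda>x. \<Psi>' (F x))"
    by (rule continuous_on_compose2[OF c Fc FU])
  note prod = absolutely_integrable_continuous_mult
  have main: "\<Psi> (F x) = \<Psi> (F a) + integral {a..x} (\<lambda>t. \<Psi>' (F t) * f t)" if x: "x \<in> {a..b}" for x
  proof -
    have sub: "{a..x} \<subseteq> {a..b}" using x by auto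
    have Gc: "continuous_on {a..b} (G k)" for k
      unfolding continuous_on_eq_continuous_within using Gd by (meson DERIV_isCont has_field_derivative_imp_has_derivative has_derivative_continuous)
    have \<Psi>G: "continuous_on {a..x} (\<lambda>t. \<Psi>' (G k t))" for k
      by (rule continuous_on_subset[OF continuous_on_compose2[OF c Gc] sub]) (use GK KU in auto)
    have FTC: "integral {a..x} (\<lambda>t. \<Psi>' (G k t) * g k t) = \<Psi> (G k x) - \<Psi> (G k a)" for k
    proof (rule integral_unique, rule fundamental_theorem_of_calculus)
      show "a \<le> x" using x by simp
      fix t assume t: "t \<in> {a..x}"
      have "(\<Psi> has_real_derivative \<Psi>' (G k t)) (at (G k t))"
        by (rule \<Psi>) (use GK KU t x in auto)
      moreover have "(G k has_real_derivative g k t) (at t within {a..x})"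
        by (rule DERIV_subset[OF Gd sub]) (use t x in auto)
      ultimately have "((\<lambda>t. \<Psi> (G k t)) has_real_derivative \<Psi>' (G k t) * g k t) (at t within {a..x})"
        by (rule DERIV_chain2)
      then show "((\<lambda>t. \<Psi> (G k t)) has_vector_derivative \<Psi>' (G k t) * g k t) (at t within {a..x})"
        by (simp add: has_real_derivative_iff_has_vector_derivative)
    qed
    have fx: "f absolutely_integrable_on {a..x}" using fi x by simp
    have gfx: "(\<lambda>t. g k t - f t) absolutely_integrable_on {a..x}" for k
      by (intro set_integral_diff(1) gi fx)
    have i1: "(\<lambda>t. \<Psi>' (G k t) * (g k t - f t)) integrable_on {a..x}" for k
      using prod[OF \<Psi>G gfx] by (simp add: absolutely_integrable_on_def)
    have i2: "(\<lambda>t. \<Psi>' (G k t) * f t) integrable_on {a..x}" for k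
      using prod[OF \<Psi>G fx] by (simp add: absolutely_integrable_on_def)
    have split: "integral {a..x} (\<lambda>t. \<Psi>' (G k t) * (g k t - f t)) + integral {a..x} (\<lambda>t. \<Psi>' (G k t) * f t)
       = \<Psi> (G k x) - \<Psi> (G k a)" for k
      unfolding FTC[symmetric] integral_add[OF i1 i2, symmetric] by (simp add: algebra_simps)
    have 1: "(\<lambda>k. integral {a..x} (\<lambda>t. \<Psi>' (G k t) * (g k t - f t))) \<longlonglongrightarrow> 0"
    proof (rule Lim_null_comparison[OF always_eventually])
      show "(\<lambda>k. C * (\<delta> / (real k + 1))) \<longlonglongrightarrow> 0"
        using tendsto_mult_right_zero[OF inv0] .
      have C0: "0 \<le> C" using C[OF FK[OF x]] by simp
      show "\<forall>k. norm (integral {a..x} (\<lambda>t. \<Psi>' (G k t) * (g k t - f t))) \<le> C * (\<delta> / (real k + 1))"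
      proof
        fix k
        have "(\<lambda>t. C * \<bar>g k t - f t\<bar>) integrable_on {a..x}"
          by (intro set_lebesgue_integral_eq_integral(1) set_integrable_mult_right set_integrable_abs gfx)
        then have "norm (integral {a..x} (\<lambda>t. \<Psi>' (G k t) * (g k t - f t)))
          \<le> integral {a..x} (\<lambda>t. C * \<bar>g k t - f t\<bar>)"
          using x GK by (intro integral_norm_bound_integral i1) (auto simp: abs_mult intro!: mult_right_mono C)
        also have "\<dots> \<le> C * (\<delta> / (real k + 1))"
          unfolding integral_mult_right by (rule mult_left_mono[OF less_imp_le[OF gf[OF x]] C0])
        finally show "norm (integral {a..x} (\<lambda>t. \<Psi>' (G k t) * (g k t - f t))) \<le> C * (\<delta> / (real k + 1))" .
      qed
    qed
    have 2: "(\<lambda>k. integral {a..x} (\<lambda>t. \<Psi>' (G k t) * f t)) \<longlonglongrightarrow> integral {a..x} (\<lambda>t. \<Psi>' (F t) * f t)"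
    proof (rule dominated_convergence(2)[where h = "\<lambda>t. C * \<bar>f t\<bar>"])
      show "(\<lambda>t. C * \<bar>f t\<bar>) integrable_on {a..x}"
        by (intro set_lebesgue_integral_eq_integral(1) set_integrable_mult_right set_integrable_abs fx)
      show "norm (\<Psi>' (G k t) * f t) \<le> C * \<bar>f t\<bar>" if "t \<in> {a..x}" for k t
        using that x GK by (auto simp: abs_mult intro!: mult_right_mono C)
      show "(\<lambda>k. \<Psi>' (G k t) * f t) \<longlonglongrightarrow> \<Psi>' (F t) * f t" if "t \<in> {a..x}" for t
      proof -
        have t: "t \<in> {a..b}" using that x by auto
        have "F t \<in> U" using FU t by blast
        then have "isCont \<Psi>' (F t)" using c \<open>open U\<close> by (simp add: continuous_on_eq_continuous_at)
        then show ?thesis by (intro tendsto_intros isCont_tendsto_compose[OF _ Glim[OF t]])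
      qed
    qed (rule i2)
    have 3: "(\<lambda>k. \<Psi> (G k y)) \<longlonglongrightarrow> \<Psi> (F y)" if "y \<in> {a..b}" for y
    proof -
      have "F y \<in> U" using FU that by blast
      then have "isCont \<Psi> (F y)" by (rule DERIV_isCont[OF \<Psi>])
      then show ?thesis by (rule isCont_tendsto_compose[OF _ Glim[OF that]])
    qed
    have "(\<lambda>k. \<Psi> (G k x) - \<Psi> (G k a)) \<longlonglongrightarrow> 0 + integral {a..x} (\<lambda>t. \<Psi>' (F t) * f t)"
      unfolding split[symmetric] by (intro tendsto_add 1 2)
    moreover have "(\<lambda>k. \<Psi> (G k x) - \<Psi> (G k a)) \<longlonglongrightarrow> \<Psi> (F x) - \<Psi> (F a)"
      using x ab by (intro tendsto_diff 3) auto
    ultimately have "0 + integral {a..x} (\<lambda>t. \<Psi>' (F t) * f t) = \<Psi> (F x) - \<Psi> (F a)"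
      by (rule LIMSEQ_unique)
    then show ?thesis by simp
  qed
  show ?thesis unfolding primitive_on_def using prod[OF \<Psi>F f] main by blast
qed

lemma primitive_on_power:
  assumes "primitive_on a b F f"
  shows "primitive_on a b (\<lambda>x. F x ^ m) (\<lambda>x. real m * F x ^ (m - 1) * f x)"
  by (rule primitive_on_chain_rule[OF assms open_UNIV]) (auto intro!: derivative_eq_intros continuous_intros)

lemma primitive_on_inverse:
  assumes "primitive_on a b F f" "\<And>x. x \<in> {a..b} \<Longrightarrow> F x \<noteq> 0"
  shows "primitive_on a b (\<lambda>x. inverse (F x)) (\<lambda>x. - (inverse (F x))\<^sup>2 * f x)"
proof (rule primitive_on_chain_rule[OF assms(1), of "- {0}"])
  show "(inverse has_real_derivative - (inverse t)\<^sup>2) (at t)" if "t \<in> - {0}" for t :: real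
    using that DERIV_inverse[of t] by (simp add: power2_eq_square)
qed (use assms(2) in \<open>auto intro!: continuous_intros\<close>)

text \<open>The product is a combination of squares, so its rule follows from the chain rule.\<close>

lemma primitive_on_mult:
  assumes "primitive_on a b F f" "primitive_on a b G g"
  shows "primitive_on a b (\<lambda>x. F x * G x) (\<lambda>x. f x * G x + F x * g x)"
proof -
  note d = primitive_on_add[OF assms(1) primitive_on_cmult[OF assms(2), of "-1"]]
  have "primitive_on a b (\<lambda>x. 1/4 * (F x + G x) ^ 2 + (- 1/4) * (F x + -1 * G x) ^ 2)
     (\<lambda>x. 1/4 * (real 2 * (F x + G x) ^ (2 - 1) * (f x + g x))
         + (- 1/4) * (real 2 * (F x + -1 * G x) ^ (2 - 1) * (f x + -1 * g x)))"
    by (intro primitive_on_add[of a b "\<lambda>x. 1/4 * (F x + G x) ^ 2"] primitive_on_cmult primitive_on_power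
        primitive_on_add[OF assms] d)
  then show ?thesis
    by (rule primitive_on_cong) (simp_all add: power2_eq_square algebra_simps)
qed

section \<open>Weak derivatives in one variable\<close>

lemma C1_real_derivative:
  fixes \<eta> :: "real \<Rightarrow> real"
  assumes "C1 \<eta>" shows "(\<eta> has_real_derivative frechet_derivative \<eta> (at t) 1) (at t)"
proof -
  have "linear (frechet_derivative \<eta> (at t))"
    using has_derivative_linear[OF C1_has_derivative[OF assms]] .
  then have "frechet_derivative \<eta> (at t) (c *\<^sub>R 1) = c *\<^sub>R frechet_derivative \<eta> (at t) 1" for c
    by (rule linear_cmul)
  then have "frechet_derivative \<eta> (at t) c = frechet_derivative \<eta> (at t) 1 * c" for c
    unfolding real_scaleR_def mult_1_right by (rule trans) (rule mult.commute)
  then have "frechet_derivative \<eta> (at t) = (*) (frechet_derivative \<eta> (at t) 1)" by (rule ext)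
  from this[symmetric] show ?thesis using C1_has_derivative[OF assms, of t] by (simp only: has_field_derivative_def)
qed

lemma C1_realI:
  fixes \<eta> :: "real \<Rightarrow> real"
  assumes "\<And>t. (\<eta> has_real_derivative \<eta>' t) (at t)" "continuous_on UNIV \<eta>'"
  shows "C1 \<eta>" "frechet_derivative \<eta> (at t) v = \<eta>' t * v"
proof -
  have d: "(\<eta> has_derivative (*) (\<eta>' t)) (at t)" for t
    using assms(1) by (simp add: has_field_derivative_def)
  show "C1 \<eta>" by (rule C1I[OF d]) (intro continuous_intros assms(2))
  show "frechet_derivative \<eta> (at t) v = \<eta>' t * v"
    using fun_cong[OF frechet_derivative_at[OF d, of t], of v] by simp
qed

text \<open>Weak derivatives are defined with Lebesgue integrals over an open set. All computations are done with
integrals over a compact set that contains the support of the test function.\<close>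

lemma LINT_eq_integral_on_support:
  fixes h :: "'a::euclidean_space \<Rightarrow> real"
  assumes "h absolutely_integrable_on K" "K \<subseteq> S" "\<And>t. t \<in> S - K \<Longrightarrow> h t = 0"
  shows "(LINT t:S|lebesgue. h t) = integral K h"
proof -
  have "indicator S t *\<^sub>R h t = indicator K t *\<^sub>R h t" for t
    using assms(2,3) by (auto simp: indicator_def)
  then show ?thesis
    using set_lebesgue_integral_eq_integral(2)[OF assms(1)] by (simp only: set_lebesgue_integral_def)
qed

lemma integral_eq_if_vanishing_on_difference:
  fixes h :: "real \<Rightarrow> real"
  assumes "\<And>t. t \<in> S - T \<Longrightarrow> h t = 0" "\<And>t. t \<in> T - S \<Longrightarrow> h t = 0"
  shows "integral S h = integral T h"
proof -
  have "(\<lambda>x. if x \<in> S then h x else 0) = (\<lambda>x. if x \<in> T then h x else 0)"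
    using assms by (auto simp: fun_eq_iff)
  then have "integral UNIV (\<lambda>x. if x \<in> S then h x else 0) = integral UNIV (\<lambda>x. if x \<in> T then h x else 0)"
    by (rule arg_cong)
  then show ?thesis by (simp only: integral_restrict_UNIV)
qed

lemma compact_subset_open_interval:
  fixes l r :: real
  assumes "compact K" "K \<subseteq> {l<..<r}" "l < r"
  obtains a b where "l < a" "a < b" "b < r" "K \<subseteq> {a<..<b}"
proof (cases "K = {}")
  case True
  obtain a where "l < a" "a < r" using dense[OF assms(3)] by blast
  moreover obtain b where "a < b" "b < r" using dense[OF \<open>a < r\<close>] by blast
  ultimately show thesis using that True by blast
next
  case False
  obtain x y where xy: "x \<in> K" "\<And>t. t \<in> K \<Longrightarrow> x \<le> t" "y \<in> K" "\<And>t. t \<in> K \<Longrightarrow> t \<le> y"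
    using compact_attains_inf[OF assms(1) False] compact_attains_sup[OF assms(1) False] by metis
  have "l < x" "y < r" "x \<le> y" using xy assms(2) by auto
  show thesis
  proof (rule that[of "(l + x) / 2" "(y + r) / 2"])
    show "K \<subseteq> {(l + x) / 2<..<(y + r) / 2}"
    proof
      fix t assume "t \<in> K"
      then have "x \<le> t" "t \<le> y" using xy(2,4) by blast+
      then show "t \<in> {(l + x) / 2<..<(y + r) / 2}" using \<open>l < x\<close> \<open>y < r\<close> by simp
    qed
  qed (use \<open>l < x\<close> \<open>y < r\<close> \<open>x \<le> y\<close> in simp_all)
qed

text \<open>A primitive that starts left of the support is zero again right of it, because the integral is zero.\<close>

lemma primitive_with_compact_support:
  fixes \<theta> :: "real \<Rightarrow> real"
  assumes c: "continuous_on UNIV \<theta>" and supp: "\<And>t. t \<notin> {a..b} \<Longrightarrow> \<theta> t = 0"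
    and zero: "integral {a..b} \<theta> = 0"
  obtains \<eta> where "C1 \<eta>" "\<And>t. t \<notin> {a..b} \<Longrightarrow> \<eta> t = 0" "\<And>t. frechet_derivative \<eta> (at t) 1 = \<theta> t"
proof -
  \<comment> \<open>Integration starts left of the support, so that the primitive vanishes near \<open>a\<close> from the left and the two descriptions of it overlap.\<close>
  define c0 where "c0 = a - 1"
  define \<eta> where "\<eta> t = (if t \<ge> c0 then integral {c0..t} \<theta> else 0)" for t
  have int: "\<theta> integrable_on {x..y}" for x y
    by (intro integrable_continuous_real continuous_on_subset[OF c]) auto
  have left: "\<eta> t = 0" if "t < a" for t
  proof -
    have "integral {c0..t} \<theta> = integral {c0..t} (\<lambda>_. 0)"
      by (rule Henstock_Kurzweil_Integration.integral_cong) (use that supp in auto)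
    then show ?thesis by (simp add: \<eta>_def)
  qed
  have right: "\<eta> t = 0" if "b < t" "a \<le> t" for t
  proof -
    have "integral {c0..t} \<theta> = integral {a..b} \<theta>"
      by (rule integral_eq_if_vanishing_on_difference) (use that supp in \<open>auto simp: c0_def\<close>)
    then show ?thesis by (simp add: \<eta>_def zero)
  qed
  have "(\<eta> has_real_derivative \<theta> t) (at t)" for t
  proof (cases "t < a")
    case True
    have "(\<eta> has_real_derivative 0) (at t)"
      by (rule has_field_derivative_transform_within_open[of "\<lambda>_. 0" _ _ "{..<a}"])
         (use True left in auto)
    then show ?thesis using supp[of t] True by simp
  next
    case False
    have "((\<lambda>t. integral {c0..t} \<theta>) has_real_derivative \<theta> t) (at t within {c0..t + 1})"
      using False by (intro integral_has_real_derivative continuous_on_subset[OF c]) (auto simp: c0_def)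
    moreover have "at t within {c0..t + 1} = at t"
      by (rule at_within_interior) (use False in \<open>auto simp: c0_def\<close>)
    ultimately have "((\<lambda>t. integral {c0..t} \<theta>) has_real_derivative \<theta> t) (at t)" by simp
    then show ?thesis
      by (rule has_field_derivative_transform_within_open[of _ _ _ "{c0<..}"])
         (use False in \<open>auto simp: c0_def \<eta>_def\<close>)
  qed
  note \<eta> = C1_realI[OF this c]
  show thesis
  proof (rule that[OF \<eta>(1)])
    show "frechet_derivative \<eta> (at t) 1 = \<theta> t" for t by (simp add: \<eta>(2))
    show "\<eta> t = 0" if "t \<notin> {a..b}" for t using that left[of t] right[of t] by force
  qed
qed

lemma indefinite_integral_on_open_interval:
  fixes Q :: "real \<Rightarrow> real"
  assumes Q: "\<And>a b. l < a \<Longrightarrow> b < r \<Longrightarrow> Q absolutely_integrable_on {a..b}"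
  obtains A where "\<And>a b. l < a \<Longrightarrow> b < r \<Longrightarrow> primitive_on a b A Q"
proof -
  define m where "m = (l + r) / 2"
  define A where "A x = (if m \<le> x then integral {m..x} Q else - integral {x..m} Q)" for x
  have i: "Q integrable_on {a..b}" if "l < a" "b < r" for a b
    by (rule set_lebesgue_integral_eq_integral(1)[OF Q[OF that]])
  have eq: "A x = A a + integral {a..x} Q" if "l < a" "a \<le> x" "x < r" for a x
  proof -
    have lr: "l < m" "m < r" using that by (auto simp: m_def)
    consider "m \<le> a" | "a < m" "m \<le> x" | "x < m" by linarith
    then show ?thesis
    proof cases
      case 1
      have "integral {m..a} Q + integral {a..x} Q = integral {m..x} Q"
        by (rule Henstock_Kurzweil_Integration.integral_combine) (use that lr 1 i in auto)
      then show ?thesis using 1 that by (simp add: A_def)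
    next
      case 2
      have "integral {a..m} Q + integral {m..x} Q = integral {a..x} Q"
        by (rule Henstock_Kurzweil_Integration.integral_combine) (use that lr 2 i in auto)
      then show ?thesis using 2 that by (simp add: A_def)
    next
      case 3
      have "integral {a..x} Q + integral {x..m} Q = integral {a..m} Q"
        by (rule Henstock_Kurzweil_Integration.integral_combine) (use that lr 3 i in auto)
      then show ?thesis using 3 that by (simp add: A_def)
    qed
  qed
  have "primitive_on a b A Q" if "l < a" "b < r" for a b
    unfolding primitive_on_def by (intro conjI ballI Q eq) (use that in auto)
  then show thesis using that by blast
qed

lemma bump_with_integral_1:
  fixes l r :: real
  assumes "l < r"
  obtains \<omega> :: "real \<Rightarrow> real" and a b where "C1 \<omega>" "l < a" "a < b" "b < r" "\<And>t. t \<notin> {a..b} \<Longrightarrow> \<omega> t = 0" "integral {a..b} \<omega> = 1"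
proof -
  define m where "m = (l + r) / 2"
  define \<rho> where "\<rho> = (r - l) / 4"
  define a where "a = m - \<rho>" define b where "b = m + \<rho>"
  have \<rho>: "\<rho> > 0" and lab: "l < a" "a < b" "b < r"
    using assms by (auto simp: a_def b_def m_def \<rho>_def field_simps)
  define W :: "real \<Rightarrow> real" where "W t = (max 0 (\<rho>\<^sup>2 - (t - m) \<bullet> (t - m)))\<^sup>2" for t
  have W: "C1 W" unfolding W_def[abs_def]
    by (intro C1_pos_part_square C1_diff C1_const C1_inner_self_diff)
  have W0: "W t = 0" if "t \<notin> {a..b}" for t
  proof -
    have "\<rho> \<le> \<bar>t - m\<bar>" using that by (auto simp: a_def b_def)
    then have "\<rho>\<^sup>2 \<le> (t - m)\<^sup>2" using \<rho> by (metis abs_le_square_iff abs_of_pos)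
    then show ?thesis by (simp add: W_def power2_eq_square)
  qed
  have Wc: "continuous_on {a..b} W" by (rule C1_continuous[OF W])
  have "integral {a..b} W \<noteq> 0"
  proof
    assume "integral {a..b} W = 0"
    moreover have "(W has_integral integral {a..b} W) {a..b}"
      using integrable_continuous_real[OF Wc] by blast
    ultimately have "W m = 0"
      using has_integral_0_cbox_imp_0[of a b W m] Wc lab by (auto simp: W_def a_def b_def)
    then show False using \<rho> by (simp add: W_def)
  qed
  then have I: "integral {a..b} (\<lambda>t. 1 / integral {a..b} W * W t) = 1" by simp
  show thesis
  proof (rule that[OF _ lab])
    show "C1 (\<lambda>t. 1 / integral {a..b} W * W t)" by (intro C1_mult C1_const W)
    show "1 / integral {a..b} W * W t = 0" if "t \<notin> {a..b}" for t using W0[OF that] by simp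
  qed (rule I)
qed

text \<open>If \<open>A\<close> is a primitive of \<open>Q\<close>, integration by parts shows that \<open>R = P - A\<close> is orthogonal to the derivatives
of all test functions, that is, to all test functions with integral zero. Every test function differs
from one of these by a multiple of a fixed \<open>\<omega>\<close> with integral one, so \<open>R\<close> minus the constant
\<open>\<integral> \<omega> R\<close> is orthogonal to all test functions.\<close>

theorem du_Bois_Reymond:
  fixes P Q :: "real \<Rightarrow> real"
  assumes "l < r"
    and P: "\<And>a b. l < a \<Longrightarrow> b < r \<Longrightarrow> P absolutely_integrable_on {a..b}"
    and Q: "\<And>a b. l < a \<Longrightarrow> b < r \<Longrightarrow> Q absolutely_integrable_on {a..b}"
    and weak: "\<And>\<eta>. \<eta> \<in> C1c {l<..<r} \<Longrightarrow>
      (LINT t:{l<..<r}|lebesgue. frechet_derivative \<eta> (at t) 1 * P t)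
        = - (LINT t:{l<..<r}|lebesgue. \<eta> t * Q t)"
  obtains P' where "AE t in lebesgue. t \<in> {l<..<r} \<longrightarrow> P t = P' t"
    "\<And>a b. l < a \<Longrightarrow> b < r \<Longrightarrow> primitive_on a b P' Q"
proof -
  obtain A where A: "\<And>a b. l < a \<Longrightarrow> b < r \<Longrightarrow> primitive_on a b A Q"
    using indefinite_integral_on_open_interval[OF Q, of l r] by blast
  define R where "R t = P t - A t" for t
  have Ai: "A absolutely_integrable_on {a..b}" if "l < a" "b < r" for a b
    by (rule absolutely_integrable_continuous_real[OF primitive_on_continuous[OF A[OF that]]])
  have R: "R absolutely_integrable_on {a..b}" if "l < a" "b < r" for a b
    unfolding R_def by (intro set_integral_diff(1) P Ai that)
  have ci: "(\<lambda>t. q t * h t) integrable_on {a..b}" "(\<lambda>t. q t * h t) absolutely_integrable_on {a..b}"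
    if "continuous_on UNIV q" "h absolutely_integrable_on {a..b}" for q h :: "real \<Rightarrow> real" and a b
    using absolutely_integrable_continuous_mult[OF continuous_on_subset[OF that(1)] that(2)]
    by (auto dest: set_lebesgue_integral_eq_integral(1))
  have R0: "integral {a..b} (\<lambda>t. frechet_derivative \<eta> (at t) 1 * R t) = 0"
    if \<eta>: "C1 \<eta>" and ab: "l < a" "a < b" "b < r" and supp: "\<And>t. t \<notin> {a<..<b} \<Longrightarrow> \<eta> t = 0"
      "\<And>t. t \<notin> {a..b} \<Longrightarrow> frechet_derivative \<eta> (at t) 1 = 0" for \<eta> a b
  proof -
    let ?D = "\<lambda>t. frechet_derivative \<eta> (at t) 1"
    have Dc: "continuous_on UNIV ?D" by (rule C1_continuous_derivative[OF \<eta>])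
    have \<eta>c: "continuous_on UNIV \<eta>" by (rule C1_continuous[OF \<eta>])
    have sub: "{a..b} \<subseteq> {l<..<r}" using ab by auto
    have mem: "\<eta> \<in> C1c {l<..<r}"
      by (rule C1cI[OF \<eta> compact_Icc sub]) (use supp in auto)
    have 1: "integral {a..b} (\<lambda>t. ?D t * P t) = - integral {a..b} (\<lambda>t. \<eta> t * Q t)"
    proof -
      have "(LINT t:{l<..<r}|lebesgue. ?D t * P t) = integral {a..b} (\<lambda>t. ?D t * P t)"
        by (rule LINT_eq_integral_on_support[OF ci(2)[OF Dc P] sub]) (use ab supp in auto)
      moreover have "(LINT t:{l<..<r}|lebesgue. \<eta> t * Q t) = integral {a..b} (\<lambda>t. \<eta> t * Q t)"
        by (rule LINT_eq_integral_on_support[OF ci(2)[OF \<eta>c Q] sub]) (use ab supp in auto)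
      ultimately show ?thesis using weak[OF mem] by simp
    qed
    have "primitive_on a b \<eta> ?D"
      by (rule primitive_on_C1) (auto intro: has_field_derivative_at_within C1_real_derivative \<eta> continuous_on_subset[OF Dc])
    from primitive_on_mult[OF this A[OF ab(1,3)]]
    have "integral {a..b} (\<lambda>t. ?D t * A t + \<eta> t * Q t) = \<eta> b * A b - \<eta> a * A a"
      by (rule primitive_on_integral) (use ab in auto)
    then have 2: "integral {a..b} (\<lambda>t. ?D t * A t) + integral {a..b} (\<lambda>t. \<eta> t * Q t) = 0"
      using supp(1)[of a] supp(1)[of b] integral_add[OF ci(1)[OF Dc Ai[OF ab(1,3)]] ci(1)[OF \<eta>c Q[OF ab(1,3)]]]
      by simp
    have "integral {a..b} (\<lambda>t. ?D t * P t - ?D t * A t) = integral {a..b} (\<lambda>t. ?D t * P t) - integral {a..b} (\<lambda>t. ?D t * A t)"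
      by (intro integral_diff ci Dc P Ai ab)
    then show ?thesis using 1 2 by (simp add: R_def right_diff_distrib)
  qed
  obtain \<omega> :: "real \<Rightarrow> real" and a0 b0 where \<omega>1: "C1 \<omega>" and lab0: "l < a0" "a0 < b0" "b0 < r"
    and \<omega>2: "\<And>t. t \<notin> {a0..b0} \<Longrightarrow> \<omega> t = 0" "integral {a0..b0} \<omega> = 1"
    by (rule bump_with_integral_1[OF \<open>l < r\<close>]) blast
  note \<omega> = \<omega>1 \<omega>2
  have shrink: "integral {a..b} h = integral {a0..b0} h" if "a \<le> a0" "b0 \<le> b" "\<And>t. t \<notin> {a0..b0} \<Longrightarrow> h t = 0"
    for h :: "real \<Rightarrow> real" and a b
    by (rule integral_eq_if_vanishing_on_difference) (use that in auto)
  define \<kappa> where "\<kappa> = integral {a0..b0} (\<lambda>t. \<omega> t * R t)"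
  have "AE t in lebesgue. t \<in> {l<..<r} \<longrightarrow> R t - \<kappa> = 0"
  proof (rule fundamental_lemma_calculus_of_variations)
    fix K :: "real set" assume K: "compact K" "K \<subseteq> {l<..<r}"
    then obtain a b where ab: "l < a" "a < b" "b < r" "K \<subseteq> {a<..<b}"
      by (rule compact_subset_open_interval[OF _ _ \<open>l < r\<close>])
    have "(\<lambda>t. R t - \<kappa>) absolutely_integrable_on {a..b}"
      by (intro set_integral_diff(1) R ab) auto
    then show "(\<lambda>t. R t - \<kappa>) absolutely_integrable_on K"
      by (rule set_integrable_subset[OF _ fmeasurableD[OF lmeasurable_compact[OF K(1)]]]) (use ab in auto)
  next
    fix \<psi> :: "real \<Rightarrow> real" assume "\<psi> \<in> C1c {l<..<r}"
    then obtain K where \<psi>: "C1 \<psi>" and K: "compact K" "K \<subseteq> {l<..<r}" "\<And>t. t \<notin> K \<Longrightarrow> \<psi> t = 0"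
      by (rule C1cE) blast
    obtain a1 b1 where ab1: "l < a1" "a1 < b1" "b1 < r" "K \<subseteq> {a1<..<b1}"
      by (rule compact_subset_open_interval[OF K(1,2) \<open>l < r\<close>])
    define a where "a = min a1 a0" define b where "b = max b1 b0"
    have ab: "l < a" "a < b" "b < r" "a \<le> a0" "b0 \<le> b" "K \<subseteq> {a..b}"
      using ab1 lab0 by (auto simp: a_def b_def min_def max_def subset_iff)
    \<comment> \<open>A slightly larger interval, at whose end points the primitive of \<open>\<theta>\<close> already vanishes.\<close>
    obtain a2 where a2: "l < a2" "a2 < a" using dense[OF ab(1)] by blast
    obtain b2 where b2: "b < b2" "b2 < r" using dense[OF ab(3)] by blast
    define s where "s = integral {a..b} \<psi>"
    define \<theta> where "\<theta> t = \<psi> t - s * \<omega> t" for t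
    have c: "continuous_on UNIV \<psi>" "continuous_on UNIV \<omega>" by (auto intro: C1_continuous \<psi> \<omega>)
    then have \<theta>c: "continuous_on UNIV \<theta>" unfolding \<theta>_def by (intro continuous_intros)
    have \<theta>0: "\<theta> t = 0" if "t \<notin> {a..b}" for t
    proof -
      have "t \<notin> K" "t \<notin> {a0..b0}" using ab that by auto
      then show ?thesis using K(3) \<omega>(2) by (simp add: \<theta>_def)
    qed
    have ii: "q integrable_on {a..b}" if "continuous_on UNIV q" for q :: "real \<Rightarrow> real" and a b
      by (intro integrable_continuous_real continuous_on_subset[OF that]) auto
    have "integral {a..b} \<theta> = integral {a..b} \<psi> - integral {a..b} (\<lambda>t. s * \<omega> t)"
      unfolding \<theta>_def by (intro integral_diff ii continuous_intros c)
    also have "\<dots> = 0" using \<omega>(3) shrink[OF ab(4,5), of \<omega>] \<omega>(2) by (simp add: s_def)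
    finally have z: "integral {a..b} \<theta> = 0" .
    obtain \<eta> where \<eta>: "C1 \<eta>" "\<And>t. t \<notin> {a..b} \<Longrightarrow> \<eta> t = 0" "\<And>t. frechet_derivative \<eta> (at t) 1 = \<theta> t"
      by (rule primitive_with_compact_support[OF \<theta>c \<theta>0 z]) blast+
    have "integral {a2..b2} (\<lambda>t. frechet_derivative \<eta> (at t) 1 * R t) = 0"
    proof (rule R0[OF \<eta>(1)])
      show "\<eta> t = 0" if "t \<notin> {a2<..<b2}" for t by (rule \<eta>(2)) (use that a2 b2 in auto)
      show "frechet_derivative \<eta> (at t) 1 = 0" if "t \<notin> {a2..b2}" for t
        unfolding \<eta>(3) by (rule \<theta>0) (use that a2 b2 in auto)
    qed (use a2 b2 ab in simp_all)
    then have 0: "integral {a2..b2} (\<lambda>t. \<theta> t * R t) = 0" by (simp add: \<eta>(3))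
    have lr2: "l < a2" "b2 < r" using a2 b2 by auto
    have const: "(\<lambda>t. \<kappa>) absolutely_integrable_on {a2..b2}" by auto
    have "integral {a2..b2} (\<lambda>t. s * (\<omega> t * R t)) = s * \<kappa>"
      using shrink[of a2 b2 "\<lambda>t. \<omega> t * R t"] \<omega>(2) a2 b2 ab by (simp add: \<kappa>_def)
    moreover have "integral {a2..b2} \<psi> = s"
      unfolding s_def
    proof (rule integral_eq_if_vanishing_on_difference)
      show "\<psi> t = 0" if "t \<in> {a2..b2} - {a..b}" for t by (rule K(3)) (use that ab(6) in auto)
      show "\<psi> t = 0" if "t \<in> {a..b} - {a2..b2}" for t using that a2 b2 by auto
    qed
    moreover have "integral {a2..b2} (\<lambda>t. \<theta> t * R t)
       = integral {a2..b2} (\<lambda>t. \<psi> t * R t) - integral {a2..b2} (\<lambda>t. s * (\<omega> t * R t))"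
      unfolding \<theta>_def left_diff_distrib mult.assoc
      by (intro integral_diff ci integrable_on_mult_right c R lr2)
    moreover have "integral {a2..b2} (\<lambda>t. \<psi> t * (R t - \<kappa>))
       = integral {a2..b2} (\<lambda>t. \<psi> t * R t) - integral {a2..b2} (\<lambda>t. \<psi> t * \<kappa>)"
      unfolding right_diff_distrib
      by (intro integral_diff ci c R lr2 const)
    ultimately have "integral {a2..b2} (\<lambda>t. \<psi> t * (R t - \<kappa>)) = 0" using 0 by simp
    moreover have "(LINT t:{l<..<r}|lebesgue. \<psi> t * (R t - \<kappa>)) = integral {a2..b2} (\<lambda>t. \<psi> t * (R t - \<kappa>))"
    proof (rule LINT_eq_integral_on_support)
      show "(\<lambda>t. \<psi> t * (R t - \<kappa>)) absolutely_integrable_on {a2..b2}"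
        by (intro ci(2) c set_integral_diff(1) R lr2 const)
      show "\<psi> t * (R t - \<kappa>) = 0" if "t \<in> {l<..<r} - {a2..b2}" for t
      proof -
        have "t \<notin> K" using that ab(6) a2 b2 by auto
        then show ?thesis using K(3) by simp
      qed
    qed (use a2 b2 ab in auto)
    ultimately show "(LINT t:{l<..<r}|lebesgue. \<psi> t * (R t - \<kappa>)) = 0" by simp
  qed simp
  then have ae: "AE t in lebesgue. t \<in> {l<..<r} \<longrightarrow> P t = A t + \<kappa>"
    by eventually_elim (auto simp: R_def)
  have prim: "primitive_on a b (\<lambda>t. A t + \<kappa>) Q" if "l < a" "b < r" for a b
    using primitive_on_add[OF A[OF that] primitive_on_C1[of a b "\<lambda>_. \<kappa>" "\<lambda>_. 0"]] by simp
  show thesis by (rule that[OF ae prim])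
qed

section \<open>Weak derivatives of radial functions\<close>

text \<open>The second factor needs to be differentiable on \<open>S\<close> only. This admits functions of \<open>|x|\<close>, which are
not differentiable at the origin, as factors of test functions on the punctured ball.\<close>

lemma C1c_mult_local:
  fixes \<eta> q :: "'a::euclidean_space \<Rightarrow> real"
  assumes \<eta>: "\<eta> \<in> C1c S" and S: "open S"
    and q: "\<And>x. x \<in> S \<Longrightarrow> (q has_derivative q' x) (at x)" and c: "\<And>v. continuous_on S (\<lambda>x. q' x v)"
  shows "(\<lambda>x. \<eta> x * q x) \<in> C1c S"
    and "frechet_derivative (\<lambda>x. \<eta> x * q x) (at x) v = frechet_derivative \<eta> (at x) v * q x + \<eta> x * q' x v"
proof -
  obtain K where K: "C1 \<eta>" "compact K" "K \<subseteq> S" "\<And>x. x \<notin> K \<Longrightarrow> \<eta> x = 0"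
    "\<And>x. x \<notin> K \<Longrightarrow> frechet_derivative \<eta> (at x) = (\<lambda>v. 0)" by (rule C1cE[OF \<eta>]) blast
  have opK: "open (- K)" using K(2) by (simp add: compact_imp_closed open_Compl)
  let ?F = "\<lambda>x v. frechet_derivative \<eta> (at x) v * q x + \<eta> x * q' x v"
  have d: "((\<lambda>x. \<eta> x * q x) has_derivative ?F x) (at x)" for x
  proof (cases "x \<in> S")
    case True
    from has_derivative_mult[OF C1_has_derivative[OF K(1), of x] q[OF True]]
    show ?thesis by (simp add: add.commute mult.commute)
  next
    case False
    then have x: "x \<notin> K" using K(3) by blast
    have "((\<lambda>x. \<eta> x * q x) has_derivative (\<lambda>v. 0)) (at x)"
    proof (rule has_derivative_transform_within_open[of "\<lambda>x. 0"])
      show "open (- K)" by (rule opK)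
      show "x \<in> - K" using x by simp
      show "0 = \<eta> y * q y" if "y \<in> - K" for y using K(4)[of y] that by simp
    qed (rule has_derivative_const)
    then show ?thesis using K(4)[OF x] K(5)[OF x] by simp
  qed
  have cF: "continuous_on UNIV (\<lambda>x. ?F x v)" for v
  proof -
    have "continuous_on S q" using q has_derivative_continuous continuous_at_imp_continuous_on by blast
    then have "continuous_on S (\<lambda>x. ?F x v)"
      by (intro continuous_intros c C1_continuous[OF K(1)]
          continuous_on_subset[OF C1_continuous_derivative[OF K(1)]]) auto
    moreover have "continuous_on (- K) (\<lambda>x. ?F x v)"
      by (rule continuous_on_eq[OF continuous_on_const[of _ 0]]) (use K(4,5) in auto)
    ultimately have "continuous_on (S \<union> - K) (\<lambda>x. ?F x v)"
      by (intro continuous_on_open_Un S opK)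
    moreover have "S \<union> - K = UNIV" using K(3) by auto
    ultimately show ?thesis by simp
  qed
  have "C1 (\<lambda>x. \<eta> x * q x)" by (rule C1I[OF d cF])
  then show "(\<lambda>x. \<eta> x * q x) \<in> C1c S" by (rule C1cI[OF _ K(2,3)]) (simp add: K(4))
  show "frechet_derivative (\<lambda>x. \<eta> x * q x) (at x) v = ?F x v"
    using fun_cong[OF frechet_derivative_at[OF d, of x], of v] by simp
qed

lemma integrable_bounded_mult:
  fixes f b :: "'a \<Rightarrow> real"
  assumes "integrable M f" "b \<in> borel_measurable M" "\<And>x. \<bar>b x\<bar> \<le> C"
  shows "integrable M (\<lambda>x. b x * f x)"
proof (rule Bochner_Integration.integrable_bound)
  show "integrable M (\<lambda>x. C * \<bar>f x\<bar>)" using assms(1) by simp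
  show "(\<lambda>x. b x * f x) \<in> borel_measurable M" using assms(1,2) by measurable
  show "AE x in M. norm (b x * f x) \<le> norm (C * \<bar>f x\<bar>)"
  proof (rule AE_I2)
    fix x
    have "0 \<le> C" using assms(3)[of x] by linarith
    then show "norm (b x * f x) \<le> norm (C * \<bar>f x\<bar>)"
      by (simp add: abs_mult mult_right_mono assms(3))
  qed
qed

lemma LINT_eq_lborel_integral:
  fixes h :: "'a::euclidean_space \<Rightarrow> real"
  assumes "h \<in> borel_measurable borel" "\<And>x. x \<notin> S \<Longrightarrow> h x = 0"
  shows "(LINT x:S|lebesgue. h x) = (\<integral>x. h x \<partial>lborel)"
proof -
  have "indicator S x *\<^sub>R h x = h x" for x using assms(2) by (cases "x \<in> S") auto
  moreover have "h \<in> borel_measurable lborel" using assms(1) by simp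
  ultimately show ?thesis unfolding set_lebesgue_integral_def by (simp only: integral_completion)
qed

lemma absolutely_integrable_imp_integrable_lborel:
  fixes h :: "'a::euclidean_space \<Rightarrow> real"
  assumes "h absolutely_integrable_on S" "h \<in> borel_measurable borel" "S \<in> sets borel"
  shows "integrable lborel (\<lambda>x. indicator S x * h x)"
proof -
  have "integrable lebesgue (\<lambda>x. indicator S x * h x)"
    using assms(1) by (simp add: set_integrable_def)
  moreover have "(\<lambda>x. indicator S x * h x) \<in> borel_measurable lborel"
    using assms(2,3) by (auto intro!: borel_measurable_times borel_measurable_indicator)
  ultimately show ?thesis by (simp add: integrable_completion)
qed

lemma lborel_integral_eq_integral:
  fixes h :: "'a::euclidean_space \<Rightarrow> real"
  assumes "h absolutely_integrable_on S" "h \<in> borel_measurable borel" "S \<in> sets borel"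
  shows "(\<integral>x. indicator S x * h x \<partial>lborel) = integral S h"
proof -
  have "(\<lambda>x. indicator S x * h x) \<in> borel_measurable lborel"
    using assms(2,3) by (auto intro!: borel_measurable_times borel_measurable_indicator)
  then have "(\<integral>x. indicator S x * h x \<partial>lborel) = (LINT x:S|lebesgue. h x)"
    by (simp add: set_lebesgue_integral_def integral_completion)
  then show ?thesis using set_lebesgue_integral_eq_integral(2)[OF assms(1)] by simp
qed

lemma radial_weight_le:
  assumes "r \<le> 1" shows "radial_weight d r \<le> real d * unit_ball_vol (real d)"
proof (cases "r \<ge> 0")
  case True
  have "real d * unit_ball_vol (real d) * r ^ (d - 1) \<le> real d * unit_ball_vol (real d) * 1"
    using True assms by (intro mult_left_mono power_le_one) auto
  then show ?thesis using True by (simp add: radial_weight_def)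
qed (simp add: radial_weight_def)

text \<open>The area of spheres is bounded in the unit ball, so integrals of radial functions are controlled by
integrals of their profiles.\<close>

lemma radial_integrable_on_annulus:
  fixes h :: "real \<Rightarrow> real"
  assumes h: "h absolutely_integrable_on {a..b}" and [measurable]: "h \<in> borel_measurable borel" and "b \<le> 1"
  shows "integrable (lborel :: 'a::euclidean_space measure) (\<lambda>x. indicator {a..b} (norm x) * h (norm x))"
    and "(\<integral>x. indicator {a..b} (norm x) * \<bar>h (norm x)\<bar> \<partial>(lborel :: 'a measure))
      \<le> real DIM('a) * unit_ball_vol (real DIM('a)) * integral {a..b} (\<lambda>r. \<bar>h r\<bar>)"
proof -
  let ?\<kappa> = "real DIM('a) * unit_ball_vol (real DIM('a))"
  have i: "integrable lborel (\<lambda>r. indicator {a..b} r * h r)"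
    by (rule absolutely_integrable_imp_integrable_lborel[OF h]) auto
  have ia: "integrable lborel (\<lambda>r. indicator {a..b} r * \<bar>h r\<bar>)"
    using integrable_abs[OF i] by (simp add: abs_mult)
  have b: "radial_weight DIM('a) r * (indicator {a..b} r * q) = min ?\<kappa> (radial_weight DIM('a) r) * (indicator {a..b} r * q)" for r q
    using radial_weight_le[of r "DIM('a)"] \<open>b \<le> 1\<close> by (auto simp: indicator_def min_def)
  have m: "(\<lambda>r. min ?\<kappa> (radial_weight DIM('a) r)) \<in> borel_measurable lborel" by measurable
  have bd: "\<bar>min ?\<kappa> (radial_weight DIM('a) r)\<bar> \<le> ?\<kappa>" for r
    using radial_weight_nonneg[of "DIM('a)" r] by (simp add: min_def)
  have "integrable lborel (\<lambda>r. radial_weight DIM('a) r * (indicator {a..b} r * h r))"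
    unfolding b by (rule integrable_bounded_mult[OF i m bd])
  then show "integrable (lborel :: 'a measure) (\<lambda>x. indicator {a..b} (norm x) * h (norm x))"
    by (subst integrable_radial_iff) auto
  have iw: "integrable lborel (\<lambda>r. radial_weight DIM('a) r * (indicator {a..b} r * \<bar>h r\<bar>))"
    unfolding b by (rule integrable_bounded_mult[OF ia m bd])
  have "(\<integral>x. indicator {a..b} (norm x) * \<bar>h (norm x)\<bar> \<partial>(lborel :: 'a measure))
     = (\<integral>r. radial_weight DIM('a) r * (indicator {a..b} r * \<bar>h r\<bar>) \<partial>lborel)"
    by (subst integral_radial) auto
  also have "\<dots> \<le> (\<integral>r. ?\<kappa> * (indicator {a..b} r * \<bar>h r\<bar>) \<partial>lborel)"
  proof (rule integral_mono[OF iw])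
    show "integrable lborel (\<lambda>r. ?\<kappa> * (indicator {a..b} r * \<bar>h r\<bar>))" using ia by simp
    show "radial_weight DIM('a) r * (indicator {a..b} r * \<bar>h r\<bar>) \<le> ?\<kappa> * (indicator {a..b} r * \<bar>h r\<bar>)" for r
      unfolding b by (rule mult_right_mono) auto
  qed
  also have "\<dots> = ?\<kappa> * integral {a..b} (\<lambda>r. \<bar>h r\<bar>)"
    using lborel_integral_eq_integral[OF set_integrable_abs[OF h]] by simp
  finally show "(\<integral>x. indicator {a..b} (norm x) * \<bar>h (norm x)\<bar> \<partial>(lborel :: 'a measure))
      \<le> ?\<kappa> * integral {a..b} (\<lambda>r. \<bar>h r\<bar>)" .
qed

lemma compact_in_punctured_ball:
  fixes K :: "'a::real_normed_vector set"
  assumes "compact K" "K \<subseteq> ball 0 1 - {0}"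
  obtains a b where "0 < a" "a < b" "b < 1" "\<And>x. x \<in> K \<Longrightarrow> a < norm x \<and> norm x < b"
proof -
  have "compact (norm ` K)" by (intro compact_continuous_image assms continuous_intros)
  moreover have "norm ` K \<subseteq> {0<..<1}" using assms(2) by (auto simp: dist_norm)
  ultimately obtain a b :: real where "0 < a" "a < b" "b < 1" "norm ` K \<subseteq> {a<..<b}"
    by (rule compact_subset_open_interval) auto
  then show thesis by (intro that[of a b]) auto
qed

text \<open>For a \<open>C\<^sup>1\<close> profile \<open>\<Gamma>\<close> the identity says that the integral of the derivative of \<open>\<eta>(x) \<Gamma>(|x|)\<close> in
direction \<open>v\<close> vanishes. In general, take for \<open>\<Gamma>\<close> the primitive of a continuous function \<open>\<gamma>\<close> that is
\<open>L\<^sup>1\<close>-close to \<open>g\<close> on an interval that contains \<open>|x|\<close> for all \<open>x\<close> in the support of \<open>\<eta>\<close>. There \<open>\<Gamma>\<close> is uniformly close to \<open>\<phi>\<close>, so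
both integrals change by no more than a constant times the distance of \<open>\<gamma>\<close> and \<open>g\<close>.\<close>

theorem weak_derivative_radial:
  fixes \<phi> g :: "real \<Rightarrow> real" and \<eta> :: "'a::euclidean_space \<Rightarrow> real"
  assumes prim: "\<And>a b. 0 < a \<Longrightarrow> b < 1 \<Longrightarrow> primitive_on a b \<phi> g"
    and \<phi>m [measurable]: "\<phi> \<in> borel_measurable borel" and gm [measurable]: "g \<in> borel_measurable borel"
    and \<eta>: "\<eta> \<in> C1c (ball 0 1 - {0})"
  shows "(\<integral>x. frechet_derivative \<eta> (at x) v * \<phi> (norm x) \<partial>lborel)
       = - (\<integral>x. \<eta> x * (g (norm x) * (v \<bullet> sgn x)) \<partial>lborel)"
proof -
  let ?S = "ball 0 1 - {0} :: 'a set"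
  obtain K where K: "C1 \<eta>" "compact K" "K \<subseteq> ?S" "\<And>x. x \<notin> K \<Longrightarrow> \<eta> x = 0"
    "\<And>x. x \<notin> K \<Longrightarrow> frechet_derivative \<eta> (at x) = (\<lambda>v. 0)" by (rule C1cE[OF \<eta>]) blast
  obtain a b where ab: "0 < a" "a < b" "b < 1" and Kab: "\<And>x. x \<in> K \<Longrightarrow> a < norm x \<and> norm x < b"
    by (rule compact_in_punctured_ball[OF K(2,3)]) blast
  define D where "D x = frechet_derivative \<eta> (at x) v" for x
  define w where "w x = \<eta> x * (v \<bullet> sgn x)" for x
  define I where "I x = (indicator {a..b} (norm x) :: real)" for x :: 'a
  have Dc: "continuous_on UNIV D" unfolding D_def[abs_def] by (rule C1_continuous_derivative[OF K(1)])
  have \<eta>c: "continuous_on UNIV \<eta>" by (rule C1_continuous[OF K(1)])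
  have [measurable]: "D \<in> borel_measurable borel" "\<eta> \<in> borel_measurable borel"
    by (intro borel_measurable_continuous_onI Dc \<eta>c)+
  have [measurable]: "w \<in> borel_measurable borel" unfolding w_def[abs_def] sgn_div_norm by measurable
  have [measurable]: "I \<in> borel_measurable borel" unfolding I_def[abs_def] by measurable
  have I1: "I x = 1" if "x \<in> K" for x using Kab[OF that] by (simp add: I_def)
  have DI: "D x = D x * I x" for x
    using I1[of x] K(5)[of x] by (cases "x \<in> K") (auto simp: D_def)
  have wI: "w x = w x * I x" for x
    using I1[of x] K(4)[of x] by (cases "x \<in> K") (auto simp: w_def)
  obtain M where M: "\<And>x. \<bar>D x\<bar> \<le> M" "\<And>x. \<bar>w x\<bar> \<le> M"
  proof -
    obtain M1 where M1: "\<And>x. x \<in> K \<Longrightarrow> \<bar>D x\<bar> \<le> M1"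
      using compact_imp_bounded[OF compact_continuous_image[OF continuous_on_subset[OF Dc subset_UNIV] K(2)]]
      by (auto simp: bounded_iff)
    obtain M2 where M2: "\<And>x. x \<in> K \<Longrightarrow> \<bar>\<eta> x\<bar> \<le> M2"
      using compact_imp_bounded[OF compact_continuous_image[OF continuous_on_subset[OF \<eta>c subset_UNIV] K(2)]]
      by (auto simp: bounded_iff)
    have s: "\<bar>v \<bullet> sgn x\<bar> \<le> norm v" for x
      using Cauchy_Schwarz_ineq2[of v "sgn x"] by (simp add: norm_sgn split: if_splits)
    show thesis
    proof (rule that[of "max 0 (max M1 (M2 * norm v))"])
      show "\<bar>D x\<bar> \<le> max 0 (max M1 (M2 * norm v))" for x
        using M1[of x] K(5)[of x] by (cases "x \<in> K") (auto simp: D_def)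
      show "\<bar>w x\<bar> \<le> max 0 (max M1 (M2 * norm v))" for x
      proof (cases "x \<in> K")
        case True
        have "\<bar>w x\<bar> \<le> M2 * norm v" unfolding w_def abs_mult
          by (rule mult_mono[OF M2[OF True] s]) (use M2[OF True] in auto)
        then show ?thesis by linarith
      qed (simp add: w_def K(4))
    qed
  qed
  have M0: "M \<ge> 0" using M(1)[of 0] by linarith
  let ?\<kappa> = "real DIM('a) * unit_ball_vol (real DIM('a))"
  have pab: "primitive_on a b \<phi> g" using prim ab by blast
  have \<phi>i: "\<phi> absolutely_integrable_on {a..b}"
    by (rule absolutely_integrable_continuous_real[OF primitive_on_continuous[OF pab]])
  have gi: "g absolutely_integrable_on {a..b}" by (rule primitive_on_absolutely_integrable[OF pab])
  have i: "integrable lborel (\<lambda>x. q x * f (norm x))"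
    if "f absolutely_integrable_on {a..b}" "f \<in> borel_measurable borel"
      "q \<in> borel_measurable borel" "\<And>x. \<bar>q x\<bar> \<le> M" "\<And>x. q x = q x * I x"
    for f :: "real \<Rightarrow> real" and q :: "'a \<Rightarrow> real"
  proof -
    have "integrable lborel (\<lambda>x. q x * (I x * f (norm x)))"
      unfolding I_def
      by (rule integrable_bounded_mult[OF radial_integrable_on_annulus(1)[OF that(1,2)]]) (use ab that in auto)
    then show ?thesis by (subst that(5)) (simp add: mult.assoc)
  qed
  define T where "T = (\<integral>x. D x * \<phi> (norm x) + w x * g (norm x) \<partial>lborel)"
  have "\<bar>T\<bar> \<le> M * ?\<kappa> * 2 * \<epsilon>" if "\<epsilon> > 0" for \<epsilon>
  proof -
    obtain \<gamma> where \<gamma>: "continuous_on UNIV \<gamma>" "integral {a..b} (\<lambda>t. \<bar>\<gamma> t - g t\<bar>) < \<epsilon>"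
      by (rule L1_approx_continuous[OF gi \<open>\<epsilon> > 0\<close>])
    have [measurable]: "\<gamma> \<in> borel_measurable borel" by (rule borel_measurable_continuous_onI[OF \<gamma>(1)])
    have \<gamma>i: "\<gamma> absolutely_integrable_on {x..y}" for x y
      by (intro absolutely_integrable_continuous_real continuous_on_subset[OF \<gamma>(1)]) auto
    have \<gamma>int: "\<gamma> integrable_on {x..y}" for x y by (rule set_lebesgue_integral_eq_integral(1)[OF \<gamma>i])
    define \<Gamma> where "\<Gamma> t = integral {0..t} \<gamma> + (\<phi> a - integral {0..a} \<gamma>)" for t
    have \<Gamma>d: "(\<Gamma> has_real_derivative \<gamma> t) (at t)" if "t > 0" for t
    proof -
      have "((\<lambda>t. integral {0..t} \<gamma>) has_real_derivative \<gamma> t) (at t within {0..t + 1})"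
        using that by (intro integral_has_real_derivative continuous_on_subset[OF \<gamma>(1)]) auto
      moreover have "at t within {0..t + 1} = at t" by (rule at_within_interior) (use that in auto)
      ultimately show ?thesis unfolding \<Gamma>_def by (auto intro!: derivative_eq_intros)
    qed
    \<comment> \<open>\<open>\<Gamma>\<close> is controlled on the positive axis only; the cut-off version is Borel measurable everywhere.\<close>
    define \<Gamma>0 where "\<Gamma>0 t = indicator {0<..} t * \<Gamma> t" for t
    have "continuous_on {0<..} \<Gamma>"
      by (intro continuous_at_imp_continuous_on ballI DERIV_isCont[OF \<Gamma>d]) simp
    then have \<Gamma>m [measurable]: "\<Gamma>0 \<in> borel_measurable borel"
      unfolding \<Gamma>0_def[abs_def]
      using borel_measurable_continuous_on_indicator[of "{0<..}" \<Gamma>] by simp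
    have \<Gamma>\<phi>: "\<bar>\<Gamma>0 t - \<phi> t\<bar> \<le> \<epsilon>" if t: "t \<in> {a..b}" for t
    proof -
      have "integral {0..a} \<gamma> + integral {a..t} \<gamma> = integral {0..t} \<gamma>"
        by (rule Henstock_Kurzweil_Integration.integral_combine) (use ab t \<gamma>int in auto)
      moreover have "\<Gamma>0 t = \<Gamma> t" using t ab by (simp add: \<Gamma>0_def)
      moreover have gt: "g absolutely_integrable_on {a..t}"
        by (rule set_integrable_subset[OF gi]) (use t in auto)
      moreover have "integral {a..t} (\<lambda>s. \<gamma> s - g s) = integral {a..t} \<gamma> - integral {a..t} g"
        by (intro integral_diff \<gamma>int set_lebesgue_integral_eq_integral(1)[OF gt])
      ultimately have "\<Gamma>0 t - \<phi> t = integral {a..t} (\<lambda>s. \<gamma> s - g s)"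
        using primitive_on_integral[OF pab t] by (simp add: \<Gamma>_def)
      also have "\<bar>\<dots>\<bar> \<le> integral {a..t} (\<lambda>s. \<bar>\<gamma> s - g s\<bar>)"
        using integral_norm_bound_integral[of "\<lambda>s. \<gamma> s - g s" "{a..t}" "\<lambda>s. \<bar>\<gamma> s - g s\<bar>"]
          set_lebesgue_integral_eq_integral(1)[OF set_integral_diff(1)[OF \<gamma>i gt]]
          set_lebesgue_integral_eq_integral(1)[OF set_integrable_abs[OF set_integral_diff(1)[OF \<gamma>i gt]]]
        by simp
      also have "\<dots> \<le> integral {a..b} (\<lambda>s. \<bar>\<gamma> s - g s\<bar>)"
        by (intro integral_subset_le set_lebesgue_integral_eq_integral(1) set_integrable_abs
            set_integral_diff(1) \<gamma>i gi gt) (use t in auto)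
      finally show ?thesis using \<gamma>(2) by simp
    qed
    have zero: "(\<integral>x. D x * \<Gamma>0 (norm x) + w x * \<gamma> (norm x) \<partial>lborel) = 0"
    proof -
      have dq: "((\<lambda>x. \<Gamma> (norm x)) has_derivative (\<lambda>v. \<gamma> (norm x) * (v \<bullet> sgn x))) (at x)" if "x \<in> ?S" for x :: 'a
      proof -
        have "x \<noteq> 0" using that by simp
        then have "(\<Gamma> has_derivative (*) (\<gamma> (norm x))) (at (norm x))"
          using \<Gamma>d[of "norm x"] by (simp add: has_field_derivative_def)
        from has_derivative_compose[OF has_derivative_norm[OF \<open>x \<noteq> 0\<close>] this]
        show ?thesis .
      qed
      have cq: "continuous_on ?S (\<lambda>x. \<gamma> (norm x) * (v \<bullet> sgn x))" for v :: 'a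
        by (intro continuous_intros continuous_on_compose2[OF \<gamma>(1)]) auto
      have S: "open ?S" by (simp add: open_delete)
      note F = C1c_mult_local[OF \<eta> S dq cq]
      have "(\<lambda>x. \<eta> x * \<Gamma> (norm x)) \<in> C1c UNIV" using F(1) C1c_mono[of ?S UNIV] by blast
      from integral_directional_derivative_eq_0[OF this, of v]
      have "(\<integral>x. D x * \<Gamma> (norm x) + \<eta> x * (\<gamma> (norm x) * (v \<bullet> sgn x)) \<partial>lborel) = 0"
        by (simp only: F(2)[where v = v] D_def)
      moreover have "D x * \<Gamma> (norm x) + \<eta> x * (\<gamma> (norm x) * (v \<bullet> sgn x))
          = D x * \<Gamma>0 (norm x) + w x * \<gamma> (norm x)" for x
      proof (cases "x = 0")
        case True
        then have "x \<notin> K" using K(3) by auto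
        then show ?thesis by (simp add: D_def w_def K(4,5))
      qed (simp add: \<Gamma>0_def w_def)
      ultimately show ?thesis by simp
    qed
    have \<Gamma>i: "\<Gamma>0 absolutely_integrable_on {a..b}"
    proof -
      have "\<Gamma> absolutely_integrable_on {a..b}"
        by (intro absolutely_integrable_continuous_real continuous_at_imp_continuous_on ballI DERIV_isCont[OF \<Gamma>d])
           (use ab in auto)
      then show ?thesis
        by (subst set_integrable_cong[of lebesgue lebesgue "{a..b}" "{a..b}" _ \<Gamma>]) (use ab in \<open>auto simp: \<Gamma>0_def\<close>)
    qed
    have iD: "integrable lborel (\<lambda>x. D x * \<phi> (norm x))" "integrable lborel (\<lambda>x. D x * \<Gamma>0 (norm x))"
      by (rule i; (rule \<phi>i \<Gamma>i \<phi>m \<Gamma>m M(1) DI | measurable))+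
    have iw: "integrable lborel (\<lambda>x. w x * g (norm x))" "integrable lborel (\<lambda>x. w x * \<gamma> (norm x))"
      by (rule i; (rule gi \<gamma>i gm M(2) wI | measurable))+
    have sub: "(\<lambda>x. \<bar>\<gamma> x - g x\<bar>) absolutely_integrable_on {a..b}"
      by (intro set_integrable_abs set_integral_diff(1) \<gamma>i gi)
    have d: "(\<lambda>x. \<gamma> x - g x) absolutely_integrable_on {a..b}"
      by (intro set_integral_diff(1) \<gamma>i gi)
    have dm: "(\<lambda>x. \<gamma> x - g x) \<in> borel_measurable borel" by measurable
    have b1: "b \<le> 1" using ab by simp
    have c: "(\<lambda>x. \<epsilon>) absolutely_integrable_on {a..b}" by auto
    have Ic: "integrable lborel (\<lambda>x :: 'a. I x * \<epsilon>)" 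
      unfolding I_def by (rule radial_integrable_on_annulus(1)[OF c _ b1]) auto
    have Id: "integrable lborel (\<lambda>x :: 'a. I x * \<bar>\<gamma> (norm x) - g (norm x)\<bar>)"
      unfolding I_def by (rule radial_integrable_on_annulus(1)[OF sub _ b1]) measurable
    have "T = T - (\<integral>x. D x * \<Gamma>0 (norm x) + w x * \<gamma> (norm x) \<partial>lborel)" using zero by simp
    also have "\<dots> = (\<integral>x. (D x * \<phi> (norm x) + w x * g (norm x)) - (D x * \<Gamma>0 (norm x) + w x * \<gamma> (norm x)) \<partial>lborel)"
      unfolding T_def using iD iw by (intro Bochner_Integration.integral_diff[symmetric] Bochner_Integration.integrable_add)
    also have "\<bar>\<dots>\<bar> \<le> (\<integral>x. M * (I x * \<epsilon>) + M * (I x * \<bar>\<gamma> (norm x) - g (norm x)\<bar>) \<partial>lborel)"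
    proof (rule order_trans[OF integral_abs_bound], rule integral_mono)
      show "integrable lborel (\<lambda>x. \<bar>(D x * \<phi> (norm x) + w x * g (norm x)) - (D x * \<Gamma>0 (norm x) + w x * \<gamma> (norm x))\<bar>)"
        using iD iw by (intro integrable_abs Bochner_Integration.integrable_diff Bochner_Integration.integrable_add)
      show "integrable lborel (\<lambda>x. M * (I x * \<epsilon>) + M * (I x * \<bar>\<gamma> (norm x) - g (norm x)\<bar>))"
        using Ic Id by (intro Bochner_Integration.integrable_add integrable_mult_right)
      fix x :: 'a
      have e: "(D x * \<phi> (norm x) + w x * g (norm x)) - (D x * \<Gamma>0 (norm x) + w x * \<gamma> (norm x))
          = D x * (I x * (\<phi> (norm x) - \<Gamma>0 (norm x))) + w x * (I x * (g (norm x) - \<gamma> (norm x)))"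
      proof -
        have 1: "D x * (I x * q) = D x * q" for q
          using arg_cong[OF DI[of x], of "\<lambda>t. t * q"] by (simp only: mult.assoc)
        have 2: "w x * (I x * q) = w x * q" for q
          using arg_cong[OF wI[of x], of "\<lambda>t. t * q"] by (simp only: mult.assoc)
        show ?thesis unfolding 1 2 by (simp add: algebra_simps)
      qed
      have "\<bar>I x * (\<phi> (norm x) - \<Gamma>0 (norm x))\<bar> \<le> I x * \<epsilon>"
        using \<Gamma>\<phi>[of "norm x"] by (auto simp: I_def indicator_def abs_minus_commute)
      then have "\<bar>D x * (I x * (\<phi> (norm x) - \<Gamma>0 (norm x)))\<bar> \<le> M * (I x * \<epsilon>)"
        unfolding abs_mult[of "D x"] by (intro mult_mono M M0) auto
      moreover have "\<bar>w x * (I x * (g (norm x) - \<gamma> (norm x)))\<bar> \<le> M * (I x * \<bar>\<gamma> (norm x) - g (norm x)\<bar>)"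
        unfolding abs_mult by (intro mult_mono M M0) (auto simp: I_def indicator_def abs_minus_commute)
      ultimately show "\<bar>(D x * \<phi> (norm x) + w x * g (norm x)) - (D x * \<Gamma>0 (norm x) + w x * \<gamma> (norm x))\<bar>
        \<le> M * (I x * \<epsilon>) + M * (I x * \<bar>\<gamma> (norm x) - g (norm x)\<bar>)"
        unfolding e by linarith
    qed
    also have "\<dots> = M * (\<integral>x. I x * \<epsilon> \<partial>lborel) + M * (\<integral>x. I x * \<bar>\<gamma> (norm x) - g (norm x)\<bar> \<partial>lborel)"
      using Ic Id by simp
    also have "\<dots> \<le> M * (?\<kappa> * \<epsilon>) + M * (?\<kappa> * \<epsilon>)"
    proof (intro add_mono mult_left_mono M0)
      have "(\<integral>x. I x * \<epsilon> \<partial>lborel) \<le> ?\<kappa> * integral {a..b} (\<lambda>r. \<bar>\<epsilon>\<bar>)"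
        using radial_integrable_on_annulus(2)[OF c _ b1, where 'a = 'a] \<open>\<epsilon> > 0\<close> by (simp add: I_def)
      also have "\<dots> \<le> ?\<kappa> * \<epsilon>"
        using ab \<open>\<epsilon> > 0\<close> by (intro mult_left_mono) (auto simp: mult_left_le_one_le)
      finally show "(\<integral>x. I x * \<epsilon> \<partial>lborel) \<le> ?\<kappa> * \<epsilon>" .
      have "(\<integral>x. I x * \<bar>\<gamma> (norm x) - g (norm x)\<bar> \<partial>lborel) \<le> ?\<kappa> * integral {a..b} (\<lambda>r. \<bar>\<gamma> r - g r\<bar>)"
        using radial_integrable_on_annulus(2)[OF d dm b1, where 'a = 'a] by (simp add: I_def)
      also have "\<dots> \<le> ?\<kappa> * \<epsilon>" using \<gamma>(2) by (intro mult_left_mono) auto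
      finally show "(\<integral>x. I x * \<bar>\<gamma> (norm x) - g (norm x)\<bar> \<partial>lborel) \<le> ?\<kappa> * \<epsilon>" .
    qed
    finally show ?thesis by (simp add: algebra_simps)
  qed
  then have "T = 0"
  proof -
    assume le: "\<And>\<epsilon>. \<epsilon> > 0 \<Longrightarrow> \<bar>T\<bar> \<le> M * ?\<kappa> * 2 * \<epsilon>"
    have C: "0 \<le> M * ?\<kappa> * 2" using M0 by simp
    have "\<bar>T\<bar> \<le> 0 + e" if "e > 0" for e
    proof -
      have "\<bar>T\<bar> \<le> M * ?\<kappa> * 2 * (e / (M * ?\<kappa> * 2 + 1))" by (rule le) (use that C in auto)
      also have "\<dots> \<le> e" using that C by (simp add: field_simps)
      finally show ?thesis by simp
    qed
    then have "\<bar>T\<bar> \<le> 0" by (rule field_le_epsilon)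
    then show ?thesis by simp
  qed
  moreover have "T = (\<integral>x. D x * \<phi> (norm x) \<partial>lborel) + (\<integral>x. w x * g (norm x) \<partial>lborel)"
    unfolding T_def
    by (intro Bochner_Integration.integral_add i \<phi>i gi M DI wI; measurable)
  ultimately show ?thesis by (simp add: D_def w_def mult_ac)
qed

section \<open>The weak Jacobian of a radial map\<close>

lemma set_integrable_continuous_scaleR:
  fixes q :: "'a::euclidean_space \<Rightarrow> real" and f :: "'a \<Rightarrow> 'b::euclidean_space"
  assumes q: "continuous_on UNIV q" "\<And>x. x \<notin> K \<Longrightarrow> q x = 0" and K: "compact K" "K \<subseteq> S"
    and f: "f absolutely_integrable_on K"
  shows "(\<lambda>x. q x *\<^sub>R f x) absolutely_integrable_on S"
proof -
  have "(\<lambda>x. q x *\<^sub>R f x) absolutely_integrable_on K"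
  proof (rule absolutely_integrable_bounded_measurable_product[OF _ _ _ _ f,
        where h = "\<lambda>(c::real) (x::'b). c *\<^sub>R x" and f = q])
    show "bilinear (\<lambda>(c::real) (x::'b). c *\<^sub>R x)"
      using bounded_bilinear_scaleR by (simp add: bilinear_conv_bounded_bilinear)
    show Ks: "K \<in> sets lebesgue" using K(1) by (intro fmeasurableD lmeasurable_compact)
    show "q \<in> borel_measurable (lebesgue_on K)"
      by (rule continuous_imp_measurable_on_sets_lebesgue[OF continuous_on_subset[OF q(1)] Ks]) auto
    show "bounded (q ` K)"
      by (intro compact_imp_bounded compact_continuous_image continuous_on_subset[OF q(1)] K(1)) auto
  qed
  moreover have "indicator S x *\<^sub>R (q x *\<^sub>R f x) = indicator K x *\<^sub>R (q x *\<^sub>R f x)" for x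
    using q(2)[of x] K(2) by (cases "x \<in> K") auto
  ultimately show ?thesis by (simp only: set_integrable_def)
qed

lemma Lp_loc_component:
  fixes f :: "'a::euclidean_space \<Rightarrow> real^'n"
  assumes f: "Lp_loc 1 S f" and S: "S \<in> sets lebesgue"
  shows "Lp_loc 1 S (\<lambda>x. f x $ i)"
proof -
  have "f \<in> borel_measurable (lebesgue_on S)" using f by (simp add: Lp_loc_def)
  moreover have "(\<lambda>x :: real^'n. x $ i) \<in> borel_measurable borel"
    by (intro borel_measurable_continuous_onI continuous_intros)
  ultimately have m: "(\<lambda>x. f x $ i) \<in> borel_measurable (lebesgue_on S)"
    by (rule measurable_compose)
  have "set_integrable lebesgue K (\<lambda>x. norm (f x $ i) powr 1)" if K: "compact K" "K \<subseteq> S" for K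
  proof -
    have "f absolutely_integrable_on K" using Lp_loc_absolutely_integrable[OF f _ K S] by simp
    then have "(\<lambda>x. f x \<bullet> axis i 1) absolutely_integrable_on K"
      by (intro absolutely_integrable_component)
    from set_integrable_norm[OF this] show ?thesis by (simp add: inner_axis)
  qed
  with m show ?thesis by (simp add: Lp_loc_def)
qed

lemma weak_partial_component:
  fixes f :: "'a::euclidean_space \<Rightarrow> real^'n"
  assumes w: "weak_partial S f b g" and S: "S \<in> sets lebesgue"
  shows "weak_partial S (\<lambda>x. f x $ i) b (\<lambda>x. g x $ i)"
proof -
  have L: "Lp_loc 1 S f" "Lp_loc 1 S g" using w by (auto simp: weak_partial_def)
  have comp: "(LINT x:S|lebesgue. q x *\<^sub>R k x $ i) = (LINT x:S|lebesgue. q x *\<^sub>R k x) $ i"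
    if k: "Lp_loc 1 S k" and q: "continuous_on UNIV q" "\<And>x. x \<notin> K \<Longrightarrow> q x = 0" and K: "compact K" "K \<subseteq> S"
    for q :: "'a \<Rightarrow> real" and k :: "'a \<Rightarrow> real^'n" and K
  proof -
    have kK: "k absolutely_integrable_on K" using Lp_loc_absolutely_integrable[OF k _ K S] by simp
    have "(\<lambda>x. q x *\<^sub>R k x) absolutely_integrable_on S"
      by (rule set_integrable_continuous_scaleR[OF q K kK])
    then have "integrable lebesgue (\<lambda>x. indicator S x *\<^sub>R (q x *\<^sub>R k x))"
      by (simp add: set_integrable_def)
    from integral_bounded_linear[OF bounded_linear_vec_nth[of i] this]
    show ?thesis by (simp add: set_lebesgue_integral_def mult.assoc)
  qed
  have "(LINT x:S|lebesgue. frechet_derivative \<eta> (at x) b *\<^sub>R f x $ i)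
      = - (LINT x:S|lebesgue. \<eta> x *\<^sub>R g x $ i)" if \<eta>: "\<eta> \<in> C1c S" for \<eta> :: "'a \<Rightarrow> real"
  proof -
    obtain K where K: "C1 \<eta>" "compact K" "K \<subseteq> S" "\<And>x. x \<notin> K \<Longrightarrow> \<eta> x = 0"
      "\<And>x. x \<notin> K \<Longrightarrow> frechet_derivative \<eta> (at x) = (\<lambda>v. 0)" by (rule C1cE[OF \<eta>]) blast
    have "(LINT x:S|lebesgue. frechet_derivative \<eta> (at x) b *\<^sub>R f x $ i)
        = (LINT x:S|lebesgue. frechet_derivative \<eta> (at x) b *\<^sub>R f x) $ i"
      by (rule comp[OF L(1) C1_continuous_derivative[OF K(1)] _ K(2,3)]) (simp add: K(5))
    also have "\<dots> = (- (LINT x:S|lebesgue. \<eta> x *\<^sub>R g x)) $ i"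
      using w \<eta> by (simp add: weak_partial_def)
    also have "\<dots> = - (LINT x:S|lebesgue. \<eta> x *\<^sub>R g x $ i)"
      using comp[OF L(2) C1_continuous[OF K(1)] K(4) K(2,3)] by simp
    finally show ?thesis .
  qed
  then show ?thesis
    using Lp_loc_component[OF L(1) S] Lp_loc_component[OF L(2) S] by (simp add: weak_partial_def)
qed

text \<open>In \<open>W1p_loc\<close> the directional derivatives of the vector-valued map exist one by one; their components
assemble to a matrix, so the choice in the definition of the weak Jacobian is not void.\<close>

lemma weak_partial_weak_jacobian:
  fixes u :: "real^'n \<Rightarrow> real^'m"
  assumes u: "W1p_loc 1 S u" and S: "S \<in> sets lebesgue"
  shows "weak_partial S (\<lambda>x. u x $ i) (axis j 1) (\<lambda>x. weak_jacobian S u x $ i $ j)"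
proof -
  have "\<exists>g. weak_partial S u (axis j 1) g" for j :: 'n
    using u by (auto simp: W1p_loc_def axis_in_Basis_iff)
  then obtain g where g: "\<And>j :: 'n. weak_partial S u (axis j 1) (g j)" by metis
  have "weak_partial S (\<lambda>x. u x $ i) (axis j 1) (\<lambda>x. (\<chi> i j. g j x $ i) $ i $ j)" for i j
    using weak_partial_component[OF g S] by simp
  then have "\<exists>G. \<forall>i j. weak_partial S (\<lambda>x. u x $ i) (axis j 1) (\<lambda>x. G x $ i $ j)"
    by (intro exI[of _ "\<lambda>x. \<chi> i j. g j x $ i"]) simp
  from someI_ex[OF this] show ?thesis unfolding weak_jacobian_def by blast
qed

lemma radial_absolutely_integrable:
  fixes f :: "real \<Rightarrow> real" and K :: "'a::euclidean_space set"
  assumes f: "\<And>a b. 0 < a \<Longrightarrow> b < 1 \<Longrightarrow> f absolutely_integrable_on {a..b}"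
    and m: "f \<in> borel_measurable borel" and K: "compact K" "K \<subseteq> ball 0 1 - {0}"
  shows "(\<lambda>x. f (norm x)) absolutely_integrable_on K"
proof -
  obtain a b where ab: "0 < a" "a < b" "b < 1" and Kab: "\<And>x. x \<in> K \<Longrightarrow> a < norm x \<and> norm x < b"
    by (rule compact_in_punctured_ball[OF K]) blast
  let ?A = "{x :: 'a. a \<le> norm x \<and> norm x \<le> b}"
  have "integrable lborel (\<lambda>x :: 'a. indicator {a..b} (norm x) * f (norm x))"
    by (rule radial_integrable_on_annulus(1)[OF f m]) (use ab in auto)
  then have i: "integrable lebesgue (\<lambda>x :: 'a. indicator {a..b} (norm x) * f (norm x))"
    using integrable_completion borel_measurable_integrable by blast
  have "(\<lambda>x. f (norm x)) absolutely_integrable_on ?A"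
    using i unfolding set_integrable_def by (simp add: indicator_def)
  then show ?thesis
    by (rule set_integrable_subset) (use K(1) Kab in \<open>force intro: fmeasurableD lmeasurable_compact\<close>)+
qed

text \<open>On the punctured ball, \<open>weak_derivative_radial\<close> applied to the test functions \<open>\<eta>(x) x\<^sub>i\<close> shows that the
matrix on the right consists of weak derivatives of \<open>u\<close>. The fundamental lemma shows that these are
unique.\<close>

theorem weak_jacobian_radial:
  fixes u :: "real^'n \<Rightarrow> real^'n" and \<phi> g :: "real \<Rightarrow> real"
  assumes u: "W1p_loc 1 (ball 0 1) u" and radial: "\<And>x. x \<in> ball 0 1 \<Longrightarrow> u x = \<phi> (norm x) *\<^sub>R x"
    and prim: "\<And>a b. 0 < a \<Longrightarrow> b < 1 \<Longrightarrow> primitive_on a b \<phi> g"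
    and \<phi>m: "\<phi> \<in> borel_measurable borel" and gm: "g \<in> borel_measurable borel"
  shows "AE x in lebesgue. x \<in> ball 0 1 - {0} \<longrightarrow>
    weak_jacobian (ball 0 1) u x = \<phi> (norm x) *\<^sub>R mat 1 + (g (norm x) / norm x) *\<^sub>R dyad x"
proof -
  let ?B = "ball 0 1 :: (real^'n) set" let ?S = "?B - {0}"
  have B: "?B \<in> sets lebesgue" by simp
  have S: "open ?S" by (simp add: open_delete)
  have \<phi>i: "\<phi> absolutely_integrable_on {a..b}" if "0 < a" "b < 1" for a b
    by (rule absolutely_integrable_continuous_real[OF primitive_on_continuous[OF prim[OF that]]])
  have gi: "g absolutely_integrable_on {a..b}" if "0 < a" "b < 1" for a b
    by (rule primitive_on_absolutely_integrable[OF prim[OF that]])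
  have pw: "AE x in lebesgue. x \<in> ?S \<longrightarrow> weak_jacobian ?B u x $ i $ j
     - (\<phi> (norm x) * (axis j 1 :: real^'n) $ i + g (norm x) * (x $ i * (axis j 1 \<bullet> sgn x))) = 0" for i j
  proof -
    define v :: "real^'n" where "v = axis j 1"
    define G where "G x = weak_jacobian ?B u x $ i $ j" for x
    define Z where "Z x = v $ i * \<phi> (norm x) + (x $ i * (v \<bullet> sgn x)) * g (norm x)" for x
    have wp: "weak_partial ?B (\<lambda>x. u x $ i) v G"
      using weak_partial_weak_jacobian[OF u B] by (simp add: v_def G_def[abs_def])
    then have GL: "Lp_loc 1 ?B G" by (simp add: weak_partial_def)
    have Gi: "G absolutely_integrable_on K" if "compact K" "K \<subseteq> ?S" for K
      using Lp_loc_absolutely_integrable[OF GL _ that(1)] that B by auto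
    have cm: "(\<lambda>x. q x * f x) absolutely_integrable_on K"
      if "continuous_on K q" "compact K" "f absolutely_integrable_on K" for q f :: "real^'n \<Rightarrow> real" and K
    proof (rule absolutely_integrable_bounded_measurable_product[OF bilinear_times _ _ _ that(3)])
      show Ks: "K \<in> sets lebesgue" using that by (intro fmeasurableD lmeasurable_compact)
      show "q \<in> borel_measurable (lebesgue_on K)" by (rule continuous_imp_measurable_on_sets_lebesgue[OF that(1) Ks])
      show "bounded (q ` K)" by (intro compact_imp_bounded compact_continuous_image that)
    qed
    have cs: "continuous_on K (\<lambda>x. x $ i * (v \<bullet> sgn x))" if "K \<subseteq> ?S" for K
      by (intro continuous_intros) (use that in auto)
    have \<phi>K: "(\<lambda>x. \<phi> (norm x)) absolutely_integrable_on K" and gK: "(\<lambda>x. g (norm x)) absolutely_integrable_on K"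
      if "compact K" "K \<subseteq> ?S" for K :: "(real^'n) set"
      by (rule radial_absolutely_integrable[OF \<phi>i \<phi>m that], assumption+)
         (rule radial_absolutely_integrable[OF gi gm that], assumption+)
    have Zi: "Z absolutely_integrable_on K" if "compact K" "K \<subseteq> ?S" for K
      unfolding Z_def[abs_def]
      by (intro set_integral_add(1) cm cs that \<phi>K gK continuous_intros)
    have "AE x in lebesgue. x \<in> ?S \<longrightarrow> G x - Z x = 0"
    proof (rule fundamental_lemma_calculus_of_variations[OF S])
      show "(\<lambda>x. G x - Z x) absolutely_integrable_on K" if "compact K" "K \<subseteq> ?S" for K
        by (intro set_integral_diff(1) Gi Zi that)
      fix \<eta> :: "real^'n \<Rightarrow> real" assume \<eta>: "\<eta> \<in> C1c ?S"
      obtain K where K: "C1 \<eta>" "compact K" "K \<subseteq> ?S" "\<And>x. x \<notin> K \<Longrightarrow> \<eta> x = 0"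
        "\<And>x. x \<notin> K \<Longrightarrow> frechet_derivative \<eta> (at x) = (\<lambda>v. 0)" by (rule C1cE[OF \<eta>]) blast
      have KB: "K \<subseteq> ?B" using K(3) by auto
      have \<eta>B: "\<eta> \<in> C1c ?B" using \<eta> C1c_mono[of ?S ?B] by blast
      define D where "D x = frechet_derivative \<eta> (at x) v" for x
      have D0: "D x = 0" if "x \<notin> K" for x using K(5)[OF that] by (simp add: D_def)
      have c: "continuous_on T \<eta>" "continuous_on T D" for T
        unfolding D_def[abs_def]
        by (auto intro: C1_continuous K(1) continuous_on_subset[OF C1_continuous_derivative[OF K(1)]])
      have [measurable]: "\<eta> \<in> borel_measurable borel" "D \<in> borel_measurable borel"
        by (intro borel_measurable_continuous_onI c)+
      note [measurable] = \<phi>m gm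
      have [measurable]: "(\<lambda>x :: real^'n. x $ i) \<in> borel_measurable borel"
        by (intro borel_measurable_continuous_onI continuous_intros)
      have \<alpha>: "(\<lambda>x. (D x * x $ i) * \<phi> (norm x)) absolutely_integrable_on K"
        by (intro cm continuous_intros c K(2) \<phi>K K(3))
      have \<beta>: "(\<lambda>x. (\<eta> x * v $ i) * \<phi> (norm x)) absolutely_integrable_on K"
        by (intro cm continuous_intros c K(2) \<phi>K K(3))
      have \<delta>: "(\<lambda>x. (\<eta> x * (x $ i * (v \<bullet> sgn x))) * g (norm x)) absolutely_integrable_on K"
        by (intro cm continuous_on_mult c cs K(2,3) gK)
      have \<eta>G: "(\<lambda>x. \<eta> x * G x) absolutely_integrable_on K"
        by (intro cm c K(2,3) Gi)
      note int = set_lebesgue_integral_eq_integral(1)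
      have e1: "integral K (\<lambda>x. (D x * x $ i) * \<phi> (norm x)) = - integral K (\<lambda>x. \<eta> x * G x)"
      proof -
        have "(LINT x:?B|lebesgue. D x * u x $ i) = (LINT x:?B|lebesgue. (D x * x $ i) * \<phi> (norm x))"
          by (rule set_lebesgue_integral_cong) (auto simp: radial)
        also have "\<dots> = integral K (\<lambda>x. (D x * x $ i) * \<phi> (norm x))"
          by (rule LINT_eq_integral_on_support[OF \<alpha> KB]) (simp add: D0)
        finally have 1: "(LINT x:?B|lebesgue. D x * u x $ i) = integral K (\<lambda>x. (D x * x $ i) * \<phi> (norm x))" .
        have "(LINT x:?B|lebesgue. \<eta> x * G x) = integral K (\<lambda>x. \<eta> x * G x)"
          by (rule LINT_eq_integral_on_support[OF \<eta>G KB]) (simp add: K(4))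
        moreover have "(LINT x:?B|lebesgue. D x * u x $ i) = - (LINT x:?B|lebesgue. \<eta> x * G x)"
          using wp \<eta>B unfolding weak_partial_def D_def by simp
        ultimately show ?thesis using 1 by simp
      qed
      have e2: "integral K (\<lambda>x. (D x * x $ i) * \<phi> (norm x)) + integral K (\<lambda>x. (\<eta> x * v $ i) * \<phi> (norm x))
         = - integral K (\<lambda>x. (\<eta> x * (x $ i * (v \<bullet> sgn x))) * g (norm x))"
      proof -
        have dq: "((\<lambda>x :: real^'n. x $ i) has_derivative (\<lambda>v. v $ i)) (at x)" for x
          by (rule bounded_linear_imp_has_derivative[OF bounded_linear_vec_nth])
        note M = C1c_mult_local[OF \<eta> S dq continuous_on_const]
        have "(\<integral>x. (D x * x $ i + \<eta> x * v $ i) * \<phi> (norm x) \<partial>lborel)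
            = - (\<integral>x. (\<eta> x * x $ i) * (g (norm x) * (v \<bullet> sgn x)) \<partial>lborel)"
          using weak_derivative_radial[OF prim \<phi>m gm M(1), of v] by (simp only: M(2)[where v = v] D_def)
        moreover have "(\<integral>x. (D x * x $ i + \<eta> x * v $ i) * \<phi> (norm x) \<partial>lborel)
           = integral K (\<lambda>x. (D x * x $ i) * \<phi> (norm x)) + integral K (\<lambda>x. (\<eta> x * v $ i) * \<phi> (norm x))"
        proof -
          have "(\<integral>x. (D x * x $ i + \<eta> x * v $ i) * \<phi> (norm x) \<partial>lborel)
            = (LINT x:K|lebesgue. (D x * x $ i + \<eta> x * v $ i) * \<phi> (norm x))"
            by (rule LINT_eq_lborel_integral[symmetric]) (measurable, simp add: D0 K(4))
          also have "\<dots> = (LINT x:K|lebesgue. (D x * x $ i) * \<phi> (norm x) + (\<eta> x * v $ i) * \<phi> (norm x))"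
            by (simp only: distrib_right)
          also have "\<dots> = integral K (\<lambda>x. (D x * x $ i) * \<phi> (norm x)) + integral K (\<lambda>x. (\<eta> x * v $ i) * \<phi> (norm x))"
            unfolding set_integral_add(2)[OF \<alpha> \<beta>] set_lebesgue_integral_eq_integral(2)[OF \<alpha>]
              set_lebesgue_integral_eq_integral(2)[OF \<beta>] ..
          finally show ?thesis .
        qed
        moreover have "(\<integral>x. (\<eta> x * x $ i) * (g (norm x) * (v \<bullet> sgn x)) \<partial>lborel)
          = integral K (\<lambda>x. (\<eta> x * (x $ i * (v \<bullet> sgn x))) * g (norm x))"
        proof -
          have "(\<integral>x. (\<eta> x * x $ i) * (g (norm x) * (v \<bullet> sgn x)) \<partial>lborel)
            = (LINT x:K|lebesgue. (\<eta> x * x $ i) * (g (norm x) * (v \<bullet> sgn x)))"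
            by (rule LINT_eq_lborel_integral[symmetric]) (simp_all add: sgn_div_norm K(4))
          also have "\<dots> = (LINT x:K|lebesgue. (\<eta> x * (x $ i * (v \<bullet> sgn x))) * g (norm x))"
            by (simp only: mult_ac)
          finally show ?thesis unfolding set_lebesgue_integral_eq_integral(2)[OF \<delta>] .
        qed
        ultimately show ?thesis by simp
      qed
      have \<eta>Z: "(\<lambda>x. \<eta> x * G x - ((\<eta> x * v $ i) * \<phi> (norm x) + (\<eta> x * (x $ i * (v \<bullet> sgn x))) * g (norm x)))
         absolutely_integrable_on K"
        by (intro set_integral_diff(1) set_integral_add(1) \<eta>G \<beta> \<delta>)
      have "(LINT x:?S|lebesgue. \<eta> x * (G x - Z x))
         = (LINT x:?S|lebesgue. \<eta> x * G x - ((\<eta> x * v $ i) * \<phi> (norm x) + (\<eta> x * (x $ i * (v \<bullet> sgn x))) * g (norm x)))"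
        by (simp add: Z_def algebra_simps)
      also have "\<dots> = integral K (\<lambda>x. \<eta> x * G x - ((\<eta> x * v $ i) * \<phi> (norm x) + (\<eta> x * (x $ i * (v \<bullet> sgn x))) * g (norm x)))"
        by (rule LINT_eq_integral_on_support[OF \<eta>Z K(3)]) (simp add: K(4))
      also have "\<dots> = integral K (\<lambda>x. \<eta> x * G x) - (integral K (\<lambda>x. (\<eta> x * v $ i) * \<phi> (norm x))
          + integral K (\<lambda>x. (\<eta> x * (x $ i * (v \<bullet> sgn x))) * g (norm x)))"
        by (simp only: integral_diff integral_add integrable_add int[OF \<eta>G] int[OF \<beta>] int[OF \<delta>])
      also have "\<dots> = 0" using e1 e2 by simp
      finally show "(LINT x:?S|lebesgue. \<eta> x * (G x - Z x)) = 0" .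
    qed
    then show ?thesis by eventually_elim (simp add: G_def Z_def v_def mult_ac)
  qed
  have "AE x in lebesgue. \<forall>i j. x \<in> ?S \<longrightarrow> weak_jacobian ?B u x $ i $ j
     - (\<phi> (norm x) * (axis j 1 :: real^'n) $ i + g (norm x) * (x $ i * (axis j 1 \<bullet> sgn x))) = 0"
    by (intro eventually_all_finite pw)
  then show ?thesis
  proof eventually_elim
    case (elim x)
    show ?case
    proof
      assume "x \<in> ?S"
      then have "weak_jacobian ?B u x $ i $ j
        = \<phi> (norm x) * (axis j 1 :: real^'n) $ i + g (norm x) * (x $ i * (axis j 1 \<bullet> sgn x))" for i j
        using elim by simp
      moreover have "(axis j 1 :: real^'n) \<bullet> sgn x = x $ j / norm x" for j
        by (simp add: inner_axis' sgn_div_norm divide_inverse mult.commute)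
      moreover have "(axis j 1 :: real^'n) $ i = (if i = j then 1 else 0)" for i j
        by (simp add: axis_def)
      ultimately show "weak_jacobian ?B u x = \<phi> (norm x) *\<^sub>R mat 1 + (g (norm x) / norm x) *\<^sub>R dyad x"
        by (simp add: vec_eq_iff mat_def dyad_def)
    qed
  qed
qed

section \<open>Reduction to an ordinary differential equation\<close>

text \<open>Away from the origin the area of spheres is bounded below, so integrability passes from a radial
function to its profile.\<close>

lemma radial_profile_absolutely_integrable:
  fixes F :: "real \<Rightarrow> real" and f :: "'a::euclidean_space \<Rightarrow> real"
  assumes "0 < a" and Fm [measurable]: "F \<in> borel_measurable borel"
    and f: "f absolutely_integrable_on {x. a \<le> norm x \<and> norm x \<le> b}"
    and ae: "AE x in lebesgue. a \<le> norm x \<and> norm x \<le> b \<longrightarrow> f x = F (norm x)"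
  shows "F absolutely_integrable_on {a..b}"
proof -
  let ?K = "{x :: 'a. a \<le> norm x \<and> norm x \<le> b}"
  have m: "(\<lambda>x :: 'a. indicator {a..b} (norm x) * F (norm x)) \<in> borel_measurable lborel" by measurable
  have "integrable lebesgue (\<lambda>x :: 'a. indicator {a..b} (norm x) * F (norm x))"
  proof (rule integrable_cong_AE_imp)
    show "integrable lebesgue (\<lambda>x. indicator ?K x *\<^sub>R f x)" using f by (simp add: set_integrable_def)
    show "(\<lambda>x. indicator {a..b} (norm x) * F (norm x)) \<in> borel_measurable (lebesgue :: 'a measure)"
      by (rule measurable_completion[OF m])
    show "AE x in lebesgue. indicator ?K x *\<^sub>R f x = indicator {a..b} (norm x) * F (norm x)"
      using ae by eventually_elim (auto simp: indicator_def)
  qed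
  then have "integrable lborel (\<lambda>x :: 'a. indicator {a..b} (norm x) * F (norm x))"
    using integrable_completion m by blast
  then have i: "integrable lborel (\<lambda>r. radial_weight DIM('a) r * (indicator {a..b} r * F r))"
    by (subst (asm) integrable_radial_iff) auto
  define c where "c = real DIM('a) * unit_ball_vol (real DIM('a)) * a ^ (DIM('a) - 1)"
  have c: "c > 0" using \<open>0 < a\<close> by (simp add: c_def)
  have w: "c \<le> radial_weight DIM('a) r" if "r \<in> {a..b}" for r
  proof -
    have "a ^ (DIM('a) - 1) \<le> r ^ (DIM('a) - 1)" using that \<open>0 < a\<close> by (intro power_mono) auto
    then show ?thesis using that \<open>0 < a\<close> unfolding c_def radial_weight_def
      by (auto intro!: mult_left_mono)
  qed
  have "integrable lborel (\<lambda>r. indicator {a..b} r / radial_weight DIM('a) r * (radial_weight DIM('a) r * (indicator {a..b} r * F r)))"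
  proof (rule integrable_bounded_mult[OF i, where C = "1 / c"])
    show "\<bar>indicator {a..b} r / radial_weight DIM('a) r\<bar> \<le> 1 / c" for r
    proof (cases "r \<in> {a..b}")
      case True
      then show ?thesis using w[OF True] c by (simp add: frac_le)
    qed (use c in simp)
  qed measurable
  moreover have "indicator {a..b} r / radial_weight DIM('a) r * (radial_weight DIM('a) r * (indicator {a..b} r * F r))
      = indicator {a..b} r *\<^sub>R F r" for r
    using w[of r] c by (cases "r \<in> {a..b}") auto
  ultimately have "integrable lborel (\<lambda>r. indicator {a..b} r *\<^sub>R F r)" by simp
  then show ?thesis unfolding set_integrable_def
    using integrable_completion borel_measurable_integrable by blast
qed

text \<open>As \<open>\<eta>\<close> vanishes near \<open>0\<close>, the field is zero near the origin, where \<open>|x|\<close> is not differentiable. The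
formula for the Jacobian holds at the origin too: there \<open>\<eta>\<close> and its derivative are zero.\<close>

lemma C1c_radial_field:
  fixes \<eta> :: "real \<Rightarrow> real"
  assumes \<eta>: "\<eta> \<in> C1c {0<..<1}"
  shows "(\<lambda>x :: real^'n. \<eta> (norm x) *\<^sub>R x) \<in> C1c (ball 0 1)"
    and "jacobian (\<lambda>x :: real^'n. \<eta> (norm x) *\<^sub>R x) (at x)
      = \<eta> (norm x) *\<^sub>R mat 1 + (frechet_derivative \<eta> (at (norm x)) 1 / norm x) *\<^sub>R dyad x"
proof -
  let ?D = "\<lambda>t. frechet_derivative \<eta> (at t) 1"
  obtain K where K: "C1 \<eta>" "compact K" "K \<subseteq> {0<..<1}" "\<And>t. t \<notin> K \<Longrightarrow> \<eta> t = 0"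
    "\<And>t. t \<notin> K \<Longrightarrow> frechet_derivative \<eta> (at t) = (\<lambda>v. 0)" by (rule C1cE[OF \<eta>]) blast
  obtain a b where ab: "0 < a" "a < b" "b < 1" "K \<subseteq> {a<..<b}"
    by (rule compact_subset_open_interval[OF K(2,3)]) auto
  have \<eta>0: "\<eta> t = 0" "?D t = 0" if "t \<notin> {a<..<b}" for t
  proof -
    have "t \<notin> K" using ab(4) that by blast
    then show "\<eta> t = 0" "?D t = 0" using K(4,5) by simp_all
  qed
  have Dc: "continuous_on UNIV ?D" by (rule C1_continuous_derivative[OF K(1)])
  let ?\<rho> = "\<lambda>x :: real^'n. \<eta> (norm x)"
  let ?\<rho>' = "\<lambda>(x :: real^'n) v. ?D (norm x) * (v \<bullet> sgn x)"
  have d: "(?\<rho> has_derivative ?\<rho>' x) (at x)" for x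
  proof (cases "x = 0")
    case True
    have "(?\<rho> has_derivative (\<lambda>v. 0)) (at x)"
    proof (rule has_derivative_transform_within_open[of "\<lambda>x. 0"])
      show "open (ball 0 a :: (real^'n) set)" by simp
      show "x \<in> ball 0 a" using True ab by simp
      show "0 = \<eta> (norm y)" if "y \<in> ball 0 a" for y :: "real^'n"
        using \<eta>0(1)[of "norm y"] that by simp
    qed (rule has_derivative_const)
    then show ?thesis using True by simp
  next
    case False
    have "(\<eta> has_derivative (*) (?D (norm x))) (at (norm x))"
      using C1_real_derivative[OF K(1), of "norm x"] by (simp add: has_field_derivative_def)
    from has_derivative_compose[OF has_derivative_norm[OF False] this] show ?thesis .
  qed
  have c: "continuous_on UNIV (\<lambda>x. ?\<rho>' x v)" for v
  proof -
    have "continuous_on (- {0}) (\<lambda>x. ?\<rho>' x v)"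
      by (intro continuous_intros continuous_on_compose2[OF Dc]) auto
    moreover have "continuous_on (ball 0 a) (\<lambda>x. ?\<rho>' x v)"
      by (rule continuous_on_eq[OF continuous_on_const[of _ 0]]) (simp add: \<eta>0(2))
    ultimately have "continuous_on (- {0} \<union> ball 0 a) (\<lambda>x. ?\<rho>' x v)"
      by (intro continuous_on_open_Un) auto
    moreover have "- {0} \<union> ball 0 a = (UNIV :: (real^'n) set)" using ab by auto
    ultimately show ?thesis by simp
  qed
  have C: "C1 (\<lambda>x :: real^'n. \<eta> (norm x) *\<^sub>R x)"
    by (intro C1_scaleR C1I[OF d c] C1_linear bounded_linear_ident)
  show "(\<lambda>x :: real^'n. \<eta> (norm x) *\<^sub>R x) \<in> C1c (ball 0 1)"
    by (rule C1cI[OF C compact_cball[of 0 b]]) (use ab \<eta>0(1) in auto)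
  have "((\<lambda>x. \<eta> (norm x) *\<^sub>R x) has_derivative (\<lambda>v. \<eta> (norm x) *\<^sub>R v + ?\<rho>' x v *\<^sub>R x)) (at x)"
    by (rule has_derivative_scaleR[OF d has_derivative_ident])
  from frechet_derivative_at[OF this]
  have J: "jacobian (\<lambda>x. \<eta> (norm x) *\<^sub>R x) (at x) = matrix (\<lambda>v. \<eta> (norm x) *\<^sub>R v + ?\<rho>' x v *\<^sub>R x)"
    by (simp add: jacobian_def)
  have "axis j 1 \<bullet> sgn x = x $ j / norm x" for j
    by (simp add: inner_axis' sgn_div_norm divide_inverse mult.commute)
  then show "jacobian (\<lambda>x. \<eta> (norm x) *\<^sub>R x) (at x) = \<eta> (norm x) *\<^sub>R mat 1 + (?D (norm x) / norm x) *\<^sub>R dyad x"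
    unfolding J by (simp add: vec_eq_iff matrix_def mat_def dyad_def axis_def)
qed

text \<open>The inner products of the flux with \<open>I\<close> and \<open>x \<otimes> x\<close> are radial functions \<open>T\<^sub>1(|x|)\<close> and \<open>T\<^sub>2(|x|)\<close>, with
\<open>r^(n-1) T\<^sub>1 = H w'\<close> and \<open>r^(n-2) T\<^sub>2 = H w\<close>. So integrability of \<open>H w\<close> and \<open>H w'\<close> is inherited
from the flux. Since the Jacobian of \<open>\<eta>(|x|) x\<close> lies in the span of \<open>I\<close> and \<open>x \<otimes> x\<close>, testing with
this field and integrating over spheres gives the integral of \<open>\<eta>' H w + \<eta> H w'\<close>.\<close>

theorem radial_equation:
  fixes u :: "real^'n \<Rightarrow> real^'n" and \<phi> g h :: "real \<Rightarrow> real"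
  defines "n \<equiv> CARD('n)"
  defines "H \<equiv> \<lambda>r. h (\<phi> r ^ (n - 1) * (\<phi> r + r * g r))"
  defines "w \<equiv> \<lambda>r. r ^ n * \<phi> r ^ (n - 1)"
  defines "w' \<equiv> \<lambda>r. real n * r ^ (n - 1) * \<phi> r ^ (n - 1) + r ^ n * (real (n - 1) * \<phi> r ^ (n - 2) * g r)"
  assumes n2: "n \<ge> 2" and h: "continuous_on UNIV h"
    and \<phi>m [measurable]: "\<phi> \<in> borel_measurable borel" and gm [measurable]: "g \<in> borel_measurable borel"
    and jac: "AE x in lebesgue. x \<in> ball 0 1 - {0} \<longrightarrow>
      weak_jacobian (ball 0 1) u x = \<phi> (norm x) *\<^sub>R mat 1 + (g (norm x) / norm x) *\<^sub>R dyad x"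
    and sol: "weak_solution h (ball 0 1) u"
  shows "\<And>a b. 0 < a \<Longrightarrow> b < 1 \<Longrightarrow> (\<lambda>r. H r * w r) absolutely_integrable_on {a..b}"
    and "\<And>a b. 0 < a \<Longrightarrow> b < 1 \<Longrightarrow> (\<lambda>r. H r * w' r) absolutely_integrable_on {a..b}"
    and "\<And>\<eta>. \<eta> \<in> C1c {0<..<1} \<Longrightarrow>
      (LINT t:{0<..<1}|lebesgue. frechet_derivative \<eta> (at t) 1 * (H t * w t))
        = - (LINT t:{0<..<1}|lebesgue. \<eta> t * (H t * w' t))"
proof -
  let ?B = "ball 0 1 :: (real^'n) set"
  let ?fl = "flux h ?B u"
  have [measurable]: "h \<in> borel_measurable borel" by (rule borel_measurable_continuous_onI[OF h])
  have [measurable]: "H \<in> borel_measurable borel" unfolding H_def by measurable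
  define T1 where "T1 r = H r * (\<phi> r ^ (n - 2) * (\<phi> r + real (n - 1) * (\<phi> r + r * g r)))" for r
  define T2 where "T2 r = H r * (\<phi> r ^ (n - 1) * r\<^sup>2)" for r
  have [measurable]: "T1 \<in> borel_measurable borel" unfolding T1_def[abs_def] by measurable
  have [measurable]: "T2 \<in> borel_measurable borel" unfolding T2_def[abs_def] by measurable
  have flux: "AE x in lebesgue. x \<in> ?B - {0} \<longrightarrow> ?fl x \<bullet> mat 1 = T1 (norm x) \<and> ?fl x \<bullet> dyad x = T2 (norm x)"
    using jac
  proof eventually_elim
    case (elim x)
    show ?case
    proof
      assume x: "x \<in> ?B - {0}"
      then have xx: "g (norm x) / norm x * (x \<bullet> x) = norm x * g (norm x)"
        by (simp add: power2_norm_eq_inner[symmetric] power2_eq_square)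
      have nn: "CARD('n) \<ge> 2" using n2 by (simp add: n_def)
      have xn: "x \<bullet> x = (norm x)\<^sup>2" by (simp add: power2_norm_eq_inner)
      show "?fl x \<bullet> mat 1 = T1 (norm x) \<and> ?fl x \<bullet> dyad x = T2 (norm x)"
        unfolding flux_def elim[rule_format, OF x] det_scalar_plus_dyad inner_scaleR_left
          cof_scalar_plus_dyad_inner_mat_1[OF nn] cof_scalar_plus_dyad_inner_dyad[OF nn] xx
        unfolding xn T1_def T2_def H_def n_def by simp
    qed
  qed
  have L: "Lp_loc 1 ?B ?fl" using sol by (simp add: weak_solution_def)
  have nN: "n - 1 = Suc (n - 2)" "n = Suc (Suc (n - 2))" using n2 by auto
  have T: "T1 absolutely_integrable_on {a..b}" "T2 absolutely_integrable_on {a..b}" if ab: "0 < a" "b < 1" for a b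
  proof -
    let ?K = "{x :: real^'n. a \<le> norm x \<and> norm x \<le> b}"
    have "?K = cball 0 b - ball 0 a" by auto
    then have K: "compact ?K" by (simp add: compact_diff)
    have KB: "?K \<subseteq> ?B" using ab by auto
    have Ks: "?K \<in> sets lebesgue" using K by (intro fmeasurableD lmeasurable_compact)
    have fl: "?fl absolutely_integrable_on ?K" using Lp_loc_absolutely_integrable[OF L _ K KB] by simp
    have ip: "(\<lambda>x. q x \<bullet> ?fl x) absolutely_integrable_on ?K" if q: "continuous_on UNIV q" for q :: "real^'n \<Rightarrow> real^'n^'n"
    proof (rule absolutely_integrable_bounded_measurable_product[OF _ _ Ks _ fl, where h = "(\<bullet>)" and f = q])
      show "bilinear ((\<bullet>) :: real^'n^'n \<Rightarrow> _)"
        using bounded_bilinear_inner by (simp add: bilinear_conv_bounded_bilinear)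
      show "q \<in> borel_measurable (lebesgue_on ?K)"
        by (rule continuous_imp_measurable_on_sets_lebesgue[OF continuous_on_subset[OF q] Ks]) auto
      show "bounded (q ` ?K)"
        by (intro compact_imp_bounded compact_continuous_image continuous_on_subset[OF q] K) auto
    qed
    have dc: "continuous_on UNIV (dyad :: real^'n \<Rightarrow> _)"
      unfolding dyad_def[abs_def] by (intro continuous_intros)
    show "T1 absolutely_integrable_on {a..b}"
    proof (rule radial_profile_absolutely_integrable[OF ab(1) _ ip[OF continuous_on_const[of _ "mat 1"]]])
      show "AE x in lebesgue. a \<le> norm x \<and> norm x \<le> b \<longrightarrow> mat 1 \<bullet> ?fl x = T1 (norm x)"
        using flux by eventually_elim (use ab in \<open>auto simp: inner_commute\<close>)
    qed measurable
    show "T2 absolutely_integrable_on {a..b}"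
    proof (rule radial_profile_absolutely_integrable[OF ab(1) _ ip[OF dc]])
      show "AE x in lebesgue. a \<le> norm x \<and> norm x \<le> b \<longrightarrow> dyad x \<bullet> ?fl x = T2 (norm x)"
        using flux by eventually_elim (use ab in \<open>auto simp: inner_commute\<close>)
    qed measurable
  qed
  have Hw: "H r * w r = r ^ (n - 2) * T2 r" for r
  proof -
    have "n - 2 + 2 = n" using n2 by simp
    then have "r ^ n = r ^ (n - 2) * r\<^sup>2" by (metis power_add)
    then show ?thesis unfolding w_def T2_def by (simp only: mult_ac)
  qed
  have Hw': "H r * w' r = r ^ (n - 1) * T1 r" for r
  proof -
    have 1: "real n = 1 + real (n - 1)" using n2 by simp
    have 2: "\<phi> r ^ (n - 1) = \<phi> r * \<phi> r ^ (n - 2)" unfolding nN(1) by simp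
    have "Suc (n - 1) = n" using n2 by simp
    then have 3: "r ^ n = r * r ^ (n - 1)" by (metis power_Suc)
    have "C * ((1 + k) * R * (f * P) + (r * R) * (k * P * q)) = R * (C * (P * (f + k * (f + r * q))))"
      for C k R f P q :: real by (simp add: algebra_simps)
    then show ?thesis unfolding w'_def T1_def 1 2 3 .
  qed
  show Hwi: "(\<lambda>r. H r * w r) absolutely_integrable_on {a..b}" if "0 < a" "b < 1" for a b
    unfolding Hw by (intro absolutely_integrable_continuous_mult T that continuous_intros)
  show Hw'i: "(\<lambda>r. H r * w' r) absolutely_integrable_on {a..b}" if "0 < a" "b < 1" for a b
    unfolding Hw' by (intro absolutely_integrable_continuous_mult T that continuous_intros)
  fix \<eta> :: "real \<Rightarrow> real" assume \<eta>: "\<eta> \<in> C1c {0<..<1}"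
  let ?D = "\<lambda>t. frechet_derivative \<eta> (at t) 1"
  obtain K where K: "C1 \<eta>" "compact K" "K \<subseteq> {0<..<1}" "\<And>t. t \<notin> K \<Longrightarrow> \<eta> t = 0"
    "\<And>t. t \<notin> K \<Longrightarrow> frechet_derivative \<eta> (at t) = (\<lambda>v. 0)" by (rule C1cE[OF \<eta>]) blast
  obtain a b where ab: "0 < a" "a < b" "b < 1" "K \<subseteq> {a<..<b}"
    by (rule compact_subset_open_interval[OF K(2,3)]) auto
  have \<eta>0: "\<eta> t = 0" "?D t = 0" if "t \<notin> {a<..<b}" for t
  proof -
    have "t \<notin> K" using ab(4) that by blast
    then show "\<eta> t = 0" "?D t = 0" using K(4,5) by simp_all
  qed
  have cont: "continuous_on T ?D" "continuous_on T \<eta>" for T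
    by (auto intro: continuous_on_subset[OF C1_continuous_derivative[OF K(1)]] C1_continuous K(1))
  have [measurable]: "?D \<in> borel_measurable borel" "\<eta> \<in> borel_measurable borel"
    by (intro borel_measurable_continuous_onI cont)+
  have \<eta>1: "\<eta> t = 0" "?D t = 0" if "t \<notin> {a..b}" for t
    by (rule \<eta>0; use that in auto)+
  have [measurable]: "w \<in> borel_measurable borel" "w' \<in> borel_measurable borel"
    unfolding w_def w'_def by measurable
  define E where "E r = \<eta> r * T1 r + ?D r / r * T2 r" for r
  have E0: "E r = 0" if "r \<notin> {a..b}" for r
    using \<eta>1[OF that] by (simp add: E_def)
  have Em [measurable]: "E \<in> borel_measurable borel" unfolding E_def[abs_def] by measurable
  have "(LINT x:?B|lebesgue. ?fl x \<bullet> jacobian (\<lambda>x. \<eta> (norm x) *\<^sub>R x) (at x)) = 0"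
    using sol C1c_radial_field(1)[OF \<eta>, where 'n = 'n] by (simp add: weak_solution_def)
  moreover have "(LINT x:?B|lebesgue. ?fl x \<bullet> jacobian (\<lambda>x. \<eta> (norm x) *\<^sub>R x) (at x))
    = (LINT x|lebesgue. E (norm (x :: real^'n)))"
  proof -
    let ?f = "\<lambda>x. indicator ?B x *\<^sub>R (?fl x \<bullet> jacobian (\<lambda>x. \<eta> (norm x) *\<^sub>R x) (at x))"
    have "AE x in lebesgue. (x :: real^'n) \<noteq> 0"
      using AE_not_in[of "{0 :: real^'n}" lebesgue] by simp
    then have ae: "AE x in lebesgue. E (norm x) = ?f x"
      using flux
    proof eventually_elim
      case (elim x)
      show ?case
      proof (cases "x \<in> ?B")
        case True
        then show ?thesis using elim
          by (simp add: C1c_radial_field(2)[OF \<eta>] inner_add_right E_def)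
      next
        case False
        then show ?thesis using E0[of "norm x"] ab by simp
      qed
    qed
    have "(\<lambda>x :: real^'n. E (norm x)) \<in> borel_measurable lborel" by measurable
    then have m: "(\<lambda>x :: real^'n. E (norm x)) \<in> borel_measurable lebesgue" by (rule measurable_completion)
    show ?thesis unfolding set_lebesgue_integral_def
      by (rule integral_cong_AE[OF m borel_measurable_AE[OF m ae] ae, symmetric])
  qed
  moreover have "(LINT x|lebesgue. E (norm (x :: real^'n))) = (\<integral>x. E (norm (x :: real^'n)) \<partial>lborel)"
    by (rule integral_completion) measurable
  ultimately have "(\<integral>r. radial_weight n r * E r \<partial>lborel) = 0"
    using integral_radial[OF Em, where 'a = "real^'n"] by (simp add: n_def)
  moreover have "radial_weight n r * E r = (real n * unit_ball_vol (real n)) *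
      (?D r * (H r * w r) + \<eta> r * (H r * w' r))" for r
  proof (cases "r \<in> {a..b}")
    case True
    then have r: "r > 0" using ab by simp
    have "r ^ (n - 1) = r * r ^ (n - 2)" unfolding nN(1) by simp
    then show ?thesis unfolding Hw Hw' E_def radial_weight_def
      using r by (simp add: field_simps)
  next
    case False
    then show ?thesis by (simp add: E0 \<eta>1)
  qed
  moreover have "real n * unit_ball_vol (real n) \<noteq> 0"
    using n2 less_imp_neq[OF unit_ball_vol_pos[OF of_nat_0_le_iff[of n]]] by auto
  ultimately have z: "(\<integral>r. ?D r * (H r * w r) + \<eta> r * (H r * w' r) \<partial>lborel) = 0" by simp
  let ?I = "{0<..<1::real}"
  have sub: "{a..b} \<subseteq> ?I" using ab by auto
  have i1: "(\<lambda>r. ?D r * (H r * w r)) absolutely_integrable_on {a..b}"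
    by (intro absolutely_integrable_continuous_mult cont Hwi ab)
  have i2: "(\<lambda>r. \<eta> r * (H r * w' r)) absolutely_integrable_on {a..b}"
    by (intro absolutely_integrable_continuous_mult cont Hw'i ab)
  have "(LINT r:{a..b}|lebesgue. ?D r * (H r * w r) + \<eta> r * (H r * w' r)) = 0"
    unfolding z[symmetric]
    by (rule LINT_eq_lborel_integral) (measurable, simp add: \<eta>1)
  then have "integral {a..b} (\<lambda>r. ?D r * (H r * w r)) + integral {a..b} (\<lambda>r. \<eta> r * (H r * w' r)) = 0"
    unfolding set_integral_add(2)[OF i1 i2] set_lebesgue_integral_eq_integral(2)[OF i1]
      set_lebesgue_integral_eq_integral(2)[OF i2] .
  moreover have "(LINT t:?I|lebesgue. ?D t * (H t * w t)) = integral {a..b} (\<lambda>r. ?D r * (H r * w r))"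
    by (rule LINT_eq_integral_on_support[OF i1 sub]) (simp add: \<eta>1)
  moreover have "(LINT t:?I|lebesgue. \<eta> t * (H t * w' t)) = integral {a..b} (\<lambda>r. \<eta> r * (H r * w' r))"
    by (rule LINT_eq_integral_on_support[OF i2 sub]) (simp add: \<eta>1)
  ultimately show "(LINT t:?I|lebesgue. ?D t * (H t * w t)) = - (LINT t:?I|lebesgue. \<eta> t * (H t * w' t))"
    by simp
qed

section \<open>The determinant is constant where the profile does not vanish\<close>

lemma integral_cong_AE_Icc:
  fixes f g :: "real \<Rightarrow> real"
  assumes "AE x in lebesgue. x \<in> {a..b} \<longrightarrow> f x = g x"
  shows "integral {a..b} f = integral {a..b} g"
proof -
  obtain N where "negligible N" "{x. \<not> (x \<in> {a..b} \<longrightarrow> f x = g x)} \<subseteq> N"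
    using assms by (auto simp: eventually_ae_filter_negligible)
  then show ?thesis by (intro integral_spike[of N]) auto
qed

text \<open>The quotient of \<open>P\<close>, the continuous representative of \<open>H w\<close>, by \<open>w\<close> has derivative zero, so \<open>H\<close> is a
constant \<open>c\<close> almost everywhere. As \<open>h\<close> is injective, the determinant is a constant \<open>D\<close>, and
\<open>n r^(n-1) D\<close> is the derivative of \<open>(r \<phi>)^n\<close>.\<close>

lemma radial_equation_first_integral:
  fixes \<phi> g h P H w w' :: "real \<Rightarrow> real" and n :: nat
  assumes H: "H = (\<lambda>r. h (\<phi> r ^ (n - 1) * (\<phi> r + r * g r)))"
    and w: "w = (\<lambda>r. r ^ n * \<phi> r ^ (n - 1))"
    and w': "w' = (\<lambda>r. real n * r ^ (n - 1) * \<phi> r ^ (n - 1) + r ^ n * (real (n - 1) * \<phi> r ^ (n - 2) * g r))"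
    and n2: "n \<ge> 2" and h: "inj h"
    and prim: "primitive_on a b \<phi> g" and P: "primitive_on a b P (\<lambda>r. H r * w' r)"
    and ae: "AE r in lebesgue. r \<in> {a..b} \<longrightarrow> H r * w r = P r"
    and ab: "0 < a" "a < b" and \<phi>0: "\<And>r. r \<in> {a..b} \<Longrightarrow> \<phi> r \<noteq> 0"
  obtains C D where "\<And>r. r \<in> {a..b} \<Longrightarrow> (r * \<phi> r) ^ n = C + D * r ^ n"
proof -
  have id: "primitive_on a b (\<lambda>r. r) (\<lambda>r. 1)"
    by (rule primitive_on_C1) (auto intro!: derivative_eq_intros)
  have pw: "primitive_on a b w w'"
    by (rule primitive_on_cong[OF primitive_on_mult[OF primitive_on_power[OF id, of n] primitive_on_power[OF prim, of "n - 1"]]])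
       (simp_all add: w w' numeral_2_eq_2)
  have w0: "w r \<noteq> 0" if "r \<in> {a..b}" for r using \<phi>0[OF that] that ab by (simp add: w)
  note pq = primitive_on_mult[OF P primitive_on_inverse[OF pw w0]]
  have z: "AE r in lebesgue. r \<in> {a..b} \<longrightarrow>
      H r * w' r * inverse (w r) + P r * (- (inverse (w r))\<^sup>2 * w' r) = 0"
    using ae
  proof eventually_elim
    case (elim r)
    show ?case
    proof
      assume r: "r \<in> {a..b}"
      then have "P r = H r * w r" using elim by simp
      then show "H r * w' r * inverse (w r) + P r * (- (inverse (w r))\<^sup>2 * w' r) = 0"
        using w0[OF r] by (simp add: power2_eq_square field_simps)
    qed
  qed
  define c where "c = P a * inverse (w a)"
  have Pc: "P r = c * w r" if r: "r \<in> {a..b}" for r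
  proof -
    have "AE t in lebesgue. t \<in> {a..r} \<longrightarrow> H t * w' t * inverse (w t) + P t * (- (inverse (w t))\<^sup>2 * w' t) = 0"
      using z by eventually_elim (use r in auto)
    from integral_cong_AE_Icc[OF this] primitive_on_integral[OF pq r]
    have "P r * inverse (w r) = c" by (simp add: c_def)
    then show ?thesis using w0[OF r] by (simp add: field_simps)
  qed
  have Hc: "AE r in lebesgue. r \<in> {a..b} \<longrightarrow> H r = c"
    using ae
  proof eventually_elim
    case (elim r)
    then show ?case using Pc[of r] w0[of r] by auto
  qed
  have "\<exists>r\<in>{a..b}. H r = c"
  proof (rule ccontr)
    assume "\<not> (\<exists>r\<in>{a..b}. H r = c)"
    then have no: "H r \<noteq> c" if "r \<in> {a..b}" for r using that by blast
    have "AE r in lebesgue. r \<in> {a..b} \<longrightarrow> (1::real) = 0"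
      using Hc by eventually_elim (use no in blast)
    from integral_cong_AE_Icc[OF this] ab show False by simp
  qed
  then obtain s where s: "H s = c" by blast
  \<comment> \<open>\<open>c\<close> is a value of \<open>h\<close>, attained at the determinant at \<open>s\<close>; injectivity makes all other determinants equal to it.\<close>
  define D where "D = \<phi> s ^ (n - 1) * (\<phi> s + s * g s)"
  have d: "AE r in lebesgue. r \<in> {a..b} \<longrightarrow> \<phi> r ^ (n - 1) * (\<phi> r + r * g r) = D"
    using Hc
  proof eventually_elim
    case (elim r)
    show ?case
    proof
      assume "r \<in> {a..b}"
      then have "H r = H s" using elim s by simp
      then show "\<phi> r ^ (n - 1) * (\<phi> r + r * g r) = D"
        using h unfolding H D_def by (rule injD[rotated])
    qed
  qed
  note pF = primitive_on_power[OF primitive_on_mult[OF id prim], of n]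
  have "(r * \<phi> r) ^ n = ((a * \<phi> a) ^ n - D * a ^ n) + D * r ^ n" if r: "r \<in> {a..b}" for r
  proof -
    have "AE t in lebesgue. t \<in> {a..r} \<longrightarrow>
        real n * (t * \<phi> t) ^ (n - 1) * (1 * \<phi> t + t * g t) = D * (real n * t ^ (n - 1) * 1)"
      using d by eventually_elim (use r in \<open>auto simp: power_mult_distrib\<close>)
    from integral_cong_AE_Icc[OF this] primitive_on_integral[OF pF r]
    have "(r * \<phi> r) ^ n - (a * \<phi> a) ^ n = integral {a..r} (\<lambda>t. D * (real n * t ^ (n - 1) * 1))" by simp
    also have "\<dots> = D * r ^ n - D * a ^ n"
      by (rule primitive_on_integral[OF primitive_on_cmult[OF primitive_on_power[OF id]] r])
    finally show ?thesis by simp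
  qed
  then show thesis by (rule that)
qed

section \<open>Zeros of the profile\<close>

text \<open>The first integral is available on compact subintervals, with constants that depend on the interval.
Values at two points determine the constants, so they are the same for all subintervals.\<close>

lemma affine_in_power_from_subintervals:
  fixes f :: "real \<Rightarrow> real" and n :: nat
  assumes "n > 0" "0 \<le> l"
    and loc: "\<And>a b. l < a \<Longrightarrow> a < b \<Longrightarrow> b < m \<Longrightarrow> \<exists>C D. \<forall>r\<in>{a..b}. f r = C + D * r ^ n"
  shows "\<exists>C D. \<forall>r\<in>{l<..<m}. f r = C + D * r ^ n"
proof (cases "l < m")
  case True
  obtain a1 where a1: "l < a1" "a1 < m" using dense[OF True] by blast
  obtain b1 where b1: "a1 < b1" "b1 < m" using dense[OF a1(2)] by blast
  obtain C D where CD: "\<forall>r\<in>{a1..b1}. f r = C + D * r ^ n" using loc[OF a1(1) b1] by blast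
  have "f r = C + D * r ^ n" if r: "r \<in> {l<..<m}" for r
  proof -
    obtain C' D' where CD': "\<forall>r\<in>{min a1 r..max b1 r}. f r = C' + D' * r ^ n"
    proof -
      have "l < min a1 r" "min a1 r < max b1 r" "max b1 r < m" using a1 b1 r by auto
      from loc[OF this] show thesis using that by blast
    qed
    have e: "C' + D' * a1 ^ n = C + D * a1 ^ n" "C' + D' * b1 ^ n = C + D * b1 ^ n"
    proof -
      have "a1 \<in> {a1..b1} \<inter> {min a1 r..max b1 r}" "b1 \<in> {a1..b1} \<inter> {min a1 r..max b1 r}"
        using b1 by auto
      then show "C' + D' * a1 ^ n = C + D * a1 ^ n" "C' + D' * b1 ^ n = C + D * b1 ^ n"
        using CD CD' by fastforce+
    qed
    have "a1 ^ n < b1 ^ n" using b1 a1 assms by (intro power_strict_mono) auto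
    moreover have "(D' - D) * (b1 ^ n - a1 ^ n) = 0" using e by (simp add: algebra_simps)
    ultimately have "D' = D" by simp
    then have "C' = C" using e by simp
    moreover have "f r = C' + D' * r ^ n" using CD' by auto
    ultimately show ?thesis using \<open>D' = D\<close> by simp
  qed
  then show ?thesis by blast
qed simp

text \<open>In \<open>r^n - z^n = (r - z) (z^(n-1) + r z^(n-2) + \<dots> + r^(n-1))\<close> all summands are nonnegative.\<close>

lemma power_diff_lower_bound:
  fixes r z :: real
  assumes "r \<ge> 0" "z \<ge> 0" "n > 0"
  shows "z ^ (n - 1) * \<bar>r - z\<bar> \<le> \<bar>r ^ n - z ^ n\<bar>"
proof -
  obtain m where m: "n = Suc m" using assms(3) by (cases n) auto
  have "r ^ n - z ^ n = (r - z) * (\<Sum>i\<le>m. r ^ i * z ^ (m - i))"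
    using power_diff_sumr2[of r n z] by (simp add: m lessThan_Suc_atMost mult.commute)
  moreover have "z ^ m \<le> (\<Sum>i\<le>m. r ^ i * z ^ (m - i))"
    using sum_mono2[of "{..m}" "{0}" "\<lambda>i. r ^ i * z ^ (m - i)"] assms by simp
  moreover have "0 \<le> (\<Sum>i\<le>m. r ^ i * z ^ (m - i))" using assms by (intro sum_nonneg) auto
  ultimately show ?thesis
    using mult_right_mono[of "z ^ m" "\<Sum>i\<le>m. r ^ i * z ^ (m - i)" "\<bar>r - z\<bar>"] assms
    by (simp add: m abs_mult mult.commute)
qed

text \<open>A substitute for Hoelder's inequality: integrating \<open>|g| \<le> M + M^(1-p) |g|^p\<close> over an interval of length
\<open>\<delta>\<close> bounds the \<open>L\<^sup>1\<close> norm, and \<open>M\<close> can be chosen in terms of \<open>\<delta>\<close>.\<close>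

lemma le_add_powr:
  fixes x M p :: real
  assumes "x \<ge> 0" "M > 0" "p \<ge> 1"
  shows "x \<le> M + M powr (1 - p) * x powr p"
proof (cases "x \<le> M")
  case True
  then show ?thesis using assms by (simp add: add_increasing2)
next
  case False
  then have x: "x > 0" "M < x" using assms by auto
  have "x = x powr (1 - p) * x powr p" using x by (simp add: powr_add[symmetric])
  also have "\<dots> \<le> M powr (1 - p) * x powr p"
    using x assms by (intro mult_right_mono powr_mono2') auto
  finally show ?thesis using assms by simp
qed

text \<open>Over an interval of length \<open>\<delta>\<close> with end point \<open>z\<close>, the variation of \<open>\<phi>\<close> is at most
\<open>M \<delta> + M^(1-p) I\<close>, where \<open>I\<close> is the integral of \<open>|g|^p\<close> over the interval and tends to zero with \<open>\<delta>\<close>. The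
choice \<open>M = \<epsilon> \<delta>^(1/n - 1)\<close> makes the first term equal to \<open>\<epsilon> \<delta>^(1/n)\<close>, and \<open>p \<ge> n/(n-1)\<close> is what makes
the second one of the same order. So \<open>|\<phi>|^n\<close> is at most \<open>(2 \<epsilon>)^n \<delta>\<close> for small \<open>\<delta>\<close>, against the lower bound.\<close>

lemma no_root_like_zero:
  fixes \<phi> g A :: "real \<Rightarrow> real" and n :: nat and p :: real
  assumes prim: "\<And>a b. 0 < a \<Longrightarrow> b < 1 \<Longrightarrow> primitive_on a b \<phi> g"
    and A: "\<And>a b. 0 < a \<Longrightarrow> b < 1 \<Longrightarrow> primitive_on a b A (\<lambda>r. \<bar>g r\<bar> powr p)"
    and n2: "n \<ge> 2" and p: "p \<ge> real n / (real n - 1)"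
    and z: "0 < z" "z < 1" "\<phi> z = 0" and \<rho>: "0 < \<rho>" "\<rho> < 1" "\<rho> \<noteq> z"
    and "c > 0" and low: "\<And>r. r \<in> open_segment z \<rho> \<Longrightarrow> c * \<bar>r - z\<bar> \<le> \<bar>\<phi> r\<bar> ^ n"
  shows False
proof -
  have n1: "real n - 1 > 0" using n2 by simp
  have p1: "p > 1"
  proof -
    have "real n / (real n - 1) > 1" using n1 by simp
    then show ?thesis using p by simp
  qed
  \<comment> \<open>chosen such that \<open>(2 \<epsilon>)^n = c / 2\<close>\<close>
  define \<epsilon> where "\<epsilon> = root n (c / 2) / 2"
  have \<epsilon>: "\<epsilon> > 0" "(2 * \<epsilon>) ^ n < c" using n2 \<open>c > 0\<close> by (auto simp: \<epsilon>_def)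
  have "isCont A z"
  proof -
    have "continuous_on {z / 2..(1 + z) / 2} A" by (rule primitive_on_continuous[OF A]) (use z in auto)
    then show ?thesis by (rule continuous_on_interior) (use z in auto)
  qed
  then obtain d where d: "d > 0" "\<And>r. \<bar>r - z\<bar> < d \<Longrightarrow> \<bar>A r - A z\<bar> < \<epsilon> powr p"
    using \<epsilon>(1) unfolding continuous_at_eps_delta dist_real_def
    by (metis powr_gt_zero less_irrefl)
  \<comment> \<open>a point \<open>r\<close> on the segment so close to \<open>z\<close> that the integral of \<open>|g|^p\<close> between them is at most \<open>\<epsilon>^p\<close>\<close>
  define t where "t = min (1/2) (d / (2 * \<bar>\<rho> - z\<bar>))"
  have t: "0 < t" "t < 1" "t * \<bar>\<rho> - z\<bar> < d"
  proof -
    show "0 < t" using d \<rho> by (simp add: t_def)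
    show "t < 1" by (simp add: t_def)
    have "t * \<bar>\<rho> - z\<bar> \<le> d / (2 * \<bar>\<rho> - z\<bar>) * \<bar>\<rho> - z\<bar>" by (intro mult_right_mono) (auto simp: t_def)
    also have "\<dots> = d / 2" using \<rho> by simp
    finally show "t * \<bar>\<rho> - z\<bar> < d" using d by simp
  qed
  define r where "r = (1 - t) * z + t * \<rho>"
  have rs: "r \<in> open_segment z \<rho>"
    unfolding in_segment using t \<rho> by (auto simp: r_def intro!: exI[of _ t])
  have rz: "r - z = t * (\<rho> - z)" by (simp add: r_def algebra_simps)
  define \<delta> where "\<delta> = \<bar>r - z\<bar>"
  have \<delta>: "\<delta> > 0" "\<delta> < d" using t \<rho> by (auto simp: \<delta>_def rz abs_mult)
  have r01: "0 < r" "r < 1"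
  proof -
    show "0 < r" unfolding r_def using t z \<rho> by (intro add_pos_pos mult_pos_pos) auto
    have "(1 - t) * z + t * \<rho> < (1 - t) * 1 + t * 1"
      using t z \<rho> by (intro add_strict_mono mult_strict_left_mono) auto
    then show "r < 1" by (simp add: r_def)
  qed
  define a where "a = min z r" define b where "b = max z r"
  have ab: "0 < a" "a \<le> b" "b < 1" "b - a = \<delta>" using z r01 by (auto simp: a_def b_def \<delta>_def)
  note pg = prim[OF ab(1,3)] note pA = A[OF ab(1,3)]
  have bi: "b \<in> {a..b}" using ab by simp
  have gi: "g absolutely_integrable_on {a..b}" by (rule primitive_on_absolutely_integrable[OF pg])
  have gpi: "(\<lambda>r. \<bar>g r\<bar> powr p) absolutely_integrable_on {a..b}" by (rule primitive_on_absolutely_integrable[OF pA])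
  define M where "M = \<epsilon> * \<delta> powr (1 / real n - 1)"
  have M: "M > 0" using \<epsilon> \<delta> by (simp add: M_def)
  have Ib: "integral {a..b} (\<lambda>r. \<bar>g r\<bar> powr p) \<le> \<epsilon> powr p"
  proof -
    have "integral {a..b} (\<lambda>r. \<bar>g r\<bar> powr p) = A b - A a" by (rule primitive_on_integral[OF pA bi])
    also have "\<dots> \<le> \<bar>A r - A z\<bar>" by (auto simp: a_def b_def min_def max_def)
    finally show ?thesis using d(2)[of r] \<delta> by (simp add: \<delta>_def)
  qed
  have "\<bar>\<phi> r\<bar> = \<bar>\<phi> b - \<phi> a\<bar>" using z(3) by (auto simp: a_def b_def min_def max_def)
  also have "\<dots> = \<bar>integral {a..b} g\<bar>" using primitive_on_integral[OF pg bi] by simp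
  also have "\<dots> \<le> integral {a..b} (\<lambda>r. M + M powr (1 - p) * \<bar>g r\<bar> powr p)"
  proof -
    have "(\<lambda>r. M + M powr (1 - p) * \<bar>g r\<bar> powr p) absolutely_integrable_on {a..b}"
      by (intro set_integral_add(1) set_integrable_mult_right gpi) auto
    then have "norm (integral {a..b} g) \<le> integral {a..b} (\<lambda>r. M + M powr (1 - p) * \<bar>g r\<bar> powr p)"
      using le_add_powr[OF abs_ge_zero M, of p] p1
      by (intro integral_norm_bound_integral set_lebesgue_integral_eq_integral(1) gi) auto
    then show ?thesis by simp
  qed
  also have "\<dots> = M * \<delta> + M powr (1 - p) * integral {a..b} (\<lambda>r. \<bar>g r\<bar> powr p)"
  proof -
    have "integral {a..b} (\<lambda>r. M + M powr (1 - p) * \<bar>g r\<bar> powr p)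
      = integral {a..b} (\<lambda>r. M) + integral {a..b} (\<lambda>r. M powr (1 - p) * \<bar>g r\<bar> powr p)"
      by (intro integral_add set_lebesgue_integral_eq_integral(1) set_integrable_mult_right gpi) auto
    then show ?thesis using ab by (simp add: mult.commute)
  qed
  also have "\<dots> \<le> M * \<delta> + M powr (1 - p) * \<epsilon> powr p"
    using Ib by (intro add_left_mono mult_left_mono) auto
  also have "\<dots> \<le> \<epsilon> * \<delta> powr (1 / real n) + \<epsilon> * \<delta> powr (1 / real n)"
  proof (rule add_mono)
    have "\<delta> powr (1 / real n - 1) * \<delta> powr 1 = \<delta> powr (1 / real n)"
      by (subst powr_add[symmetric]) simp
    then show "M * \<delta> \<le> \<epsilon> * \<delta> powr (1 / real n)" using \<delta> by (simp add: M_def mult.assoc)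
    have "M powr (1 - p) * \<epsilon> powr p = \<epsilon> powr (1 - p) * \<epsilon> powr p * \<delta> powr ((1 / real n - 1) * (1 - p))"
      unfolding M_def using \<epsilon> \<delta> by (simp add: powr_mult powr_powr)
    also have "\<epsilon> powr (1 - p) * \<epsilon> powr p = \<epsilon>" using \<epsilon> by (simp add: powr_add[symmetric])
    also have "\<delta> powr ((1 / real n - 1) * (1 - p)) \<le> \<delta> powr (1 / real n)"
    proof (rule powr_mono')
      have "1 \<le> (p - 1) * (real n - 1)"
        using p n1 by (simp add: field_simps)
      then show "1 / real n \<le> (1 / real n - 1) * (1 - p)"
        using n2 by (simp add: field_simps)
      show "\<delta> \<le> 1" using r01 z by (auto simp: \<delta>_def)
    qed (use \<delta> in simp)
    finally show "M powr (1 - p) * \<epsilon> powr p \<le> \<epsilon> * \<delta> powr (1 / real n)" using \<epsilon> by simp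
  qed
  finally have "\<bar>\<phi> r\<bar> \<le> 2 * \<epsilon> * \<delta> powr (1 / real n)" by simp
  then have "\<bar>\<phi> r\<bar> ^ n \<le> (2 * \<epsilon> * \<delta> powr (1 / real n)) ^ n" by (rule power_mono) simp
  also have "\<dots> = (2 * \<epsilon>) ^ n * \<delta>"
  proof -
    have "(\<delta> powr (1 / real n)) ^ n = \<delta> powr (1 / real n * real n)"
      using \<delta> by (simp add: powr_powr flip: powr_realpow)
    also have "\<dots> = \<delta>" using n2 \<delta> by simp
    finally show ?thesis by (simp add: power_mult_distrib)
  qed
  also have "\<dots> < c * \<delta>" using \<epsilon> \<delta> by simp
  finally show False using low[OF rs] by (simp add: \<delta>_def)
qed

section \<open>The profile as an absolutely continuous function\<close>

text \<open>By \<open>du_Bois_Reymond\<close> some absolutely continuous function equals \<open>\<phi>\<close> almost everywhere; as both are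
continuous, they are equal. The derivative is replaced by a Borel function, because only Borel
functions can be composed with the norm without losing measurability.\<close>

lemma W1p_loc_real_primitive:
  fixes \<phi> :: "real \<Rightarrow> real"
  assumes W: "W1p_loc p {0<..<1} \<phi>" and p: "p \<ge> 1" and c: "continuous_on {0<..<1} \<phi>"
  obtains g where "g \<in> borel_measurable borel"
    "\<And>a b. 0 < a \<Longrightarrow> b < 1 \<Longrightarrow> primitive_on a b \<phi> g"
    "\<And>a b. 0 < a \<Longrightarrow> b < 1 \<Longrightarrow> (\<lambda>r. \<bar>g r\<bar> powr p) absolutely_integrable_on {a..b}"
proof -
  let ?I = "{0<..<1::real}"
  have "\<forall>b\<in>Basis. \<exists>g. Lp_loc p ?I g \<and> weak_partial ?I \<phi> b g" using W by (simp add: W1p_loc_def)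
  then obtain g1 where g1: "Lp_loc p ?I g1" "weak_partial ?I \<phi> 1 g1" by auto
  have "g1 \<in> borel_measurable (lebesgue_on ?I)" using g1(1) by (simp add: Lp_loc_def)
  then have "(\<lambda>r. if r \<in> ?I then g1 r else 0) \<in> borel_measurable lebesgue"
    by (subst (asm) borel_measurable_if[symmetric]) auto
  then obtain g where g: "g \<in> borel_measurable lborel" "AE r in lborel. (if r \<in> ?I then g1 r else 0) = g r"
    using completion_ex_borel_measurable_real[of _ lborel] by blast
  have ae: "AE r in lebesgue. r \<in> ?I \<longrightarrow> g1 r = g r"
    using AE_completion[OF g(2)] by eventually_elim auto
  have gm: "g \<in> borel_measurable borel" using g(1) by simp
  have I1: "?I \<in> sets lebesgue" by simp
  have sub: "{a..b} \<subseteq> ?I" if "0 < a" "b < 1" for a b using that by auto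
  have transfer: "(\<lambda>r. F (g r)) absolutely_integrable_on {a..b}"
    if i: "(\<lambda>r. F (g1 r)) absolutely_integrable_on {a..b}" and F: "F \<in> borel_measurable borel" and ab: "0 < a" "b < 1"
    for F :: "real \<Rightarrow> real" and a b
    unfolding set_integrable_def
  proof (rule integrable_cong_AE_imp)
    show "integrable lebesgue (\<lambda>r. indicator {a..b} r *\<^sub>R F (g1 r))" using i by (simp add: set_integrable_def)
    have "(\<lambda>r. indicator {a..b} r *\<^sub>R F (g r)) \<in> borel_measurable lborel"
      using F gm by measurable
    then show "(\<lambda>r. indicator {a..b} r *\<^sub>R F (g r)) \<in> borel_measurable lebesgue" by (rule measurable_completion)
    show "AE r in lebesgue. indicator {a..b} r *\<^sub>R F (g1 r) = indicator {a..b} r *\<^sub>R F (g r)"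
      using ae by eventually_elim (use ab in \<open>auto simp: indicator_def\<close>)
  qed
  have g1i: "g1 absolutely_integrable_on {a..b}" if "0 < a" "b < 1" for a b
    by (rule Lp_loc_absolutely_integrable[OF g1(1) p compact_Icc sub[OF that] I1])
  have gi: "g absolutely_integrable_on {a..b}" if "0 < a" "b < 1" for a b
    by (rule transfer[where F = "\<lambda>t. t", OF g1i[OF that] _ that]) simp
  have gp: "(\<lambda>r. \<bar>g r\<bar> powr p) absolutely_integrable_on {a..b}" if "0 < a" "b < 1" for a b
  proof (rule transfer[where F = "\<lambda>t. \<bar>t\<bar> powr p", OF _ _ that])
    show "(\<lambda>r. \<bar>g1 r\<bar> powr p) absolutely_integrable_on {a..b}"
      using g1(1) sub[OF that] by (simp add: Lp_loc_def)
  qed measurable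
  have \<phi>i: "\<phi> absolutely_integrable_on {a..b}" if "0 < a" "b < 1" for a b
    by (rule absolutely_integrable_continuous_real[OF continuous_on_subset[OF c sub[OF that]]])
  have weak: "(LINT t:?I|lebesgue. frechet_derivative \<eta> (at t) 1 * \<phi> t) = - (LINT t:?I|lebesgue. \<eta> t * g t)"
    if \<eta>: "\<eta> \<in> C1c ?I" for \<eta> :: "real \<Rightarrow> real"
  proof -
    obtain K where K: "C1 \<eta>" "compact K" "K \<subseteq> ?I" "\<And>t. t \<notin> K \<Longrightarrow> \<eta> t = 0"
      by (rule C1cE[OF \<eta>]) blast
    obtain a b :: real where ab: "0 < a" "a < b" "b < 1" "K \<subseteq> {a<..<b}"
      by (rule compact_subset_open_interval[OF K(2,3)]) auto
    have \<eta>0: "\<eta> t = 0" if "t \<in> ?I - {a..b}" for t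
    proof (rule K(4))
      show "t \<notin> K" using ab(4) that by auto
    qed
    have \<eta>c: "continuous_on {a..b} \<eta>" by (rule C1_continuous[OF K(1)])
    have "(LINT t:?I|lebesgue. \<eta> t * g1 t) = integral {a..b} (\<lambda>t. \<eta> t * g1 t)"
      by (rule LINT_eq_integral_on_support[OF absolutely_integrable_continuous_mult[OF \<eta>c g1i[OF ab(1,3)]] sub[OF ab(1,3)]])
         (simp add: \<eta>0)
    also have "\<dots> = integral {a..b} (\<lambda>t. \<eta> t * g t)"
    proof (rule integral_cong_AE_Icc)
      show "AE t in lebesgue. t \<in> {a..b} \<longrightarrow> \<eta> t * g1 t = \<eta> t * g t"
        using ae by eventually_elim (use ab in auto)
    qed
    also have "\<dots> = (LINT t:?I|lebesgue. \<eta> t * g t)"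
      by (rule LINT_eq_integral_on_support[OF absolutely_integrable_continuous_mult[OF \<eta>c gi[OF ab(1,3)]] sub[OF ab(1,3)], symmetric])
         (simp add: \<eta>0)
    finally show ?thesis using g1(2) \<eta> by (simp add: weak_partial_def)
  qed
  obtain P where P: "AE t in lebesgue. t \<in> ?I \<longrightarrow> \<phi> t = P t"
    "\<And>a b. 0 < a \<Longrightarrow> b < 1 \<Longrightarrow> primitive_on a b P g"
    by (rule du_Bois_Reymond[OF zero_less_one \<phi>i gi weak]) blast+
  have Pc: "continuous_on ?I P"
  proof (rule continuous_at_imp_continuous_on, rule ballI)
    fix t :: real assume t: "t \<in> ?I"
    have "continuous_on {t / 2..(1 + t) / 2} P" by (rule primitive_on_continuous[OF P(2)]) (use t in auto)
    then show "isCont P t" by (rule continuous_on_interior) (use t in auto)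
  qed
  have "\<phi> t = P t" if t: "t \<in> ?I" for t
  proof (rule ccontr)
    assume ne: "\<phi> t \<noteq> P t"
    let ?U = "?I \<inter> (\<lambda>t. \<phi> t - P t) -` (- {0})"
    have "open ?U" by (rule continuous_open_preimage) (auto intro!: continuous_intros c Pc)
    moreover have "t \<in> ?U" using t ne by auto
    moreover have "negligible ?U"
    proof -
      obtain N where "negligible N" "{t. \<not> (t \<in> ?I \<longrightarrow> \<phi> t = P t)} \<subseteq> N"
        using P(1) by (auto simp: eventually_ae_filter_negligible)
      then show ?thesis by (elim negligible_subset) auto
    qed
    ultimately show False using open_not_negligible by blast
  qed
  then have "primitive_on a b \<phi> g" if "0 < a" "b < 1" for a b
    by (intro primitive_on_cong[OF P(2)[OF that]]) (use that in auto)
  then show thesis using that[OF gm _ gp] by blast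
qed

section \<open>Classification of radial weak solutions\<close>

text \<open>On the segment, \<open>(r \<phi>)^n = C + D r^n\<close>. By continuity this extends to \<open>z\<close>, where the left side is
zero, so it equals \<open>D (r^n - z^n)\<close> with \<open>D \<noteq> 0\<close>. Hence \<open>\<phi>\<close> vanishes at \<open>z\<close> only like an \<open>n\<close>-th root.\<close>

lemma no_interior_end_point:
  fixes \<phi> g A :: "real \<Rightarrow> real" and n :: nat and p :: real
  assumes prim: "\<And>a b. 0 < a \<Longrightarrow> b < 1 \<Longrightarrow> primitive_on a b \<phi> g"
    and A: "\<And>a b. 0 < a \<Longrightarrow> b < 1 \<Longrightarrow> primitive_on a b A (\<lambda>r. \<bar>g r\<bar> powr p)"
    and n2: "n \<ge> 2" and p: "p \<ge> real n / (real n - 1)"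
    and c: "continuous_on {0<..<1} \<phi>"
    and first: "\<And>l m. 0 \<le> l \<Longrightarrow> m \<le> 1 \<Longrightarrow> (\<And>r. r \<in> {l<..<m} \<Longrightarrow> \<phi> r \<noteq> 0) \<Longrightarrow>
        \<exists>C D. \<forall>r\<in>{l<..<m}. (r * \<phi> r) ^ n = C + D * r ^ n"
    and z: "0 < z" "z < 1" "\<phi> z = 0" and \<rho>: "0 < \<rho>" "\<rho> < 1" "\<rho> \<noteq> z"
    and ne: "\<And>r. r \<in> open_segment z \<rho> \<Longrightarrow> \<phi> r \<noteq> 0"
  shows False
proof -
  define l where "l = min z \<rho>" define m where "m = max z \<rho>"
  have lm: "0 < l" "l < m" "m < 1" and seg: "open_segment z \<rho> = {l<..<m}"
    using z \<rho> by (auto simp: l_def m_def open_segment_eq_real_ivl min_def max_def)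
  obtain C D where CD: "\<And>r. r \<in> {l<..<m} \<Longrightarrow> (r * \<phi> r) ^ n = C + D * r ^ n"
    using first[of l m] ne lm unfolding seg by auto
  have clos: "closure {l<..<m} = {l..m}" using lm by simp
  have c': "continuous_on {l..m} \<phi>" by (rule continuous_on_subset[OF c]) (use lm in auto)
  have "(z * \<phi> z) ^ n - (C + D * z ^ n) = 0"
  proof (rule continuous_constant_on_closure[of "{l<..<m}" "\<lambda>r. (r * \<phi> r) ^ n - (C + D * r ^ n)"])
    show "continuous_on (closure {l<..<m}) (\<lambda>r. (r * \<phi> r) ^ n - (C + D * r ^ n))"
      unfolding clos by (intro continuous_intros c')
    show "(r * \<phi> r) ^ n - (C + D * r ^ n) = 0" if "r \<in> {l<..<m}" for r using CD[OF that] by simp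
    show "z \<in> closure {l<..<m}" unfolding clos by (auto simp: l_def m_def)
  qed
  moreover have "(0::real) ^ n = 0" using n2 by (simp add: zero_power)
  ultimately have C: "C = - D * z ^ n" using z by simp
  have eq: "(r * \<phi> r) ^ n = D * (r ^ n - z ^ n)" if "r \<in> {l<..<m}" for r
    using CD[OF that] by (simp add: C algebra_simps)
  have D: "D \<noteq> 0"
  proof
    assume "D = 0"
    obtain r where r: "r \<in> {l<..<m}" using dense[OF lm(2)] by auto
    then show False using eq[OF r] ne[of r] lm \<open>D = 0\<close> unfolding seg by auto
  qed
  show False
  proof (rule no_root_like_zero[OF prim A n2 p z \<rho>])
    show "0 < \<bar>D\<bar> * z ^ (n - 1)" using D z by simp
    fix r assume "r \<in> open_segment z \<rho>"
    then have r: "r \<in> {l<..<m}" by (simp add: seg)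
    then have r01: "0 < r" "r < 1" using lm by auto
    have "\<bar>D\<bar> * z ^ (n - 1) * \<bar>r - z\<bar> \<le> \<bar>D\<bar> * \<bar>r ^ n - z ^ n\<bar>"
      using power_diff_lower_bound[of r z n] r01 z n2 by (simp add: mult.assoc mult_left_mono)
    also have "\<dots> = \<bar>(r * \<phi> r) ^ n\<bar>" by (simp only: eq[OF r] abs_mult)
    also have "\<dots> = \<bar>r * \<phi> r\<bar> ^ n" by (rule power_abs)
    also have "\<dots> \<le> \<bar>\<phi> r\<bar> ^ n"
      using r01 by (intro power_mono) (auto simp: abs_mult mult_left_le_one_le)
    finally show "\<bar>D\<bar> * z ^ (n - 1) * \<bar>r - z\<bar> \<le> \<bar>\<phi> r\<bar> ^ n" .
  qed
qed

lemma nearest_zero: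
  fixes \<phi> :: "real \<Rightarrow> real"
  assumes c: "continuous_on {0<..<1} \<phi>" and z: "z \<in> {0<..<1}" "\<phi> z = 0" and r: "r \<in> {0<..<1}" "\<phi> r \<noteq> 0"
  obtains s where "s \<in> {0<..<1}" "\<phi> s = 0" "s \<noteq> r" "\<And>t. t \<in> open_segment s r \<Longrightarrow> \<phi> t \<noteq> 0"
proof -
  let ?Z = "closed_segment z r \<inter> \<phi> -` {0}"
  have sub: "closed_segment z r \<subseteq> {0<..<1}" using z r by (simp add: closed_segment_subset convex_real_interval)
  have "compact ?Z"
    using continuous_closed_preimage[OF continuous_on_subset[OF c sub] closed_segment closed_singleton[of 0]]
      bounded_subset[OF bounded_closed_segment, of ?Z z r] by (auto simp: compact_eq_bounded_closed)
  moreover have "?Z \<noteq> {}" using z by auto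
  moreover have "continuous_on ?Z (\<lambda>t. \<bar>t - r\<bar>)" by (intro continuous_intros)
  ultimately have "\<exists>s\<in>?Z. \<forall>t\<in>?Z. \<bar>s - r\<bar> \<le> \<bar>t - r\<bar>" by (rule continuous_attains_inf)
  then obtain s where s: "s \<in> ?Z" "\<And>t. t \<in> ?Z \<Longrightarrow> \<bar>s - r\<bar> \<le> \<bar>t - r\<bar>" by blast
  show thesis
  proof (rule that)
    show "s \<in> {0<..<1}" "\<phi> s = 0" using s(1) sub by auto
    then show "s \<noteq> r" using r by auto
    fix t assume t: "t \<in> open_segment s r"
    show "\<phi> t \<noteq> 0"
    proof
      assume "\<phi> t = 0"
      moreover have "t \<in> closed_segment z r"
        using t s(1) by (auto simp: open_segment_eq_real_ivl closed_segment_eq_real_ivl split: if_splits)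
      ultimately have "\<bar>s - r\<bar> \<le> \<bar>t - r\<bar>" using s(2) by auto
      then show False using t by (auto simp: open_segment_eq_real_ivl split: if_splits)
    qed
  qed
qed

theorem theorem3p3:
  fixes h :: "real \<Rightarrow> real" and p :: real and \<phi> :: "real \<Rightarrow> real"
    and u :: "real^'n \<Rightarrow> real^'n" and n :: nat
  assumes n_def: "n = CARD('n)" and n_ge_2: "n \<ge> 2"
    and h_cont: "continuous_on UNIV h" and h_inj: "inj h"
    and p_ge: "p \<ge> real n / (real n - 1)"
    and phi_W1p: "W1p_loc p {0<..<1} \<phi>"
    and phi_cont: "continuous_on {0<..<1} \<phi>"
    and u_radial: "\<And>x. x \<in> ball 0 1 \<Longrightarrow> u x = \<phi> (norm x) *\<^sub>R x"
    and u_sol: "weak_solution h (ball 0 1) u"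
    and flux_Lp: "Lp_loc (p / (p - 1)) (ball 0 1) (flux h (ball 0 1) u)"
  shows "(\<forall>r\<in>{0<..<1}. \<phi> r = 0) \<or>
    (\<exists>lam c :: real.
       (\<forall>r\<in>{0<..<1}. \<phi> r \<noteq> 0) \<and>
       (odd n \<longrightarrow> (\<forall>r\<in>{0<..<1}. \<phi> r = root n (lam + c / r ^ n))) \<and>
       (even n \<longrightarrow> (\<forall>r\<in>{0<..<1}. lam + c / r ^ n > 0) \<and>
          ((\<forall>r\<in>{0<..<1}. \<phi> r = root n (lam + c / r ^ n)) \<or>
           (\<forall>r\<in>{0<..<1}. \<phi> r = - root n (lam + c / r ^ n)))))"
proof -
  let ?I = "{0<..<1::real}"
  have p1: "p \<ge> 1"
  proof -
    have "real n / (real n - 1) \<ge> 1" using n_ge_2 by simp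
    then show ?thesis using p_ge by simp
  qed
  obtain g where gm: "g \<in> borel_measurable borel"
    and prim: "\<And>a b. 0 < a \<Longrightarrow> b < 1 \<Longrightarrow> primitive_on a b \<phi> g"
    and gp: "\<And>a b. 0 < a \<Longrightarrow> b < 1 \<Longrightarrow> (\<lambda>r. \<bar>g r\<bar> powr p) absolutely_integrable_on {a..b}"
    by (rule W1p_loc_real_primitive[OF phi_W1p p1 phi_cont]) blast
  obtain A where A: "\<And>a b. 0 < a \<Longrightarrow> b < 1 \<Longrightarrow> primitive_on a b A (\<lambda>r. \<bar>g r\<bar> powr p)"
    using indefinite_integral_on_open_interval[of 0 1 "\<lambda>r. \<bar>g r\<bar> powr p"] gp by blast
  \<comment> \<open>Outside \<open>(0,1)\<close> the profile is arbitrary and possibly not measurable, so it is cut off there.\<close>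
  define \<phi>0 where "\<phi>0 r = indicator ?I r * \<phi> r" for r
  have \<phi>0: "\<phi>0 r = \<phi> r" if "r \<in> ?I" for r using that by (simp add: \<phi>0_def)
  have \<phi>0m: "\<phi>0 \<in> borel_measurable borel"
    using borel_measurable_continuous_on_indicator[OF _ phi_cont] by (simp add: \<phi>0_def[abs_def])
  have prim0: "primitive_on a b \<phi>0 g" if "0 < a" "b < 1" for a b
    by (rule primitive_on_cong[OF prim[OF that]]) (use that \<phi>0 in auto)
  have rad0: "u x = \<phi>0 (norm x) *\<^sub>R x" if "x \<in> ball 0 1" for x
    using u_radial[OF that] \<phi>0[of "norm x"] that by (cases "x = 0") auto
  have u_W: "W1p_loc 1 (ball 0 1) u" using u_sol by (simp add: weak_solution_def)
  have jac: "AE x in lebesgue. x \<in> ball 0 1 - {0} \<longrightarrow>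
      weak_jacobian (ball 0 1) u x = \<phi>0 (norm x) *\<^sub>R mat 1 + (g (norm x) / norm x) *\<^sub>R dyad x"
    by (rule weak_jacobian_radial[OF u_W rad0 prim0 \<phi>0m gm])
  define H where "H = (\<lambda>r. h (\<phi>0 r ^ (n - 1) * (\<phi>0 r + r * g r)))"
  define w where "w = (\<lambda>r. r ^ n * \<phi>0 r ^ (n - 1))"
  define w' where "w' = (\<lambda>r. real n * r ^ (n - 1) * \<phi>0 r ^ (n - 1) + r ^ n * (real (n - 1) * \<phi>0 r ^ (n - 2) * g r))"
  have n2: "CARD('n) \<ge> 2" using n_ge_2 n_def by simp
  note eqn = radial_equation[OF n2 h_cont \<phi>0m gm jac u_sol]
  have "(\<lambda>r. H r * w r) absolutely_integrable_on {a..b}" "(\<lambda>r. H r * w' r) absolutely_integrable_on {a..b}"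
    if "0 < a" "b < 1" for a b
    unfolding H_def w_def w'_def n_def using eqn(1,2)[OF that] by simp_all
  moreover have "(LINT t:?I|lebesgue. frechet_derivative \<eta> (at t) 1 * (H t * w t))
      = - (LINT t:?I|lebesgue. \<eta> t * (H t * w' t))" if "\<eta> \<in> C1c ?I" for \<eta>
    unfolding H_def w_def w'_def n_def by (rule eqn(3)[OF that])
  ultimately obtain P where P: "AE t in lebesgue. t \<in> ?I \<longrightarrow> H t * w t = P t"
    "\<And>a b. 0 < a \<Longrightarrow> b < 1 \<Longrightarrow> primitive_on a b P (\<lambda>r. H r * w' r)"
    using du_Bois_Reymond[OF zero_less_one, of "\<lambda>r. H r * w r" "\<lambda>r. H r * w' r"] by blast
  have first: "\<exists>C D. \<forall>r\<in>{l<..<m}. (r * \<phi> r) ^ n = C + D * r ^ n"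
    if lm: "0 \<le> l" "m \<le> 1" and ne: "\<And>r. r \<in> {l<..<m} \<Longrightarrow> \<phi> r \<noteq> 0" for l m
  proof (rule affine_in_power_from_subintervals)
    fix a b assume ab: "l < a" "a < b" "b < m"
    then have ab': "0 < a" "b < 1" using lm by auto
    have ae: "AE r in lebesgue. r \<in> {a..b} \<longrightarrow> H r * w r = P r"
      using P(1) by eventually_elim (use ab' in auto)
    have ne0: "\<phi>0 r \<noteq> 0" if "r \<in> {a..b}" for r using ne[of r] \<phi>0[of r] that ab ab' by auto
    obtain C D where CD: "\<And>r. r \<in> {a..b} \<Longrightarrow> (r * \<phi>0 r) ^ n = C + D * r ^ n"
      by (rule radial_equation_first_integral[OF H_def w_def w'_def n_ge_2 h_inj prim0[OF ab'] P(2)[OF ab'] ae ab'(1) ab(2) ne0]) blast+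
    have "(r * \<phi> r) ^ n = C + D * r ^ n" if "r \<in> {a..b}" for r
      using CD[OF that] \<phi>0[of r] that ab' by simp
    then show "\<exists>C D. \<forall>r\<in>{a..b}. (r * \<phi> r) ^ n = C + D * r ^ n" by blast
  qed (use n_ge_2 lm in auto)
  show ?thesis
  proof (cases "\<forall>r\<in>?I. \<phi> r = 0")
    case False
    then obtain r0 where r0: "r0 \<in> ?I" "\<phi> r0 \<noteq> 0" by blast
    have ne: "\<phi> r \<noteq> 0" if r: "r \<in> ?I" for r
    proof
      assume "\<phi> r = 0"
      then obtain s where s: "s \<in> ?I" "\<phi> s = 0" "s \<noteq> r0" "\<And>t. t \<in> open_segment s r0 \<Longrightarrow> \<phi> t \<noteq> 0"
        using nearest_zero[OF phi_cont r _ r0] by metis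
      show False
        by (rule no_interior_end_point[OF prim A n_ge_2 p_ge phi_cont first, of s r0])
           (use s r0 in auto)
    qed
    obtain C D where CD: "\<forall>r\<in>?I. (r * \<phi> r) ^ n = C + D * r ^ n"
      using first[of 0 1] ne by auto
    have pow: "\<phi> r ^ n = D + C / r ^ n" if r: "r \<in> ?I" for r
    proof -
      have "r ^ n \<noteq> 0" using r by simp
      moreover have "r ^ n * \<phi> r ^ n = C + D * r ^ n" using CD r by (simp add: power_mult_distrib)
      ultimately show ?thesis by (simp add: field_simps)
    qed
    have n0: "n > 0" using n_ge_2 by simp
    have "\<forall>r\<in>?I. \<phi> r = root n (D + C / r ^ n)" if "odd n"
      using pow odd_real_root_power_cancel[OF that] by metis
    moreover have "\<forall>r\<in>?I. D + C / r ^ n > 0" if "even n"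
      using pow ne that by (metis zero_less_power_eq)
    moreover have "(\<forall>r\<in>?I. \<phi> r = root n (D + C / r ^ n)) \<or> (\<forall>r\<in>?I. \<phi> r = - root n (D + C / r ^ n))" if "even n"
    proof -
      have "(\<forall>r\<in>?I. \<phi> r > 0) \<or> (\<forall>r\<in>?I. \<phi> r < 0)"
      proof (rule ccontr)
        assume "\<not> ((\<forall>r\<in>?I. \<phi> r > 0) \<or> (\<forall>r\<in>?I. \<phi> r < 0))"
        then obtain s t where st: "s \<in> ?I" "t \<in> ?I" "\<phi> s \<le> 0" "0 \<le> \<phi> t" by (meson not_le less_imp_le)
        have "connected (\<phi> ` ?I)" by (rule connected_continuous_image[OF phi_cont]) simp
        then have "0 \<in> \<phi> ` ?I" using st unfolding connected_iff_interval by blast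
        then show False using ne by auto
      qed
      then show ?thesis
      proof
        assume pos: "\<forall>r\<in>?I. \<phi> r > 0"
        have "\<phi> r = root n (D + C / r ^ n)" if "r \<in> ?I" for r
        proof -
          have "\<phi> r \<ge> 0" using pos that by (simp add: less_imp_le)
          from real_root_power_cancel[OF n0 this] show ?thesis unfolding pow[OF that] by (rule sym)
        qed
        then show ?thesis by blast
      next
        assume neg: "\<forall>r\<in>?I. \<phi> r < 0"
        have "\<phi> r = - root n (D + C / r ^ n)" if r: "r \<in> ?I" for r
        proof -
          have "(- \<phi> r) ^ n = D + C / r ^ n" using pow[OF r] \<open>even n\<close> by simp
          moreover have "root n ((- \<phi> r) ^ n) = - \<phi> r"
            using neg r by (intro real_root_power_cancel[OF n0]) (simp add: less_imp_le)
          ultimately show ?thesis by simp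
        qed
        then show ?thesis by blast
      qed
    qed
    ultimately show ?thesis using ne by blast
  qed simp
qed

end
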